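(* Let $\Sigma$ be a minimal $k$-dimensional submanifold of the hyperbolic space $\mathbb{H}^n$, let $O$ be an interior point of $\mathbb{H}^n$ and let $d$ be the hyperbolic distance from $O$ to $\Sigma$. Let $A(t)$ be the $k$-volume of $\Sigma_t=\{p\in\Sigma : \cosh \operatorname{dist}(O,p)\le t\}$. Let $a$ be any number in the interval $[1,\cosh d]$. Then the function $$\Phi_a(\Sigma,t)=\frac{A(t)}{Q_{-1}(a,t)},\qquad Q_{-1}(a,t)=\int_a^t (s^2-1)^{\frac k2-1}\,ds+\frac{1}{ka}(a^2-1)^{\frac k2},$$ is increasing in $t$.
   Context: $\mathbb{H}^n$ is the hyperbolic space of constant sectional curvature $-1$. Minimal means vanishing mean curvature. $\operatorname{dist}$ is the hyperbolic distance. "Increasing" is in the weak sense (nondecreasing).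
   Formalization: Σ is assumed to be a nonempty embedded submanifold without boundary that is closed in H^n (without closedness an open geodesic disc is a counterexample), and Φ_a is shown to be nondecreasing on those t ≥ 1 with Q_{-1}(a,t) ≠ 0. *)

theory Defs
  imports "HOL-Analysis.Analysis"
begin

text \<open>
  Hyperbolic \<open>n\<close>-space is the upper sheet of the unit hyperboloid in Minkowski space
  \<open>\<real> \<times> \<real>\<^sup>n\<close>, where \<open>n = CARD('n)\<close>, with the metric induced by the Minkowski form.
\<close>

type_synonym 'n mink = "real \<times> (real ^ 'n)"

definition mink_inner :: "'n::finite mink \<Rightarrow> 'n mink \<Rightarrow> real" where
  "mink_inner v w = snd v \<bullet> snd w - fst v * fst w"

definition hyp_space :: "'n::finite mink set" where
  "hyp_space = {p. mink_inner p p = -1 \<and> fst p > 0}"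

definition hyp_dist :: "'n::finite mink \<Rightarrow> 'n mink \<Rightarrow> real" where
  "hyp_dist p q = arcosh (- mink_inner p q)"

definition hyp_dist_set :: "'n::finite mink \<Rightarrow> 'n mink set \<Rightarrow> real" where
  "hyp_dist_set p S = (INF q\<in>S. hyp_dist p q)"


definition partial :: "'k::finite \<Rightarrow> (real ^ 'k \<Rightarrow> 'b::real_normed_vector) \<Rightarrow> real ^ 'k \<Rightarrow> 'b" where
  "partial i f x = frechet_derivative f (at x) (axis i 1)"

text \<open>The next two notions are used for open \<open>U\<close> only.\<close>

fun Ck_on :: "nat \<Rightarrow> (real ^ 'k::finite \<Rightarrow> 'b::real_normed_vector) \<Rightarrow> (real ^ 'k) set \<Rightarrow> bool" where
  "Ck_on 0 f U \<longleftrightarrow> continuous_on U f"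
| "Ck_on (Suc m) f U \<longleftrightarrow> f differentiable_on U \<and> (\<forall>i. Ck_on m (partial i f) U)"

definition smooth_on :: "(real ^ 'k::finite \<Rightarrow> 'b::real_normed_vector) \<Rightarrow> (real ^ 'k) set \<Rightarrow> bool" where
  "smooth_on f U \<longleftrightarrow> (\<forall>m. Ck_on m f U)"


text \<open>
  Embedded submanifolds of hyperbolic space of dimension \<open>k = CARD('k)\<close>, described by their
  smooth local parametrizations. They have no boundary, but need not be closed subsets.
\<close>

definition local_param ::
  "'n::finite mink set \<Rightarrow> (real ^ 'k::finite) set \<Rightarrow> (real ^ 'k \<Rightarrow> 'n mink) \<Rightarrow> bool" where
  "local_param S U \<phi> \<longleftrightarrow>
     open U \<and> smooth_on \<phi> U \<and>
     (\<forall>x\<in>U. inj (frechet_derivative \<phi> (at x))) \<and>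
     openin (top_of_set S) (\<phi> ` U) \<and> (\<exists>\<psi>. homeomorphism U (\<phi> ` U) \<phi> \<psi>)"

definition hyp_submanifold :: "'k::finite itself \<Rightarrow> 'n::finite mink set \<Rightarrow> bool" where
  "hyp_submanifold k S \<longleftrightarrow>
     S \<subseteq> hyp_space \<and>
     (\<forall>p\<in>S. \<exists>U (\<phi> :: real ^ 'k \<Rightarrow> 'n mink). local_param S U \<phi> \<and> p \<in> \<phi> ` U)"

definition first_fund :: "(real ^ 'k::finite \<Rightarrow> 'n::finite mink) \<Rightarrow> real ^ 'k \<Rightarrow> real ^ 'k ^ 'k" where
  "first_fund \<phi> x = (\<chi> i j. mink_inner (partial i \<phi> x) (partial j \<phi> x))"

text \<open>
  The component of \<open>v\<close> normal to the submanifold inside hyperbolic space: at \<open>p = \<phi> x\<close>, the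
  position vector \<open>p\<close> is normal to the hyperboloid and satisfies \<open>mink_inner p p = -1\<close>, so
  \<open>v + mink_inner v p *\<^sub>R p\<close> is the component of \<open>v\<close> tangent to hyperbolic space.
\<close>

definition normal_part ::
  "(real ^ 'k::finite \<Rightarrow> 'n::finite mink) \<Rightarrow> real ^ 'k \<Rightarrow> 'n mink \<Rightarrow> 'n mink" where
  "normal_part \<phi> x v =
     v + mink_inner v (\<phi> x) *\<^sub>R \<phi> x
       - (\<Sum>i\<in>UNIV. \<Sum>j\<in>UNIV.
            (matrix_inv (first_fund \<phi> x) $ i $ j * mink_inner v (partial i \<phi> x)) *\<^sub>R partial j \<phi> x)"

text \<open>
  The Levi-Civita connection of hyperbolic space is the tangential component of the flat
  derivative of Minkowski space, so the second fundamental form is the normal part of the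
  second derivatives of \<open>\<phi>\<close>.
\<close>

definition second_fund ::
  "(real ^ 'k::finite \<Rightarrow> 'n::finite mink) \<Rightarrow> real ^ 'k \<Rightarrow> 'k \<Rightarrow> 'k \<Rightarrow> 'n mink" where
  "second_fund \<phi> x i j = normal_part \<phi> x (partial i (partial j \<phi>) x)"

definition mean_curvature ::
  "(real ^ 'k::finite \<Rightarrow> 'n::finite mink) \<Rightarrow> real ^ 'k \<Rightarrow> 'n mink" where
  "mean_curvature \<phi> x =
     (\<Sum>i\<in>UNIV. \<Sum>j\<in>UNIV. (matrix_inv (first_fund \<phi> x) $ i $ j) *\<^sub>R second_fund \<phi> x i j)"

definition minimal_submanifold :: "'k::finite itself \<Rightarrow> 'n::finite mink set \<Rightarrow> bool" where
  "minimal_submanifold k S \<longleftrightarrow>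
     hyp_submanifold k S \<and>
     (\<forall>U (\<phi> :: real ^ 'k \<Rightarrow> 'n mink). local_param S U \<phi> \<longrightarrow> (\<forall>x\<in>U. mean_curvature \<phi> x = 0))"


text \<open>
  The Riemannian \<open>k\<close>-volume of a Borel subset \<open>T\<close> of \<open>S\<close>. Finitely many disjoint pieces
  \<open>\<phi> ` E\<close> of \<open>T\<close>, each lying in one parametrized patch, contribute the integral of the
  volume density over \<open>E\<close>. As \<open>S\<close> is covered by countably many patches, the supremum over all
  such families is the volume of \<open>T\<close>.
\<close>

definition patch_volume :: "(real ^ 'k::finite \<Rightarrow> 'n::finite mink) \<Rightarrow> (real ^ 'k) set \<Rightarrow> ennreal" where
  "patch_volume \<phi> E = (\<integral>\<^sup>+x\<in>E. ennreal (sqrt (det (first_fund \<phi> x))) \<partial>lborel)"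

definition patch_families ::
  "'n::finite mink set \<Rightarrow> 'n mink set \<Rightarrow> ((real ^ 'k::finite \<Rightarrow> 'n mink) \<times> (real ^ 'k) set) set set" where
  "patch_families S T =
     {F. finite F \<and>
         (\<forall>(\<phi>, E)\<in>F. E \<in> sets borel \<and> \<phi> ` E \<subseteq> T \<and> (\<exists>U. local_param S U \<phi> \<and> E \<subseteq> U)) \<and>
         disjoint_family_on (\<lambda>(\<phi>, E). \<phi> ` E) F}"

definition volume :: "'k::finite itself \<Rightarrow> 'n::finite mink set \<Rightarrow> 'n mink set \<Rightarrow> ennreal" where
  "volume k S T =
     (SUP F \<in> (patch_families S T :: ((real ^ 'k \<Rightarrow> 'n mink) \<times> (real ^ 'k) set) set set).
        \<Sum>(\<phi>, E)\<in>F. patch_volume \<phi> E)"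

definition sublevel :: "'n::finite mink set \<Rightarrow> 'n mink \<Rightarrow> real \<Rightarrow> 'n mink set" where
  "sublevel S c t = {p\<in>S. cosh (hyp_dist c p) \<le> t}"

definition A_vol :: "'k::finite itself \<Rightarrow> 'n::finite mink set \<Rightarrow> 'n mink \<Rightarrow> real \<Rightarrow> real" where
  "A_vol k S c t = enn2real (volume k S (sublevel S c t))"

definition Q_hyp :: "nat \<Rightarrow> real \<Rightarrow> real \<Rightarrow> real" where
  "Q_hyp k a t =
     (LBINT s=ereal a..ereal t. (s\<^sup>2 - 1) powr (real k / 2 - 1))
     + 1 / (real k * a) * (a\<^sup>2 - 1) powr (real k / 2)"

definition \<Phi>_hyp :: "'k::finite itself \<Rightarrow> 'n::finite mink set \<Rightarrow> 'n mink \<Rightarrow> real \<Rightarrow> real \<Rightarrow> real" where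
  "\<Phi>_hyp k S c a t = A_vol k S c t / Q_hyp CARD('k) a t"

end

theory Submission
  imports Defs
begin

text \<open>
  On a minimal submanifold the restriction \<open>f\<close> of \<open>p \<mapsto> - mink_inner c p\<close>, which is
  \<open>cosh (hyp_dist c p)\<close>, satisfies \<open>\<Delta> f = k f\<close> and \<open>\<bar>\<nabla>f\<bar>\<^sup>2 \<le> f\<^sup>2 - 1\<close>. Integrating
  \<open>div (h(f) \<nabla>f)\<close> gives \<open>\<integral> k f h(f) + h'(f) \<bar>\<nabla>f\<bar>\<^sup>2 = 0\<close> for every \<open>h\<close> that vanishes for large
  values. Choosing for \<open>h\<close> smoothings of a truncation of \<open>1 / P\<close>, where
  \<open>P(s) = (s\<^sup>2 - 1) powr (k / 2)\<close>, one finds that the weighted volume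
  \<open>B(t) = \<integral>\<^bsub>f \<le> t\<^esub> f\<close> has a nondecreasing quotient \<open>B / P\<close>.

  Both the volume and the denominator are recovered by the same operation:
  \<open>A(t) = B(t) / t + \<integral>\<^bsub>[a, t]\<^esub> B(s) / s\<^sup>2 ds\<close> and
  \<open>k Q(a, t) = P(t) / t + \<integral>\<^bsub>[a, t]\<^esub> P(s) / s\<^sup>2 ds\<close>, the summand
  \<open>(a\<^sup>2 - 1) powr (k / 2) / (k a)\<close> of \<open>Q\<close> being the boundary term at \<open>a\<close>. So
  \<open>A / (k Q)\<close> is an average of \<open>B / P\<close> over an increasing family of measures.
\<close>

section \<open>Change of variables over an arbitrary finite index type\<close>

text \<open>The library states the change of variables formula for well-ordered index types only.\<close>

typedef 'k wo_copy = "UNIV :: 'k set" by auto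

instantiation wo_copy :: (finite) "{finite, wellorder}"
begin

definition "x \<le> y \<longleftrightarrow> to_nat (Rep_wo_copy x) \<le> to_nat (Rep_wo_copy y)"
definition "x < y \<longleftrightarrow> to_nat (Rep_wo_copy x) < to_nat (Rep_wo_copy y)"

instance
proof
  show "finite (UNIV :: 'a wo_copy set)"
    unfolding type_definition.univ[OF type_definition_wo_copy] by simp
  fix x y z :: "'a wo_copy"
  show "x < y \<longleftrightarrow> x \<le> y \<and> \<not> y \<le> x" by (auto simp: less_eq_wo_copy_def less_wo_copy_def)
  show "x \<le> x" by (simp add: less_eq_wo_copy_def)
  show "x \<le> z" if "x \<le> y" "y \<le> z" using that by (simp add: less_eq_wo_copy_def)
  show "x = y" if "x \<le> y" "y \<le> x" using that by (simp add: less_eq_wo_copy_def Rep_wo_copy_inject)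
  show "x \<le> y \<or> y \<le> x" by (auto simp: less_eq_wo_copy_def)
  show "P w" if "\<And>x. (\<And>y. y < x \<Longrightarrow> P y) \<Longrightarrow> P x" for P and w :: "'a wo_copy"
    using that
    by (induction "to_nat (Rep_wo_copy w)" arbitrary: w rule: less_induct) (metis less_wo_copy_def)
qed

end

definition to_wo :: "real ^ 'k \<Rightarrow> real ^ 'k::finite wo_copy" where
  "to_wo x = (\<chi> i. x $ Rep_wo_copy i)"

definition of_wo :: "real ^ 'k::finite wo_copy \<Rightarrow> real ^ 'k" where
  "of_wo x = (\<chi> i. x $ Abs_wo_copy i)"

lemma to_of_wo [simp]: "to_wo (of_wo x) = x" "of_wo (to_wo y) = y"
  by (simp_all add: to_wo_def of_wo_def vec_eq_iff Rep_wo_copy_inverse Abs_wo_copy_inverse)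

lemma bij_Rep_wo: "bij (Rep_wo_copy :: 'k wo_copy \<Rightarrow> 'k)"
  by (metis Abs_wo_copy_inverse Rep_wo_copy_inverse UNIV_I bijI')

lemma linear_to_wo: "linear to_wo" and linear_of_wo: "linear of_wo"
  by (auto intro!: linearI simp: to_wo_def of_wo_def vec_eq_iff)

lemmas bounded_linear_to_wo = linear_to_wo[unfolded linear_conv_bounded_linear]
lemmas bounded_linear_of_wo = linear_of_wo[unfolded linear_conv_bounded_linear]

lemma borel_measurable_to_wo [measurable]: "to_wo \<in> borel_measurable borel"
  and borel_measurable_of_wo [measurable]: "of_wo \<in> borel_measurable borel"
  using bounded_linear_to_wo bounded_linear_of_wo
  by (auto intro!: borel_measurable_continuous_onI linear_continuous_on)

lemma prod_Basis_cart:
  fixes l u :: "real ^ 'n::finite"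
  shows "(\<Prod>b\<in>Basis. (u - l) \<bullet> b) = (\<Prod>i\<in>UNIV. u $ i - l $ i)"
proof -
  have "Basis = range (\<lambda>i::'n. axis i (1::real))" by (auto simp: Basis_vec_def)
  moreover have "inj (\<lambda>i::'n. axis i (1::real))" by (auto simp: inj_on_def axis_eq_axis)
  ultimately have "(\<Prod>b\<in>Basis. (u - l) \<bullet> b) = (\<Prod>i\<in>UNIV. (u - l) \<bullet> axis i 1)"
    by (metis (no_types, lifting) prod.reindex_cong)
  then show ?thesis by (simp add: inner_axis)
qed

lemma lborel_distr_to_wo: "distr lborel borel to_wo = (lborel :: (real ^ 'k::finite wo_copy) measure)"
proof (rule lborel_eqI[symmetric])
  fix l u :: "real ^ 'k wo_copy"
  assume le: "\<And>b. b \<in> Basis \<Longrightarrow> l \<bullet> b \<le> u \<bullet> b"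
  have le': "l $ i \<le> u $ i" for i
    using le[of "axis i 1"] by (auto simp: Basis_vec_def inner_axis)
  have "to_wo -` box l u = box (of_wo l) (of_wo u)"
    by (auto simp: mem_box_cart to_wo_def of_wo_def) (metis Abs_wo_copy_inverse Rep_wo_copy_inverse UNIV_I)+
  then have "emeasure (distr lborel borel to_wo) (box l u) = emeasure lborel (box (of_wo l) (of_wo u))"
    by (subst emeasure_distr) auto
  also have "\<dots> = ennreal (\<Prod>b\<in>Basis. (of_wo u - of_wo l) \<bullet> b)"
    using le' by (intro emeasure_lborel_box) (auto simp: Basis_vec_def inner_axis of_wo_def)
  also have "(\<Prod>b\<in>Basis. (of_wo u - of_wo l) \<bullet> b) = (\<Prod>i\<in>UNIV. of_wo u $ i - of_wo l $ i)"
    by (rule prod_Basis_cart)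
  also have "\<dots> = (\<Prod>i\<in>UNIV. u $ i - l $ i)"
    by (subst prod.reindex_bij_betw[OF bij_Rep_wo, symmetric]) (simp add: of_wo_def Rep_wo_copy_inverse)
  also have "\<dots> = (\<Prod>b\<in>Basis. (u - l) \<bullet> b)" by (rule prod_Basis_cart[symmetric])
  finally show "emeasure (distr lborel borel to_wo) (box l u) = (\<Prod>b\<in>Basis. (u - l) \<bullet> b)" by simp
qed simp

lemma nn_integral_to_wo:
  assumes "h \<in> borel_measurable borel"
  shows "(\<integral>\<^sup>+y. h y \<partial>(lborel :: (real ^ 'k::finite wo_copy) measure)) = (\<integral>\<^sup>+x. h (to_wo x) \<partial>lborel)"
  using assms by (subst lborel_distr_to_wo[symmetric]) (auto simp: nn_integral_distr)

lemma det_to_wo: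
  fixes A :: "real ^ 'k::finite \<Rightarrow> real ^ 'k"
  assumes "linear A"
  shows "det (matrix (\<lambda>v. to_wo (A (of_wo v)))) = det (matrix A)"
proof -
  let ?R = "Rep_wo_copy :: 'k wo_copy \<Rightarrow> 'k"
  have ax: "of_wo (axis j 1) = axis (?R j) 1" for j :: "'k wo_copy"
    by (auto simp: of_wo_def axis_def vec_eq_iff Abs_wo_copy_inverse Rep_wo_copy_inverse)
  have entry: "matrix (\<lambda>v. to_wo (A (of_wo v))) $ i $ j = matrix A $ ?R i $ ?R j" for i j
    by (simp add: matrix_def ax to_wo_def)
  have bij: "bij_betw (map_permutation UNIV ?R) {p. p permutes UNIV} {p. p permutes UNIV}"
    using bij_betw_permutations[OF bij_Rep_wo]
    by (simp add: map_permutation_def[abs_def] restrict_id_def[abs_def] o_def bij_is_surj[OF bij_Rep_wo])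
  have "det (matrix A) = (\<Sum>p\<in>{p. p permutes (UNIV :: 'k wo_copy set)}.
      of_int (sign (map_permutation UNIV ?R p)) *
      (\<Prod>i\<in>UNIV. matrix A $ i $ map_permutation UNIV ?R p i))"
    unfolding det_def by (rule sum.reindex_bij_betw[OF bij, symmetric])
  also have "\<dots> = (\<Sum>p\<in>{p. p permutes (UNIV :: 'k wo_copy set)}.
      of_int (sign p) * (\<Prod>i\<in>UNIV. matrix A $ ?R i $ ?R (p i)))"
  proof (intro sum.cong refl arg_cong2[where f = "(*)"])
    fix p :: "'k wo_copy \<Rightarrow> 'k wo_copy" assume p: "p \<in> {p. p permutes UNIV}"
    have inj: "inj ?R" using bij_Rep_wo bij_is_inj by blast
    show "of_int (sign (map_permutation UNIV ?R p)) = (of_int (sign p) :: real)"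
      using p inj by (subst sign_map_permutation) auto
    have "(\<Prod>i\<in>UNIV. matrix A $ i $ map_permutation UNIV ?R p i) =
        (\<Prod>i\<in>UNIV. matrix A $ ?R i $ map_permutation UNIV ?R p (?R i))"
      by (rule prod.reindex_bij_betw[OF bij_Rep_wo, symmetric])
    then show "(\<Prod>i\<in>UNIV. matrix A $ i $ map_permutation UNIV ?R p i) =
        (\<Prod>i\<in>UNIV. matrix A $ ?R i $ ?R (p i))"
      using inj by (simp add: map_permutation_apply)
  qed
  finally show ?thesis by (simp add: det_def entry)
qed

lemma nn_integral_eq_if_integrable_iff:
  assumes "f \<in> borel_measurable M" "g \<in> borel_measurable N"
    and "\<And>x. 0 \<le> f x" "\<And>x. 0 \<le> g x"
    and "integrable M f \<longleftrightarrow> integrable N g"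
    and "integrable M f \<Longrightarrow> integral\<^sup>L M f = integral\<^sup>L N g"
  shows "(\<integral>\<^sup>+x. ennreal (f x) \<partial>M) = (\<integral>\<^sup>+x. ennreal (g x) \<partial>N)"
proof (cases "integrable M f")
  case True
  then show ?thesis using assms by (simp add: nn_integral_eq_integral)
next
  case False
  then have "\<not> integrable N g" using assms by simp
  then show ?thesis using False assms
    by (metis ennreal_0 infinity_ennreal_def integrableI_nonneg nn_integral_cong top.not_eq_extremum AE_I2)
qed


lemma nn_integral_change_of_variables_wo:
  fixes f :: "real ^ 'k::{finite,wellorder} \<Rightarrow> real" and g :: "real ^ 'k::_ \<Rightarrow> real ^ 'k::_"
  assumes E: "E \<in> sets borel" "g ` E \<in> sets borel"
    and der: "\<And>x. x \<in> E \<Longrightarrow> (g has_derivative g' x) (at x)"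
    and inj: "inj_on g E"
    and f: "set_borel_measurable borel (g ` E) f" "\<And>x. 0 \<le> f x"
    and m: "set_borel_measurable borel E (\<lambda>x. \<bar>det (matrix (g' x))\<bar> * f (g x))"
  shows "(\<integral>\<^sup>+y\<in>g ` E. ennreal (f y) \<partial>lborel) =
         (\<integral>\<^sup>+x\<in>E. ennreal (\<bar>det (matrix (g' x))\<bar> * f (g x)) \<partial>lborel)"
proof -
  let ?J = "\<lambda>x. \<bar>det (matrix (g' x))\<bar> * f (g x)"
  let ?a = "\<lambda>y. indicator (g ` E) y * f y"
  let ?b = "\<lambda>x. indicator E x * ?J x"
  have cov: "((\<lambda>x. \<bar>det (matrix (g' x))\<bar> *\<^sub>R (vec (f (g x)) :: real ^ 1)) absolutely_integrable_on E \<and>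
           integral E (\<lambda>x. \<bar>det (matrix (g' x))\<bar> *\<^sub>R (vec (f (g x)) :: real ^ 1)) = b)
     \<longleftrightarrow> ((\<lambda>y. vec (f y) :: real ^ 1) absolutely_integrable_on (g ` E) \<and> integral (g ` E) (\<lambda>y. vec (f y)) = b)" for b
    by (rule has_absolute_integral_change_of_variables)
      (use E der inj in \<open>auto intro: has_derivative_at_withinI\<close>)
  have c1: "(\<lambda>x. \<bar>det (matrix (g' x))\<bar> *\<^sub>R (vec (f (g x)) :: real ^ 1)) = (\<lambda>x. vec (?J x))"
    by (simp add: vec_eq_iff fun_eq_iff)
  have cov': "?J absolutely_integrable_on E \<and>
           integral E ?J = b
     \<longleftrightarrow> f absolutely_integrable_on (g ` E) \<and> integral (g ` E) f = b" for b
    using cov[of "vec b"] unfolding c1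
    by (simp add: absolutely_integrable_on_1_iff integral_on_1_eq vec_eq_iff)
  have bor: "?a \<in> borel_measurable borel" "?b \<in> borel_measurable borel"
    using f m by (auto simp: set_borel_measurable_def)
  have int_iff: "integrable lborel ?b \<longleftrightarrow> ?J absolutely_integrable_on E"
    "integrable lborel ?a \<longleftrightarrow> f absolutely_integrable_on (g ` E)"
    using bor by (simp_all add: set_integrable_def integrable_completion)
  have "(\<integral>\<^sup>+y. ennreal (?a y) \<partial>lborel) = (\<integral>\<^sup>+x. ennreal (?b x) \<partial>lborel)"
  proof (rule nn_integral_eq_if_integrable_iff)
    show "integrable lborel ?a \<longleftrightarrow> integrable lborel ?b" unfolding int_iff using cov' by blast
    assume "integrable lborel ?a"
    then have A: "f absolutely_integrable_on (g ` E)" and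
      B: "?J absolutely_integrable_on E"
      unfolding int_iff using cov' by blast+
    have "integral\<^sup>L lborel ?a = integral (g ` E) f"
      using set_lebesgue_integral_eq_integral(2)[OF A] bor
      by (simp add: set_lebesgue_integral_def integral_completion)
    moreover have "integral\<^sup>L lborel ?b = integral E ?J"
      using set_lebesgue_integral_eq_integral(2)[OF B] bor
      by (simp add: set_lebesgue_integral_def integral_completion)
    ultimately show "integral\<^sup>L lborel ?a = integral\<^sup>L lborel ?b" using A cov' by metis
  qed (use bor f(2) in auto)
  moreover have "ennreal (indicator A x * c) = ennreal c * indicator A x" for A :: "(real ^ 'k::_) set" and x c
    by (simp add: indicator_def)
  ultimately show ?thesis by simp
qed

lemma nn_integral_change_of_variables:
  fixes f :: "real ^ 'k::finite \<Rightarrow> real" and g :: "real ^ 'k \<Rightarrow> real ^ 'k"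
  assumes E: "E \<in> sets borel" "g ` E \<in> sets borel"
    and der: "\<And>x. x \<in> E \<Longrightarrow> (g has_derivative g' x) (at x)"
    and inj: "inj_on g E"
    and f: "set_borel_measurable borel (g ` E) f" "\<And>x. 0 \<le> f x"
    and m: "set_borel_measurable borel E (\<lambda>x. \<bar>det (matrix (g' x))\<bar> * f (g x))"
  shows "(\<integral>\<^sup>+y\<in>g ` E. ennreal (f y) \<partial>lborel) =
         (\<integral>\<^sup>+x\<in>E. ennreal (\<bar>det (matrix (g' x))\<bar> * f (g x)) \<partial>lborel)"
proof -
  let ?J = "\<lambda>x. \<bar>det (matrix (g' x))\<bar> * f (g x)"
  let ?E = "of_wo -` E" and ?g = "\<lambda>x. to_wo (g (of_wo x))"
  let ?g' = "\<lambda>x v. to_wo (g' (of_wo x) (of_wo v))"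
  let ?f = "\<lambda>x. f (of_wo x)"
  have im: "?g ` ?E = of_wo -` (g ` E)"
  proof (intro equalityI subsetI)
    fix y assume "y \<in> of_wo -` (g ` E)"
    then obtain x where "x \<in> E" "of_wo y = g x" by auto
    then have "y = ?g (to_wo x)" "to_wo x \<in> ?E" by (metis to_of_wo(1,2), simp)
    then show "y \<in> ?g ` ?E" by blast
  qed auto
  have det: "det (matrix (?g' x)) = det (matrix (g' (of_wo x)))" if "x \<in> ?E" for x
    using det_to_wo[of "g' (of_wo x)"] der that has_derivative_linear by fastforce
  have ind: "indicator (?g ` ?E) x = indicator (g ` E) (of_wo x)"
       "indicator ?E x = (indicator E (of_wo x))" for x
    unfolding im by (auto simp: indicator_def)
  have "(\<integral>\<^sup>+y\<in>?g ` ?E. ennreal (?f y) \<partial>lborel) =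
         (\<integral>\<^sup>+x\<in>?E. ennreal (\<bar>det (matrix (?g' x))\<bar> * ?f (?g x)) \<partial>lborel)"
  proof (rule nn_integral_change_of_variables_wo)
    show "?E \<in> sets borel" using measurable_sets[OF borel_measurable_of_wo E(1)] by simp
    show "?g ` ?E \<in> sets borel"
      unfolding im using measurable_sets[OF borel_measurable_of_wo E(2)] by simp
    show "(?g has_derivative ?g' x) (at x)" if "x \<in> ?E" for x
    proof -
      have "(of_wo has_derivative of_wo) (at x)" "(to_wo has_derivative to_wo) (at (g (of_wo x)))"
        by (intro bounded_linear_imp_has_derivative bounded_linear_of_wo bounded_linear_to_wo)+
      with der[of "of_wo x"] that show ?thesis
        using diff_chain_at[of of_wo of_wo x g "g' (of_wo x)"]
          diff_chain_at[of "\<lambda>x. g (of_wo x)" "\<lambda>v. g' (of_wo x) (of_wo v)" x to_wo to_wo]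
        by (simp add: o_def)
    qed
    show "inj_on ?g ?E" by (rule inj_onI) (metis inj inj_onD to_of_wo vimageD)
    show "set_borel_measurable borel (?g ` ?E) ?f"
      unfolding im using measurable_compose[OF borel_measurable_of_wo f(1)[unfolded set_borel_measurable_def]]
      by (simp add: set_borel_measurable_def indicator_def cong: if_cong)
    have "(\<lambda>x. indicator ?E x *\<^sub>R (\<bar>det (matrix (?g' x))\<bar> * ?f (?g x))) =
        (\<lambda>x. indicator E (of_wo x) *\<^sub>R ?J (of_wo x))"
      by (auto simp: indicator_def fun_eq_iff det)
    then show "set_borel_measurable borel ?E (\<lambda>x. \<bar>det (matrix (?g' x))\<bar> * ?f (?g x))"
      using measurable_compose[OF borel_measurable_of_wo m[unfolded set_borel_measurable_def]]
      by (simp add: set_borel_measurable_def)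
  qed (use f in simp)
  moreover have "(\<integral>\<^sup>+y\<in>?g ` ?E. ennreal (?f y) \<partial>lborel) = (\<integral>\<^sup>+y\<in>g ` E. ennreal (f y) \<partial>lborel)"
  proof -
    have "(\<lambda>y. ennreal (f y) * indicator (g ` E) y) = (\<lambda>y. ennreal (indicator (g ` E) y *\<^sub>R f y))"
      by (auto simp: indicator_def)
    then have [measurable]: "(\<lambda>y. ennreal (f y) * indicator (g ` E) y) \<in> borel_measurable borel"
      using f(1) unfolding set_borel_measurable_def by auto
    show ?thesis by (subst nn_integral_to_wo) (auto simp: ind)
  qed
  moreover have "(\<integral>\<^sup>+x\<in>?E. ennreal (\<bar>det (matrix (?g' x))\<bar> * ?f (?g x)) \<partial>lborel) =
     (\<integral>\<^sup>+x\<in>E. ennreal (?J x) \<partial>lborel)"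
  proof -
    have *: "(\<lambda>x. ennreal (?J x) * indicator E x) =
       (\<lambda>x. ennreal (indicator E x *\<^sub>R ?J x))"
      by (auto simp: indicator_def)
    have [measurable]: "(\<lambda>x. ennreal (?J x) * indicator E x) \<in> borel_measurable borel"
      using m unfolding set_borel_measurable_def * by auto
    have "(\<lambda>x. ennreal (\<bar>det (matrix (?g' x))\<bar> * ?f (?g x)) * indicator ?E x) =
       (\<lambda>x. (\<lambda>x. ennreal (?J x) * indicator E x) (of_wo x))"
      by (auto simp: indicator_def fun_eq_iff det)
    then show ?thesis by (simp add: nn_integral_to_wo)
  qed
  ultimately show ?thesis by simp
qed

section \<open>Continuously differentiable functions on open sets\<close>

lemma partial_eq:
  assumes "(f has_derivative f') (at x)"
  shows "partial i f x = f' (axis i 1)"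
  using frechet_derivative_at[OF assms] by (simp add: partial_def)

lemma partial_cong:
  assumes "open U" "x \<in> U" "\<And>y. y \<in> U \<Longrightarrow> f y = g y"
  shows "partial i f x = partial i g x"
proof -
  have "(f has_derivative D) (at x) \<longleftrightarrow> (g has_derivative D) (at x)" for D
  proof
    show "(g has_derivative D) (at x)" if "(f has_derivative D) (at x)"
      by (rule has_derivative_transform_within_open[OF that assms(1,2)]) (rule assms(3))
    show "(f has_derivative D) (at x)" if "(g has_derivative D) (at x)"
      by (rule has_derivative_transform_within_open[OF that assms(1,2)]) (rule assms(3)[symmetric])
  qed
  then show ?thesis unfolding partial_def frechet_derivative_def by presburger
qed

definition C1_on :: "(real ^ 'k::finite \<Rightarrow> 'b::real_normed_vector) \<Rightarrow> (real ^ 'k) set \<Rightarrow> bool" where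
  "C1_on f U \<longleftrightarrow> (\<forall>x\<in>U. f differentiable (at x)) \<and> (\<forall>i. continuous_on U (partial i f))"

lemma C1_onI:
  assumes "\<And>x. x \<in> U \<Longrightarrow> (f has_derivative f' x) (at x)"
    and "\<And>i. continuous_on U (\<lambda>x. f' x (axis i 1))"
  shows "C1_on f U"
  unfolding C1_on_def
proof (intro conjI ballI allI)
  show "f differentiable (at x)" if "x \<in> U" for x
    using assms(1) that differentiable_def by blast
  show "continuous_on U (partial i f)" for i
    by (rule continuous_on_eq[OF assms(2)]) (rule partial_eq[OF assms(1), symmetric])
qed

lemma C1_on_has_derivative:
  assumes "C1_on f U" "x \<in> U"
  shows "(f has_derivative frechet_derivative f (at x)) (at x)"
  using assms by (simp add: C1_on_def frechet_derivative_works)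

lemma frechet_derivative_partial:
  assumes "f differentiable (at x)"
  shows "frechet_derivative f (at x) h = (\<Sum>i\<in>UNIV. h $ i *\<^sub>R partial i f x)"
proof -
  have lin: "linear (frechet_derivative f (at x))"
    using assms by (simp add: linear_frechet_derivative)
  have "h = (\<Sum>i\<in>UNIV. h $ i *\<^sub>R axis i 1)"
    using basis_expansion[of h, symmetric] unfolding scalar_mult_eq_scaleR .
  then have "frechet_derivative f (at x) h = frechet_derivative f (at x) (\<Sum>i\<in>UNIV. h $ i *\<^sub>R axis i 1)"
    by (rule arg_cong)
  also have "\<dots> = (\<Sum>i\<in>UNIV. h $ i *\<^sub>R partial i f x)"
    unfolding linear_sum[OF lin] linear_scale[OF lin] partial_def ..
  finally show ?thesis .
qed

lemma C1_on_continuous: "C1_on f U \<Longrightarrow> continuous_on U f"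
  by (simp add: C1_on_def continuous_at_imp_continuous_on differentiable_imp_continuous_within)

lemma C1_on_cong:
  assumes "C1_on f U" "open U" "\<And>y. y \<in> U \<Longrightarrow> f y = g y"
  shows "C1_on g U"
proof (rule C1_onI)
  show "(g has_derivative frechet_derivative f (at x)) (at x)" if "x \<in> U" for x
    by (rule has_derivative_transform_within_open[OF C1_on_has_derivative[OF assms(1) that] assms(2) that])
      (rule assms(3))
  show "continuous_on U (\<lambda>x. frechet_derivative f (at x) (axis i 1))" for i
    using assms(1) unfolding C1_on_def partial_def[abs_def] by blast
qed

lemma C1_on_const [simp]: "C1_on (\<lambda>x. c) U"
  by (rule C1_onI[where f' = "\<lambda>_ _. 0"]) simp_all

lemma C1_on_bilinear:
  assumes "bounded_bilinear b" "C1_on f U" "C1_on g U"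
  shows "C1_on (\<lambda>x. b (f x) (g x)) U"
    and "x \<in> U \<Longrightarrow> partial i (\<lambda>x. b (f x) (g x)) x = b (f x) (partial i g x) + b (partial i f x) (g x)"
proof -
  have der: "((\<lambda>x. b (f x) (g x)) has_derivative (\<lambda>h. b (f x) (frechet_derivative g (at x) h) + b (frechet_derivative f (at x) h) (g x))) (at x)" if "x \<in> U" for x
    using bounded_bilinear.FDERIV[OF assms(1) C1_on_has_derivative[OF assms(2) that] C1_on_has_derivative[OF assms(3) that]] .
  have "continuous_on U (\<lambda>x. b (f x) (partial i g x) + b (partial i f x) (g x))" for i
    using assms C1_on_continuous[OF assms(2)] C1_on_continuous[OF assms(3)] unfolding C1_on_def
    by (intro continuous_on_add bounded_bilinear.continuous_on[OF assms(1)]) auto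
  then show "C1_on (\<lambda>x. b (f x) (g x)) U"
    by (intro C1_onI[OF der]) (simp_all add: partial_def[symmetric])
  show "x \<in> U \<Longrightarrow> partial i (\<lambda>x. b (f x) (g x)) x = b (f x) (partial i g x) + b (partial i f x) (g x)"
    using partial_eq[OF der] by (simp add: partial_def)
qed

lemmas C1_on_mult = C1_on_bilinear[OF bounded_bilinear_mult]
lemmas C1_on_scaleR = C1_on_bilinear[OF bounded_bilinear_scaleR]
lemmas C1_on_inner = C1_on_bilinear[OF bounded_bilinear_inner]

lemma C1_on_sum:
  assumes "\<And>j. j \<in> J \<Longrightarrow> C1_on (f j) U"
  shows "C1_on (\<lambda>x. \<Sum>j\<in>J. f j x) U"
    and "x \<in> U \<Longrightarrow> partial i (\<lambda>x. \<Sum>j\<in>J. f j x) x = (\<Sum>j\<in>J. partial i (f j) x)"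
proof -
  have der: "((\<lambda>x. \<Sum>j\<in>J. f j x) has_derivative (\<lambda>h. \<Sum>j\<in>J. frechet_derivative (f j) (at x) h)) (at x)" if "x \<in> U" for x
    using C1_on_has_derivative[OF assms] that by (intro has_derivative_sum) auto
  show "C1_on (\<lambda>x. \<Sum>j\<in>J. f j x) U"
    using assms unfolding C1_on_def
    by (intro C1_onI[OF der, unfolded C1_on_def]) (auto simp: partial_def[symmetric] intro!: continuous_on_sum)
  show "x \<in> U \<Longrightarrow> partial i (\<lambda>x. \<Sum>j\<in>J. f j x) x = (\<Sum>j\<in>J. partial i (f j) x)"
    using partial_eq[OF der] by (simp add: partial_def)
qed

lemma C1_on_real_compose:
  fixes f :: "real ^ 'k::finite \<Rightarrow> real"
  assumes "C1_on f U" "\<And>x. x \<in> U \<Longrightarrow> (g has_real_derivative g' (f x)) (at (f x))"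
    and "continuous_on U (\<lambda>x. g' (f x))"
  shows "C1_on (\<lambda>x. g (f x)) U"
    and "x \<in> U \<Longrightarrow> partial i (\<lambda>x. g (f x)) x = g' (f x) * partial i f x"
proof -
  have der: "((\<lambda>x. g (f x)) has_derivative (\<lambda>h. g' (f x) * frechet_derivative f (at x) h)) (at x)" if "x \<in> U" for x
    using diff_chain_at[OF C1_on_has_derivative[OF assms(1) that] assms(2)[OF that, unfolded has_field_derivative_def]]
    by (simp add: o_def)
  show "C1_on (\<lambda>x. g (f x)) U"
    using assms(1,3) unfolding C1_on_def
    by (intro C1_onI[OF der, unfolded C1_on_def]) (auto simp: partial_def[symmetric] intro!: continuous_intros)
  show "x \<in> U \<Longrightarrow> partial i (\<lambda>x. g (f x)) x = g' (f x) * partial i f x"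
    using partial_eq[OF der] by (simp add: partial_def)
qed

lemma C1_on_prod:
  fixes f :: "'j \<Rightarrow> real ^ 'k::finite \<Rightarrow> real"
  assumes "finite J" "\<And>j. j \<in> J \<Longrightarrow> C1_on (f j) U"
  shows "C1_on (\<lambda>x. \<Prod>j\<in>J. f j x) U"
    and "x \<in> U \<Longrightarrow> partial i (\<lambda>x. \<Prod>j\<in>J. f j x) x = (\<Sum>j\<in>J. partial i (f j) x * (\<Prod>l\<in>J - {j}. f l x))"
proof -
  have der: "((\<lambda>x. \<Prod>j\<in>J. f j x) has_derivative (\<lambda>h. \<Sum>j\<in>J. frechet_derivative (f j) (at x) h * (\<Prod>l\<in>J - {j}. f l x))) (at x)" if "x \<in> U" for x
    using C1_on_has_derivative[OF assms(2)] that by (intro has_derivative_prod) auto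
  show "C1_on (\<lambda>x. \<Prod>j\<in>J. f j x) U"
    using assms C1_on_continuous[OF assms(2)] unfolding C1_on_def
    by (intro C1_onI[OF der, unfolded C1_on_def])
      (auto simp: partial_def[symmetric] intro!: continuous_on_sum continuous_on_mult continuous_on_prod)
  show "x \<in> U \<Longrightarrow> partial i (\<lambda>x. \<Prod>j\<in>J. f j x) x = (\<Sum>j\<in>J. partial i (f j) x * (\<Prod>l\<in>J - {j}. f l x))"
    using partial_eq[OF der] by (simp add: partial_def)
qed

lemma C1_on_divide:
  fixes f g :: "real ^ 'k::finite \<Rightarrow> real"
  assumes "C1_on f U" "C1_on g U" "\<And>x. x \<in> U \<Longrightarrow> g x \<noteq> 0"
  shows "C1_on (\<lambda>x. f x / g x) U"
proof -
  have "C1_on (\<lambda>x. inverse (g x)) U"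
  proof (rule C1_on_real_compose(1)[OF assms(2)])
    show "(inverse has_real_derivative - (inverse (g x) ^ Suc (Suc 0))) (at (g x))" if "x \<in> U" for x
      using DERIV_inverse[OF assms(3)[OF that]] .
    show "continuous_on U (\<lambda>x. - (inverse (g x) ^ Suc (Suc 0)))"
      using C1_on_continuous[OF assms(2)] assms(3) by (intro continuous_intros) auto
  qed
  from C1_on_mult(1)[OF assms(1) this] show ?thesis
    by (simp add: divide_inverse)
qed

lemma C1_on_det:
  fixes A :: "real ^ 'k::finite \<Rightarrow> real ^ 'm::finite ^ 'm"
  assumes "\<And>i j. C1_on (\<lambda>x. A x $ i $ j) U"
  shows "C1_on (\<lambda>x. det (A x)) U"
    and "x \<in> U \<Longrightarrow> partial m (\<lambda>x. det (A x)) x =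
      (\<Sum>i\<in>UNIV. det (\<chi> r. if r = i then (\<chi> j. partial m (\<lambda>x. A x $ i $ j) x) else A x $ r))"
proof -
  let ?P = "{p. p permutes (UNIV :: 'm set)}"
  have C: "C1_on (\<lambda>x. of_int (sign p) * (\<Prod>i\<in>UNIV. A x $ i $ p i)) U" for p
    by (intro C1_on_mult(1) C1_on_const C1_on_prod(1) assms) auto
  show "C1_on (\<lambda>x. det (A x)) U" unfolding det_def by (intro C1_on_sum(1) C)
  assume x: "x \<in> U"
  let ?d = "\<lambda>i j. partial m (\<lambda>x. A x $ i $ j) x"
  have "partial m (\<lambda>x. of_int (sign p) * (\<Prod>i\<in>UNIV. A x $ i $ p i)) x =
      of_int (sign p) * (\<Sum>i\<in>UNIV. ?d i (p i) * (\<Prod>l\<in>UNIV - {i}. A x $ l $ p l))" for p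
    using x assms by (subst C1_on_mult(2)[where U = U]; (intro C1_on_const C1_on_prod(1))?)
      (auto simp: C1_on_prod(2)[where U = U] partial_eq[OF has_derivative_const])
  then have "partial m (\<lambda>x. det (A x)) x =
      (\<Sum>p\<in>?P. of_int (sign p) * (\<Sum>i\<in>UNIV. ?d i (p i) * (\<Prod>l\<in>UNIV - {i}. A x $ l $ p l)))"
    unfolding det_def by (subst C1_on_sum(2)[OF C x]) simp
  also have "\<dots> = (\<Sum>i\<in>UNIV. \<Sum>p\<in>?P. of_int (sign p) * (?d i (p i) * (\<Prod>l\<in>UNIV - {i}. A x $ l $ p l)))"
    unfolding sum_distrib_left by (rule sum.swap)
  also have "\<dots> = (\<Sum>i\<in>UNIV. det (\<chi> r. if r = i then (\<chi> j. ?d i j) else A x $ r))"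
    unfolding det_def
    by (intro sum.cong refl arg_cong2[where f = "(*)"], subst prod.remove[of UNIV]) (auto intro!: prod.cong)
  finally show "partial m (\<lambda>x. det (A x)) x =
      (\<Sum>i\<in>UNIV. det (\<chi> r. if r = i then (\<chi> j. ?d i j) else A x $ r))" .
qed

lemma det_replace_row:
  fixes A B :: "real ^ 'm::finite ^ 'm"
  assumes "B ** A = mat 1"
  shows "det (\<chi> r. if r = i then a else A $ r) = (\<Sum>j\<in>UNIV. a $ j * B $ j $ i) * det A"
proof -
  have "(\<Sum>r\<in>UNIV. (a v* B) $ r *s row r A) = transpose A *v (a v* B)"
    by (simp add: matrix_mult_sum column_transpose)
  also have "\<dots> = a v* (B ** A)" by (simp add: transpose_matrix_vector vector_matrix_mul_assoc)
  also have "\<dots> = a" by (simp add: assms)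
  finally have *: "(\<Sum>r\<in>UNIV. (a v* B) $ r *s row r A) = a" .
  have "det (\<chi> r. if r = i then a else row r A) = (a v* B) $ i * det A"
    using cramer_lemma_transpose[of i "a v* B" A] unfolding * .
  moreover have "row r A = A $ r" for r
    by (simp add: row_def)
  ultimately have "det (\<chi> r. if r = i then a else A $ r) = (a v* B) $ i * det A" by (simp only:)
  then show ?thesis by (simp add: vector_matrix_mult_def mult.commute)
qed

lemma partial_det:
  fixes A :: "real ^ 'k::finite \<Rightarrow> real ^ 'm::finite ^ 'm"
  assumes "\<And>i j. C1_on (\<lambda>x. A x $ i $ j) U" "x \<in> U" "B ** A x = mat 1"
  shows "partial m (\<lambda>x. det (A x)) x =
    det (A x) * (\<Sum>i\<in>UNIV. \<Sum>j\<in>UNIV. B $ j $ i * partial m (\<lambda>x. A x $ i $ j) x)"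
  unfolding C1_on_det(2)[OF assms(1,2)] det_replace_row[OF assms(3)]
  by (simp add: sum_distrib_left sum_distrib_right mult_ac)

lemma matrix_inv_mult:
  fixes A :: "real ^ 'm::finite ^ 'm"
  assumes "det A \<noteq> 0"
  shows "A ** matrix_inv A = mat 1" "matrix_inv A ** A = mat 1"
proof -
  have "\<exists>A'. A ** A' = mat 1 \<and> A' ** A = mat 1"
    using assms by (simp add: invertible_det_nz flip: invertible_def)
  from someI_ex[OF this] show "A ** matrix_inv A = mat 1" "matrix_inv A ** A = mat 1"
    unfolding matrix_inv_def by auto
qed

lemma matrix_inv_entry:
  fixes A :: "real ^ 'm::finite ^ 'm"
  assumes "det A \<noteq> 0"
  shows "matrix_inv A $ j $ l = det (\<chi> r s. if s = j then (if r = l then 1 else 0) else A $ r $ s) / det A"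
proof -
  have "A *v (matrix_inv A *v axis l 1) = axis l 1"
    by (simp add: matrix_vector_mul_assoc matrix_inv_mult[OF assms])
  then have "matrix_inv A *v axis l 1 = (\<chi> k. det (\<chi> i j. if j = k then axis l 1 $ i else A $ i $ j) / det A)"
    by (subst (asm) cramer[OF assms])
  from arg_cong[OF this, of "\<lambda>v. v $ j"]
  have "(matrix_inv A *v axis l 1) $ j = det (\<chi> i k. if k = j then axis l 1 $ i else A $ i $ k) / det A"
    by simp
  moreover have "(matrix_inv A *v axis l 1) $ j = matrix_inv A $ j $ l"
    by (simp add: matrix_vector_mult_basis column_def)
  moreover have "axis l 1 $ i = (if i = l then 1 else 0 :: real)" for i
    by (simp add: axis_def)
  ultimately show ?thesis by (simp only:)
qed

lemma C1_on_matrix_inv: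
  fixes A :: "real ^ 'k::finite \<Rightarrow> real ^ 'm::finite ^ 'm"
  assumes "\<And>i j. C1_on (\<lambda>x. A x $ i $ j) U" "open U" "\<And>x. x \<in> U \<Longrightarrow> det (A x) \<noteq> 0"
  shows "C1_on (\<lambda>x. matrix_inv (A x) $ j $ l) U"
proof (rule C1_on_cong[OF _ \<open>open U\<close>])
  have "C1_on (\<lambda>x. (\<chi> r s. if s = j then (if r = l then 1 else 0) else A x $ r $ s) $ r' $ s') U" for r' s'
    using assms(1) by (cases "s' = j") auto
  then show "C1_on (\<lambda>x. det (\<chi> r s. if s = j then (if r = l then 1 else 0) else A x $ r $ s) / det (A x)) U"
    using assms by (intro C1_on_divide C1_on_det(1)) auto
qed (use assms in \<open>simp add: matrix_inv_entry\<close>)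

lemma has_real_derivative_along_axis:
  fixes f :: "real ^ 'k::finite \<Rightarrow> real"
  assumes "f differentiable (at (p + t *\<^sub>R axis i 1))"
  shows "((\<lambda>t. f (p + t *\<^sub>R axis i 1)) has_real_derivative partial i f (p + t *\<^sub>R axis i 1)) (at t)"
proof -
  let ?D = "frechet_derivative f (at (p + t *\<^sub>R axis i 1))"
  have "((\<lambda>t. p + t *\<^sub>R axis i 1) has_derivative (\<lambda>h. h *\<^sub>R axis i 1)) (at t)"
    by (auto intro!: derivative_eq_intros)
  from diff_chain_at[OF this assms[unfolded frechet_derivative_works]]
  have "((\<lambda>t. f (p + t *\<^sub>R axis i 1)) has_derivative (\<lambda>h. ?D (h *\<^sub>R axis i 1))) (at t)"
    by (simp add: o_def)
  then show ?thesis
    unfolding has_field_derivative_def partial_def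
    by (simp add: linear_scale[OF linear_frechet_derivative[OF assms]] mult_commute_abs)
qed

lemma mixed_difference:
  fixes f :: "real ^ 'k::finite \<Rightarrow> real"
  assumes "C1_on f U" "C1_on (partial i f) U" "cball x (2 * s) \<subseteq> U" "0 < s"
  obtains y where "dist x y \<le> 2 * s"
    "f (x + s *\<^sub>R axis i 1 + s *\<^sub>R axis j 1) - f (x + s *\<^sub>R axis i 1) - f (x + s *\<^sub>R axis j 1) + f x
      = s\<^sup>2 * partial j (partial i f) y"
proof -
  let ?i = "axis i 1 :: real ^ 'k" and ?j = "axis j 1 :: real ^ 'k"
  have near: "dist x (x + t *\<^sub>R ?i + u *\<^sub>R ?j) \<le> 2 * s" if "0 \<le> t" "t \<le> s" "0 \<le> u" "u \<le> s" for t u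
  proof -
    have "dist x (x + t *\<^sub>R ?i + u *\<^sub>R ?j) = norm (t *\<^sub>R ?i + u *\<^sub>R ?j)"
      by (simp add: dist_norm norm_minus_commute algebra_simps)
    also have "\<dots> \<le> norm (t *\<^sub>R ?i) + norm (u *\<^sub>R ?j)" by (rule norm_triangle_ineq)
    finally show ?thesis using that by (simp add: norm_axis_1)
  qed
  then have mem: "x + t *\<^sub>R ?i + u *\<^sub>R ?j \<in> U" if "0 \<le> t" "t \<le> s" "0 \<le> u" "u \<le> s" for t u
    using that assms(3) by (auto simp: subset_iff)
  let ?g = "\<lambda>t. f (x + s *\<^sub>R ?j + t *\<^sub>R ?i) - f (x + t *\<^sub>R ?i)"
  let ?g' = "\<lambda>t. partial i f (x + s *\<^sub>R ?j + t *\<^sub>R ?i) - partial i f (x + t *\<^sub>R ?i)"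
  have "DERIV ?g t :> ?g' t" if "0 \<le> t" "t \<le> s" for t
  proof (intro derivative_intros has_real_derivative_along_axis)
    show "f differentiable at (x + s *\<^sub>R ?j + t *\<^sub>R ?i)"
      using mem[of t s] that assms(1,4) by (simp add: C1_on_def algebra_simps)
    show "f differentiable at (x + t *\<^sub>R ?i)"
      using mem[of t 0] that assms(1,4) by (simp add: C1_on_def)
  qed
  from MVT2[OF assms(4) this] obtain z where z: "0 < z" "z < s" "?g s - ?g 0 = (s - 0) * ?g' z"
    by blast
  let ?h = "\<lambda>u. partial i f (x + z *\<^sub>R ?i + u *\<^sub>R ?j)"
  have "DERIV ?h u :> partial j (partial i f) (x + z *\<^sub>R ?i + u *\<^sub>R ?j)" if "0 \<le> u" "u \<le> s" for u
  proof (rule has_real_derivative_along_axis)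
    show "partial i f differentiable at (x + z *\<^sub>R ?i + u *\<^sub>R ?j)"
      using mem[of z u] that z assms(2) by (simp add: C1_on_def)
  qed
  from MVT2[OF assms(4) this] obtain u where u: "0 < u" "u < s"
    "?h s - ?h 0 = (s - 0) * partial j (partial i f) (x + z *\<^sub>R ?i + u *\<^sub>R ?j)"
    by blast
  have "?g' z = ?h s - ?h 0" by (simp add: algebra_simps)
  with z(3) u(3) have "?g s - ?g 0 = s\<^sup>2 * partial j (partial i f) (x + z *\<^sub>R ?i + u *\<^sub>R ?j)"
    by (simp add: power2_eq_square)
  moreover have "?g s - ?g 0 = f (x + s *\<^sub>R ?i + s *\<^sub>R ?j) - f (x + s *\<^sub>R ?i) - f (x + s *\<^sub>R ?j) + f x"
    by (simp add: algebra_simps)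
  ultimately show thesis using that near[of z u] z u by auto
qed

lemma partial_commute_real:
  fixes f :: "real ^ 'k::finite \<Rightarrow> real"
  assumes "open U" "C1_on f U" "\<And>i. C1_on (partial i f) U" "x \<in> U"
  shows "partial i (partial j f) x = partial j (partial i f) x"
proof -
  have cont: "continuous (at x) (partial a (partial b f))" for a b
    using assms(3)[of b] assms(4) by (simp add: C1_on_def continuous_on_eq_continuous_at[OF assms(1)])
  have "dist (partial i (partial j f) x) (partial j (partial i f) x) \<le> 0 + e'" if "e' > 0" for e'
  proof -
    define e where "e = e' / 2"
    have "e > 0" using \<open>e' > 0\<close> by (simp add: e_def)
    obtain d1 where d1: "d1 > 0" "\<And>y. dist y x < d1 \<Longrightarrow> dist (partial i (partial j f) y) (partial i (partial j f) x) < e"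
      using cont[of i j] \<open>e > 0\<close> unfolding continuous_at_eps_delta by blast
    obtain d2 where d2: "d2 > 0" "\<And>y. dist y x < d2 \<Longrightarrow> dist (partial j (partial i f) y) (partial j (partial i f) x) < e"
      using cont[of j i] \<open>e > 0\<close> unfolding continuous_at_eps_delta by blast
    obtain r where r: "r > 0" "cball x r \<subseteq> U" using assms(1,4) open_contains_cball by blast
    define s where "s = min r (min d1 d2) / 4"
    have s: "0 < s" "2 * s \<le> r" "2 * s < d1" "2 * s < d2" using r d1 d2 by (auto simp: s_def)
    then have sub: "cball x (2 * s) \<subseteq> U" using r(2) by auto
    obtain y where y: "dist x y \<le> 2 * s" "f (x + s *\<^sub>R axis i 1 + s *\<^sub>R axis j 1) - f (x + s *\<^sub>R axis i 1) - f (x + s *\<^sub>R axis j 1) + f x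
      = s\<^sup>2 * partial j (partial i f) y"
      by (rule mixed_difference[OF assms(2,3) sub s(1)])
    obtain z where z: "dist x z \<le> 2 * s" "f (x + s *\<^sub>R axis j 1 + s *\<^sub>R axis i 1) - f (x + s *\<^sub>R axis j 1) - f (x + s *\<^sub>R axis i 1) + f x
      = s\<^sup>2 * partial i (partial j f) z"
      by (rule mixed_difference[OF assms(2,3) sub s(1)])
    have "f (x + s *\<^sub>R axis i 1 + s *\<^sub>R axis j 1) = f (x + s *\<^sub>R axis j 1 + s *\<^sub>R axis i 1)"
      by (simp add: add_ac)
    then have "s\<^sup>2 * partial j (partial i f) y = s\<^sup>2 * partial i (partial j f) z"
      using y(2) z(2) by linarith
    then have eq: "partial j (partial i f) y = partial i (partial j f) z" using s(1) by simp
    have "dist (partial j (partial i f) y) (partial j (partial i f) x) < e"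
      using y(1) s by (intro d2) (simp add: dist_commute)
    moreover have "dist (partial i (partial j f) z) (partial i (partial j f) x) < e"
      using z(1) s by (intro d1) (simp add: dist_commute)
    ultimately show ?thesis unfolding eq dist_real_def e_def by linarith
  qed
  then have "dist (partial i (partial j f) x) (partial j (partial i f) x) \<le> 0"
    by (rule field_le_epsilon)
  then show ?thesis by simp
qed

lemma partial_commute:
  fixes f :: "real ^ 'k::finite \<Rightarrow> 'b::euclidean_space"
  assumes U: "open U" and C1: "C1_on f U" "\<And>i. C1_on (partial i f) U" and x: "x \<in> U"
  shows "partial i (partial j f) x = partial j (partial i f) x"
proof (rule euclidean_eqI)
  fix b :: 'b assume "b \<in> Basis"
  have p1: "partial a (\<lambda>x. f x \<bullet> b) y = partial a f y \<bullet> b" if "y \<in> U" for a y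
    using C1_on_inner(2)[OF C1(1) C1_on_const that] by (simp add: partial_eq[OF has_derivative_const])
  have C: "C1_on (\<lambda>x. partial a f x \<bullet> b) U" for a
    by (intro C1_on_inner(1) C1 C1_on_const)
  have p2: "partial c (partial a (\<lambda>x. f x \<bullet> b)) x = partial c (partial a f) x \<bullet> b" for a c
  proof -
    have "partial c (partial a (\<lambda>x. f x \<bullet> b)) x = partial c (\<lambda>x. partial a f x \<bullet> b) x"
      by (rule partial_cong[OF U x p1])
    also have "\<dots> = partial c (partial a f) x \<bullet> b"
      using C1_on_inner(2)[OF C1(2) C1_on_const x] by (simp add: partial_eq[OF has_derivative_const])
    finally show ?thesis .
  qed
  have "partial i (partial j (\<lambda>x. f x \<bullet> b)) x = partial j (partial i (\<lambda>x. f x \<bullet> b)) x"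
  proof (rule partial_commute_real[OF U _ _ x])
    show "C1_on (\<lambda>x. f x \<bullet> b) U" by (intro C1_on_inner(1) C1 C1_on_const)
    show "C1_on (partial a (\<lambda>x. f x \<bullet> b)) U" for a
      by (rule C1_on_cong[OF C U]) (rule p1[symmetric])
  qed
  then show "partial i (partial j f) x \<bullet> b = partial j (partial i f) x \<bullet> b" by (simp only: p2)
qed

lemma integral_partial_eq_0:
  fixes w :: "real ^ 'k::finite \<Rightarrow> real"
  assumes w: "C1_on w UNIV" and supp: "\<And>x. w x \<noteq> 0 \<Longrightarrow> norm x \<le> R"
  shows "integrable lborel (partial i w)" "integral\<^sup>L lborel (partial i w) = 0"
proof -
  let ?e = "axis i 1 :: real ^ 'k"
  let ?K = "cball 0 (R + 1) :: (real ^ 'k) set"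
  have cont: "continuous_on UNIV w" "continuous_on UNIV (partial i w)"
    using w C1_on_continuous[OF w] by (auto simp: C1_on_def)
  then have [measurable]: "w \<in> borel_measurable borel" "partial i w \<in> borel_measurable borel"
    by (auto intro: borel_measurable_continuous_onI)
  have p0: "partial i w x = 0" if "norm x > R" for x
  proof -
    have "partial i w x = partial i (\<lambda>_. 0) x"
    proof (rule partial_cong[where U = "- cball 0 R"])
      show "w y = 0" if "y \<in> - cball 0 R" for y
        using supp[of y] that by force
    qed (use that in \<open>auto intro: open_Compl\<close>)
    then show ?thesis by (simp add: partial_eq[OF has_derivative_const])
  qed
  have "bounded (partial i w ` ?K)"
    by (intro compact_imp_bounded compact_continuous_image continuous_on_subset[OF cont(2)]) auto
  then obtain M where M: "M > 0" "\<And>x. x \<in> ?K \<Longrightarrow> \<bar>partial i w x\<bar> \<le> M" by (auto simp: bounded_pos)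
  have bd: "\<bar>partial i w x\<bar> \<le> M" for x
    using M(2)[of x] p0[of x] M(1) by (cases "norm x \<le> R + 1") auto
  let ?h = "\<lambda>n. 1 / real (Suc n)"
  let ?D = "\<lambda>n x. (w (x + ?h n *\<^sub>R ?e) - w x) / ?h n"
  have der: "((\<lambda>t. w (x + t *\<^sub>R ?e)) has_real_derivative partial i w (x + t *\<^sub>R ?e)) (at t)" for x t
    using w by (intro has_real_derivative_along_axis) (simp add: C1_on_def)
  have D_bd: "norm (?D n x) \<le> indicator ?K x *\<^sub>R M" for n x
  proof (cases "x \<in> ?K")
    case True
    have "\<exists>z>0. z < ?h n \<and> w (x + ?h n *\<^sub>R ?e) - w (x + 0 *\<^sub>R ?e) = (?h n - 0) * partial i w (x + z *\<^sub>R ?e)"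
      by (rule MVT2) (auto intro: der)
    then obtain z where "w (x + ?h n *\<^sub>R ?e) - w x = ?h n * partial i w (x + z *\<^sub>R ?e)" by auto
    then have "?D n x = partial i w (x + z *\<^sub>R ?e)" by simp
    then show ?thesis using bd True by simp
  next
    case False
    have "norm (x + ?h n *\<^sub>R ?e) \<ge> norm x - norm (?h n *\<^sub>R ?e)"
      using norm_diff_triangle_ineq[of x "?h n *\<^sub>R ?e" 0 0] norm_triangle_ineq2[of x "- (?h n *\<^sub>R ?e)"] by simp
    moreover have "norm (?h n *\<^sub>R ?e) \<le> 1" by (simp add: norm_axis_1)
    moreover have "norm x > R + 1" using False by simp
    ultimately have "norm (x + ?h n *\<^sub>R ?e) > R" "norm x > R" by linarith+
    then have "w (x + ?h n *\<^sub>R ?e) = 0" "w x = 0"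
      using supp[of "x + ?h n *\<^sub>R ?e"] supp[of x] by linarith+
    then show ?thesis using False by simp
  qed
  have lim: "(\<lambda>n. ?D n x) \<longlonglongrightarrow> partial i w x" for x
  proof -
    have "((\<lambda>h. (w (x + h *\<^sub>R ?e) - w x) / h) \<longlongrightarrow> partial i w x) (at 0)"
      using der[of x 0] by (simp add: has_field_derivative_iff)
    moreover have "filterlim ?h (at 0) sequentially"
    proof (rule filterlim_atI)
      show "?h \<longlonglongrightarrow> 0" using LIMSEQ_inverse_real_of_nat by (simp add: inverse_eq_divide)
    qed auto
    ultimately show ?thesis by (rule filterlim_compose)
  qed
  have bint: "integrable lborel (\<lambda>x. indicator ?K x *\<^sub>R M)"
    by (rule borel_integrable_compact) auto
  have wint: "integrable lborel w"
  proof -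
    have "integrable lborel (\<lambda>x. indicator ?K x *\<^sub>R w x)"
      by (rule borel_integrable_compact) (auto intro: continuous_on_subset[OF cont(1)])
    moreover have "indicator ?K x *\<^sub>R w x = w x" for x
      using supp[of x] by (cases "x \<in> ?K") force+
    ultimately show ?thesis by (simp only:)
  qed
  have shift: "integral\<^sup>L lborel (\<lambda>x. w (x + v)) = integral\<^sup>L lborel w"
    "integrable lborel (\<lambda>x. w (x + v))" for v
  proof -
    have "integral\<^sup>L (distr lborel borel ((+) v)) w = integral\<^sup>L lborel (\<lambda>x. w (v + x))"
      by (rule integral_distr) auto
    then show "integral\<^sup>L lborel (\<lambda>x. w (x + v)) = integral\<^sup>L lborel w"
      by (simp add: lborel_distr_plus add.commute)
    have "integrable (distr lborel borel ((+) v)) w" using wint by (simp add: lborel_distr_plus)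
    then show "integrable lborel (\<lambda>x. w (x + v))"
      by (subst (asm) integrable_distr_eq) (auto simp: add.commute)
  qed
  have D0: "integral\<^sup>L lborel (?D n) = 0" for n
    using shift wint by (simp add: Bochner_Integration.integral_diff)
  show "integrable lborel (partial i w)"
    by (rule integrable_dominated_convergence[OF _ _ bint, of _ ?D]) (use lim D_bd in auto)
  have "(\<lambda>n. integral\<^sup>L lborel (?D n)) \<longlonglongrightarrow> integral\<^sup>L lborel (partial i w)"
    by (rule integral_dominated_convergence[OF _ _ bint]) (use lim D_bd in auto)
  then have "(\<lambda>n. 0) \<longlonglongrightarrow> integral\<^sup>L lborel (partial i w)" unfolding D0 .
  then show "integral\<^sup>L lborel (partial i w) = 0" using LIMSEQ_unique tendsto_const by blast
qed

section \<open>Monotonicity for a stationary measure\<close>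

text \<open>As \<open>e \<rightarrow> 0\<close>, \<open>ramp e\<close> tends to \<open>max 0\<close>, but unlike it is an admissible test function.\<close>

definition ramp :: "real \<Rightarrow> real \<Rightarrow> real" where
  "ramp e z = ((max 0 z)\<^sup>2 - (max 0 (z - e))\<^sup>2) / (2 * e)"

definition ramp_deriv :: "real \<Rightarrow> real \<Rightarrow> real" where
  "ramp_deriv e z = (max 0 z - max 0 (z - e)) / e"

lemma has_real_derivative_square_pos_part:
  "((\<lambda>z::real. (max 0 z)\<^sup>2) has_real_derivative 2 * max 0 z) (at z)"
proof -
  consider "z < 0" | "z = 0" | "z > 0" by linarith
  then show ?thesis
  proof cases
    case 1
    have "((\<lambda>z::real. 0) has_real_derivative 0) (at z)" by simp
    then show ?thesis using 1 by (subst DERIV_cong_ev[OF refl _ refl, of _ "\<lambda>_. 0"])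
        (auto intro: eventually_mono[OF eventually_nhds_in_open[of "{..<0}"]])
  next
    case 2
    have "(max 0 h)\<^sup>2 / h = max 0 h" for h :: real
      by (cases "h > 0") (auto simp: power2_eq_square)
    moreover have "((\<lambda>h::real. max 0 h) \<longlongrightarrow> max 0 0) (at 0)"
      by (intro tendsto_max tendsto_const tendsto_ident_at)
    ultimately have "((\<lambda>h::real. (max 0 h)\<^sup>2 / h) \<longlongrightarrow> 0) (at 0)" by simp
    then show ?thesis using 2 by (simp add: has_field_derivative_iff)
  next
    case 3
    have "((\<lambda>z::real. z\<^sup>2) has_real_derivative 2 * z) (at z)"
      by (auto intro!: derivative_eq_intros)
    then show ?thesis using 3 by (subst DERIV_cong_ev[OF refl _ refl, of _ "\<lambda>z. z\<^sup>2"])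
        (auto intro: eventually_mono[OF eventually_nhds_in_open[of "{0<..}"]])
  qed
qed

lemma ramp_has_real_derivative: "e \<noteq> 0 \<Longrightarrow> (ramp e has_real_derivative ramp_deriv e z) (at z)"
proof -
  assume "e \<noteq> 0"
  have "((\<lambda>z. (max 0 (z - e))\<^sup>2) has_real_derivative 2 * max 0 (z - e)) (at z)"
  proof (rule DERIV_chain2[where f = "\<lambda>z. (max 0 z)\<^sup>2" and g = "\<lambda>z. z - e" and Db = 1, simplified])
    show "((\<lambda>z. (max 0 z)\<^sup>2) has_real_derivative 2 * max 0 (z - e)) (at (z - e))"
      by (rule has_real_derivative_square_pos_part)
    show "((\<lambda>z. z - e) has_real_derivative 1) (at z)" by (auto intro!: derivative_eq_intros)
  qed
  then have "((\<lambda>z. ((max 0 z)\<^sup>2 - (max 0 (z - e))\<^sup>2) / (2 * e)) has_real_derivative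
      (2 * max 0 z - 2 * max 0 (z - e)) / (2 * e)) (at z)"
    by (intro DERIV_cdivide DERIV_diff has_real_derivative_square_pos_part)
  moreover have "(2 * max 0 z - 2 * max 0 (z - e)) / (2 * e) = ramp_deriv e z"
    using \<open>e \<noteq> 0\<close> by (simp add: ramp_deriv_def field_simps)
  ultimately show ?thesis unfolding ramp_def[abs_def] by simp
qed

lemma continuous_on_ramp_deriv: "continuous_on UNIV (ramp_deriv e)"
  unfolding ramp_deriv_def[abs_def] divide_inverse by (intro continuous_intros)

lemma ramp_nonpos: "e > 0 \<Longrightarrow> z \<le> 0 \<Longrightarrow> ramp e z = 0" "e > 0 \<Longrightarrow> z \<le> 0 \<Longrightarrow> ramp_deriv e z = 0"
  by (simp_all add: ramp_def ramp_deriv_def)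

lemma ramp_ge: "e > 0 \<Longrightarrow> e \<le> z \<Longrightarrow> ramp e z = z - e / 2" "e > 0 \<Longrightarrow> e \<le> z \<Longrightarrow> ramp_deriv e z = 1"
  by (simp_all add: ramp_def ramp_deriv_def max_def power2_eq_square field_simps)

lemma ramp_bounds:
  assumes "e > 0"
  shows "0 \<le> ramp e z" "z \<le> w \<Longrightarrow> 0 \<le> w \<Longrightarrow> ramp e z \<le> w"
proof -
  consider "z \<le> 0" | "0 < z" "z < e" | "e \<le> z" by linarith
  then have "0 \<le> ramp e z \<and> ramp e z \<le> max 0 z"
  proof cases
    case 2
    then have "ramp e z = z * (z / (2 * e))" using assms by (simp add: ramp_def power2_eq_square)
    moreover have "z * (z / (2 * e)) \<le> z * 1" using 2 assms by (intro mult_left_mono) auto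
    ultimately show ?thesis using 2 assms by simp
  qed (use assms in \<open>auto simp: ramp_nonpos ramp_ge\<close>)
  then show "0 \<le> ramp e z" "z \<le> w \<Longrightarrow> 0 \<le> w \<Longrightarrow> ramp e z \<le> w" by auto
qed

lemma ramp_deriv_bounds:
  assumes "e > 0"
  shows "0 \<le> ramp_deriv e z" "ramp_deriv e z \<le> 1" "w \<le> z \<Longrightarrow> ramp_deriv e w \<le> ramp_deriv e z"
proof -
  show "0 \<le> ramp_deriv e z" "ramp_deriv e z \<le> 1"
    using assms by (auto simp: ramp_deriv_def max_def)
  show "w \<le> z \<Longrightarrow> ramp_deriv e w \<le> ramp_deriv e z"
    using assms unfolding ramp_deriv_def by (intro divide_right_mono) (auto simp: max_def)
qed

lemma has_real_derivative_sq_minus_1_powr: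
  fixes x r :: real
  assumes "1 < x"
  shows "((\<lambda>s. (s\<^sup>2 - 1) powr r) has_real_derivative r * (x\<^sup>2 - 1) powr (r - 1) * (2 * x)) (at x)"
proof (rule DERIV_chain2[where g = "\<lambda>s. s\<^sup>2 - 1"])
  have "0 < x\<^sup>2 - 1" using one_less_power[OF assms, of 2] by linarith
  then show "((\<lambda>z. z powr r) has_real_derivative r * (x\<^sup>2 - 1) powr (r - 1)) (at (x\<^sup>2 - 1))"
    by (rule has_real_derivative_powr)
  show "((\<lambda>s. s\<^sup>2 - 1) has_real_derivative 2 * x) (at x)" by (auto intro!: derivative_eq_intros)
qed

text \<open>
  \<open>M\<close> stands for the volume measure of the submanifold and \<open>q\<close> for the squared norm of the
  tangential gradient of \<open>f\<close>.
\<close>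

locale stationary_measure = finite_measure M
  for M :: "'a measure" +
  fixes f q :: "'a \<Rightarrow> real" and k :: nat and T :: real
  assumes f_meas [measurable]: "f \<in> borel_measurable M"
    and q_meas [measurable]: "q \<in> borel_measurable M"
    and k_pos: "0 < k"
    and f_ge_1: "AE x in M. 1 \<le> f x"
    and q_bounds: "AE x in M. 0 \<le> q x \<and> q x \<le> (f x)\<^sup>2 - 1"
    and stationary: "\<And>h h'. (\<And>s. (h has_real_derivative h' s) (at s)) \<Longrightarrow> continuous_on UNIV h' \<Longrightarrow>
      (\<And>s. T \<le> s \<Longrightarrow> h s = 0) \<Longrightarrow> (\<integral>x. h' (f x) * q x + real k * f x * h (f x) \<partial>M) = 0"
begin

definition P :: "real \<Rightarrow> real" where
  "P s = (s\<^sup>2 - 1) powr (real k / 2)"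

definition B :: "real \<Rightarrow> real" where
  "B t = (\<integral>x. indicator {x. f x \<le> t} x * f x \<partial>M)"

lemma P_pos:
  assumes "1 < s"
  shows "0 < P s"
proof -
  have "s\<^sup>2 - 1 \<noteq> 0" using one_less_power[OF assms, of 2] by linarith
  then show ?thesis unfolding P_def powr_gt_zero .
qed

lemma P_mono: "1 \<le> r \<Longrightarrow> r \<le> t \<Longrightarrow> P r \<le> P t"
  unfolding P_def by (intro powr_mono2) (auto intro: power_mono simp: one_le_power)

lemma P_strict_mono: "1 \<le> r \<Longrightarrow> r < t \<Longrightarrow> P r < P t"
  unfolding P_def using k_pos by (intro powr_less_mono2) (auto intro!: power_strict_mono simp: one_le_power)

lemma integrable_cutoff:
  fixes g :: "real \<Rightarrow> real"
  assumes "g \<in> borel_measurable borel" "\<And>s. 1 \<le> s \<Longrightarrow> \<bar>g s\<bar> \<le> C"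
  shows "integrable M (\<lambda>x. g (f x))"
proof (rule integrable_const_bound[where B = C])
  show "AE x in M. norm (g (f x)) \<le> C" using f_ge_1 assms(2) by auto
qed (use assms(1) in measurable)

lemma B_integrable: "integrable M (\<lambda>x. indicator {x. f x \<le> t} x * f x)"
proof -
  have "integrable M (\<lambda>x. (\<lambda>s. indicator {..t} s * s) (f x))"
    by (rule integrable_cutoff[where C = "\<bar>t\<bar>"]) (auto simp: indicator_def)
  then show ?thesis by (simp add: indicator_def)
qed

definition Y :: "real \<Rightarrow> real" where
  "Y s = (s\<^sup>2 - 1) powr (- (real k / 2))"

lemma Y_eq: "Y s = 1 / P s"
  by (simp add: Y_def P_def powr_minus_divide)

lemma Y_has_derivative:
  assumes "1 < s"
  shows "(Y has_real_derivative - (real k * s * Y s / (s\<^sup>2 - 1))) (at s)"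
proof -
  have pos: "s\<^sup>2 - 1 > 0" using assms by (simp add: power2_eq_square less_1_mult)
  note has_real_derivative_sq_minus_1_powr[OF assms, of "- (real k / 2)"]
  moreover have "(s\<^sup>2 - 1) powr (- (real k / 2) - 1) = Y s / (s\<^sup>2 - 1)"
    using pos by (simp add: Y_def powr_diff)
  moreover have "- (real k / 2) * (Y s / (s\<^sup>2 - 1)) * (2 * s) = - (real k * s * Y s / (s\<^sup>2 - 1))"
    using pos by (simp add: field_simps)
  ultimately show ?thesis unfolding Y_def[abs_def] by metis
qed

lemma test_function_inequality:
  assumes r: "1 < r" and rt: "r < t" "t \<le> T"
    and a: "a = Y t" and b: "b = Y r" and e: "0 < e" "e \<le> b - a"
  defines "h \<equiv> \<lambda>s. if s \<le> r then b - a - e else ramp e (Y s - a) - ramp e (Y s - b + e)"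
    and "u \<equiv> \<lambda>s. if s \<le> r then 0 else (ramp_deriv e (Y s - a) - ramp_deriv e (Y s - b + e)) * Y s"
  shows "(\<integral>x. f x * (h (f x) - u (f x)) \<partial>M) \<le> 0"
    and "1 \<le> s \<Longrightarrow> \<bar>s * (h s - u s)\<bar> \<le> t * (b + b)"
    and "(\<lambda>s. s * (h s - u s)) \<in> borel_measurable borel"
proof -
  let ?R = "\<lambda>s. ramp_deriv e (Y s - a) - ramp_deriv e (Y s - b + e)" and ?Q = "\<lambda>s. real k * s * Y s / (s\<^sup>2 - 1)"
  have ab: "0 < a" "a < b"
    using P_pos[OF r] P_strict_mono[of r t] r rt P_pos[of t] by (auto simp: a b Y_eq frac_less2)
  have Y_ge: "b \<le> Y s" if "1 < s" "s \<le> r" for s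
    using P_mono[of s r] that P_pos[of s] P_pos[OF r] by (simp add: b Y_eq frac_le)
  have Y_le_a: "Y s \<le> a" if "t \<le> s" for s
    using P_mono[of t s] that P_pos[of t] r rt by (simp add: a Y_eq frac_le)
  have Y_le_b: "Y s \<le> b" if "r < s" for s
    using P_mono[of r s] that P_pos[of r] r rt by (simp add: b Y_eq frac_le)
  have Y_pos: "0 < Y s" if "1 < s" for s
    using P_pos[OF that] by (simp add: Y_eq)
  define h' where "h' = (\<lambda>s. if s \<le> r then 0 else
    ?R s * (- ?Q s))"
  have flat: "ramp e (Y s - a) - ramp e (Y s - b + e) = b - a - e"
    "?R s = 0" if "1 < s" "s \<le> r" for s
    using Y_ge[OF that] e by (simp_all add: ramp_ge)
  have h_eq: "h s = ramp e (Y s - a) - ramp e (Y s - b + e)" if "1 < s" for s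
    using flat that by (auto simp: h_def)
  have h'_eq: "h' s = ?R s * (- ?Q s)" if "1 < s" for s
    using flat that by (auto simp: h'_def)
  have zero: "h s = 0" "u s = 0" if "t \<le> s" for s
    using Y_le_a[OF that] e rt that by (auto simp: h_def u_def ramp_nonpos)
  have der: "(h has_real_derivative h' s) (at s)" for s
  proof (cases "1 < s")
    case True
    have e0: "e \<noteq> 0" using e by simp
    have "((\<lambda>s. ramp e (Y s - a) - ramp e (Y s - b + e)) has_real_derivative
       ramp_deriv e (Y s - a) * (- ?Q s) -
       ramp_deriv e (Y s - b + e) * (- ?Q s)) (at s)"
      using Y_has_derivative[OF True]
      by (intro DERIV_diff DERIV_chain2[OF ramp_has_real_derivative[OF e0]])
        (auto intro!: derivative_eq_intros)
    then have "((\<lambda>s. ramp e (Y s - a) - ramp e (Y s - b + e)) has_real_derivative h' s) (at s)"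
      by (simp add: h'_eq[OF True] algebra_simps)
    then show ?thesis
      by (rule has_field_derivative_transform_within_open[where S = "{1<..}"]) (use True h_eq in auto)
  next
    case False
    have "((\<lambda>_. b - a - e) has_real_derivative h' s) (at s)" using False r by (simp add: h'_def)
    then show ?thesis
      by (rule has_field_derivative_transform_within_open[where S = "{..<r}"]) (use False r in \<open>auto simp: h_def\<close>)
  qed
  have cont_Y: "continuous_on {1<..} Y"
    using Y_has_derivative by (intro DERIV_continuous_on) (auto intro: DERIV_subset)
  have "continuous_on ({1<..} \<union> {..<r}) h'"
  proof (rule continuous_on_open_Un)
    have "continuous_on {1<..} (\<lambda>s. ?R s * (- ?Q s))"
      using cont_Y
      by (intro continuous_intros continuous_on_compose2[OF continuous_on_ramp_deriv])
        (auto simp: power2_eq_1_iff)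
    then show "continuous_on {1<..} h'" by (rule continuous_on_eq) (simp add: h'_eq)
    show "continuous_on {..<r} h'"
      by (rule continuous_on_eq[OF continuous_on_const[of _ 0]]) (simp add: h'_def)
  qed auto
  moreover have "{1<..} \<union> {..<r} = UNIV" using r by auto
  ultimately have cont_h': "continuous_on UNIV h'" by simp
  have cont_h: "continuous_on UNIV h"
    using der by (intro DERIV_continuous_on) (auto intro: DERIV_subset)
  have h'_zero: "h' s = 0" if "t \<le> s" for s
    using Y_le_a[OF that] e rt that by (auto simp: h'_def ramp_nonpos)
  have h'_nonpos: "h' s \<le> 0" for s
  proof (cases "s \<le> r")
    case False
    then have "0 \<le> ?Q s" using Y_pos[of s] r by (simp add: one_le_power)
    moreover have "ramp_deriv e (Y s - b + e) \<le> ramp_deriv e (Y s - a)"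
      using e by (intro ramp_deriv_bounds) auto
    ultimately have "0 \<le> ?R s * (?Q s)" by (intro mult_nonneg_nonneg) auto
    moreover have "h' s = - (?R s * (?Q s))" using False by (simp add: h'_def)
    ultimately show ?thesis by linarith
  qed (simp add: h'_def)
  have key: "h' s * (s\<^sup>2 - 1) = - (real k * s * u s)" if "1 \<le> s" for s
  proof (cases "s \<le> r")
    case False
    then have "s\<^sup>2 - 1 \<noteq> 0" using r by (auto simp: power2_eq_1_iff)
    then show ?thesis using False by (simp add: h'_def u_def)
  qed (simp add: h'_def u_def)
  have "\<exists>C. \<forall>s\<in>{1..t}. \<bar>h' s\<bar> \<le> C" 
    using compact_imp_bounded[OF compact_continuous_image[OF continuous_on_subset[OF cont_h'] compact_Icc[of 1 t]]]
    by (auto simp: bounded_iff)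
  then obtain C where C: "\<And>s. 1 \<le> s \<Longrightarrow> s \<le> t \<Longrightarrow> \<bar>h' s\<bar> \<le> C" by (meson atLeastAtMost_iff)
  have C0: "0 \<le> C" using C[of 1] r rt by linarith
  have [measurable]: "h \<in> borel_measurable borel" "h' \<in> borel_measurable borel"
    using cont_h cont_h' by (auto intro: borel_measurable_continuous_onI)
  have bound_h: "0 \<le> h s \<and> h s \<le> b" if "1 \<le> s" for s
  proof (cases "s \<le> r")
    case False
    have "ramp e (Y s - a) \<le> b - a" using Y_le_b[of s] False e ab by (intro ramp_bounds) auto
    moreover have "0 \<le> ramp e (Y s - b + e)" using e by (intro ramp_bounds)
    moreover have "ramp e (Y s - b + e) \<le> ramp e (Y s - a)"
    proof (rule DERIV_nonneg_imp_nondecreasing[where f = "ramp e"])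
      show "\<exists>y. (ramp e has_real_derivative y) (at x) \<and> 0 \<le> y" for x
        using ramp_has_real_derivative[of e x] ramp_deriv_bounds(1)[OF e(1)] e by auto
    qed (use e in auto)
    ultimately show ?thesis using False ab by (simp add: h_def)
  qed (use e ab in \<open>auto simp: h_def\<close>)
  have bound_u: "0 \<le> u s \<and> u s \<le> b" if "1 \<le> s" for s
  proof (cases "s \<le> r")
    case False
    have "ramp_deriv e (Y s - b + e) \<le> ramp_deriv e (Y s - a)"
      using e by (intro ramp_deriv_bounds) auto
    moreover have "ramp_deriv e (Y s - a) \<le> 1" "0 \<le> ramp_deriv e (Y s - b + e)"
      using e by (auto intro: ramp_deriv_bounds)
    moreover have "0 < Y s" "Y s \<le> b" using False r Y_pos Y_le_b by auto
    ultimately have "?R s * Y s \<le> 1 * b" by (intro mult_mono) auto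
    then show ?thesis
      using False \<open>0 < Y s\<close> \<open>ramp_deriv e (Y s - b + e) \<le> ramp_deriv e (Y s - a)\<close> by (simp add: u_def)
  qed (use ab in \<open>auto simp: u_def\<close>)
  show bound: "\<bar>s * (h s - u s)\<bar> \<le> t * (b + b)" if "1 \<le> s" for s
  proof (cases "t \<le> s")
    case False
    have "\<bar>h s - u s\<bar> \<le> b + b" using bound_h[OF that] bound_u[OF that] by linarith
    then show ?thesis using False that unfolding abs_mult by (intro mult_mono) auto
  next
    case True
    then show ?thesis using zero ab r rt by simp
  qed
  have "u \<in> borel_measurable borel"
  proof -
    have "u = (\<lambda>s. if s \<le> r then 0 else - (h' s * (s\<^sup>2 - 1) / (real k * s)))"
    proof
      fix s show "u s = (if s \<le> r then 0 else - (h' s * (s\<^sup>2 - 1) / (real k * s)))"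
        using key[of s] k_pos r by (cases "s \<le> r") (auto simp: u_def)
    qed
    also have "\<dots> \<in> borel_measurable borel" by measurable
    finally show ?thesis .
  qed
  then show meas_hu: "(\<lambda>s. s * (h s - u s)) \<in> borel_measurable borel" by measurable
  have int1: "integrable M (\<lambda>x. real k * (f x * (h (f x) - u (f x))))"
    using integrable_cutoff[OF meas_hu bound] by simp
  have int_h: "integrable M (\<lambda>x. f x * h (f x))"
  proof (rule integrable_cutoff[where g = "\<lambda>s. s * h s" and C = "t * b"])
    show "\<bar>s * h s\<bar> \<le> t * b" if "1 \<le> s" for s
      using bound_h[OF that] zero[of s] that ab r rt
      by (cases "t \<le> s") (auto simp: abs_mult intro!: mult_mono)
  qed measurable
  have int_q: "integrable M (\<lambda>x. h' (f x) * q x)"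
  proof (rule integrable_const_bound[where B = "C * t\<^sup>2"])
    show "AE x in M. norm (h' (f x) * q x) \<le> C * t\<^sup>2"
      using f_ge_1 q_bounds
    proof eventually_elim
      fix x assume x: "1 \<le> f x" "0 \<le> q x \<and> q x \<le> (f x)\<^sup>2 - 1"
      show "norm (h' (f x) * q x) \<le> C * t\<^sup>2"
      proof (cases "t \<le> f x")
        case True
        then show ?thesis using h'_zero C0 by simp
      next
        case False
        then have "(f x)\<^sup>2 \<le> t\<^sup>2" using x by (intro power_mono) auto
        then have "\<bar>q x\<bar> \<le> t\<^sup>2" using x by auto
        then show ?thesis
          using C[of "f x"] x False C0 unfolding real_norm_def abs_mult by (intro mult_mono) auto
      qed
    qed
  qed measurable
  have "(\<integral>x. real k * (f x * (h (f x) - u (f x))) \<partial>M) \<le> (\<integral>x. h' (f x) * q x + real k * f x * h (f x) \<partial>M)"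
  proof (rule integral_mono_AE[OF int1])
    show "integrable M (\<lambda>x. h' (f x) * q x + real k * f x * h (f x))"
      using int_q int_h by (simp add: mult.assoc)
    show "AE x in M. real k * (f x * (h (f x) - u (f x))) \<le> h' (f x) * q x + real k * f x * h (f x)"
      using f_ge_1 q_bounds
    proof eventually_elim
      fix x assume x: "1 \<le> f x" "0 \<le> q x \<and> q x \<le> (f x)\<^sup>2 - 1"
      have "h' (f x) * ((f x)\<^sup>2 - 1) \<le> h' (f x) * q x"
        using x h'_nonpos by (intro mult_left_mono_neg) auto
      then show "real k * (f x * (h (f x) - u (f x))) \<le> h' (f x) * q x + real k * f x * h (f x)"
        using key[OF x(1)] by (simp add: algebra_simps)
    qed
  qed
  also have "\<dots> = 0" by (rule stationary[OF der cont_h']) (use zero rt in auto)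
  finally show "(\<integral>x. f x * (h (f x) - u (f x)) \<partial>M) \<le> 0" using k_pos by (simp add: mult_le_0_iff)
qed

lemma weighted_monotonicity:
  assumes r: "1 < r" and rt: "r \<le> t" "t \<le> T"
  shows "B r / P r \<le> B t / P t"
proof (cases "r = t")
  case False
  then have rt': "r < t" using rt by simp
  define a b where "a = Y t" and "b = Y r"
  have ab: "0 < a" "a < b"
    using P_pos[OF r] P_strict_mono[of r t] r rt' P_pos[of t]
    by (auto simp: a_def b_def Y_eq frac_less2)
  define e where "e n = (b - a) / real (Suc n)" for n
  have e: "0 < e n" "e n \<le> b - a" for n
    using ab by (auto simp: e_def field_simps intro: mult_right_mono)
  have e_lim: "e \<longlonglongrightarrow> 0"
    unfolding e_def[abs_def]
    using tendsto_mult_right_zero[OF LIMSEQ_inverse_real_of_nat, of "b - a"] by (simp add: divide_inverse)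
  define h where "h n s = (if s \<le> r then b - a - e n else ramp (e n) (Y s - a) - ramp (e n) (Y s - b + e n))" for n s
  define u where "u n s = (if s \<le> r then 0 else (ramp_deriv (e n) (Y s - a) - ramp_deriv (e n) (Y s - b + e n)) * Y s)" for n s
  note tf = test_function_inequality[OF r rt' rt(2) a_def b_def e, folded h_def u_def]
  define L where "L s = (if s \<le> r then b - a else if s < t then - a else 0)" for s
  have lim: "(\<lambda>n. s * (h n s - u n s)) \<longlonglongrightarrow> s * L s" if "1 \<le> s" for s
  proof -
    consider "s \<le> r" | "r < s" "s < t" | "t \<le> s" by linarith
    then show ?thesis
    proof cases
      case 1
      have "(\<lambda>n. s * (b - a - e n - 0)) \<longlonglongrightarrow> s * (b - a - 0 - 0)" by (intro tendsto_intros e_lim)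
      then show ?thesis using 1 by (simp add: h_def u_def L_def)
    next
      case 2
      have Ys: "a < Y s" "Y s < b"
        using P_strict_mono[of s t] P_strict_mono[of r s] 2 r P_pos[of s] P_pos[of t] P_pos[of r]
        by (auto simp: a_def b_def Y_eq frac_less2)
      have "eventually (\<lambda>n. e n < Y s - a \<and> e n < b - Y s) sequentially"
        using Ys by (intro eventually_conj order_tendstoD(2)[OF e_lim]) auto
      then have "eventually (\<lambda>n. s * (Y s - a - e n / 2 - 0 - 1 * Y s) = s * (h n s - u n s)) sequentially"
      proof eventually_elim
        case (elim n)
        then show ?case using 2 e[of n] by (simp add: h_def u_def ramp_ge ramp_nonpos)
      qed
      moreover have "(\<lambda>n. s * (Y s - a - e n / 2 - 0 - 1 * Y s)) \<longlonglongrightarrow> s * (Y s - a - 0 / 2 - 0 - 1 * Y s)"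
        by (intro tendsto_intros e_lim) auto
      ultimately have "(\<lambda>n. s * (h n s - u n s)) \<longlonglongrightarrow> s * (Y s - a - 0 / 2 - 0 - 1 * Y s)"
        by (rule Lim_transform_eventually[rotated])
      then show ?thesis using 2 by (simp add: L_def)
    next
      case 3
      have "Y s \<le> a" using P_mono[of t s] 3 r rt' P_pos[of t] by (simp add: a_def Y_eq frac_le)
      then have "h n s = 0" "u n s = 0" for n
        using 3 rt' e[of n] ab by (auto simp: h_def u_def ramp_nonpos)
      then show ?thesis using 3 rt' by (simp add: L_def)
    qed
  qed
  have [measurable]: "L \<in> borel_measurable borel" unfolding L_def[abs_def] by measurable
  have "(\<lambda>n. \<integral>x. f x * (h n (f x) - u n (f x)) \<partial>M) \<longlonglongrightarrow> (\<integral>x. f x * L (f x) \<partial>M)"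
  proof (rule integral_dominated_convergence[where w = "\<lambda>_. t * (b + b)"])
    show "(\<lambda>x. f x * (h n (f x) - u n (f x))) \<in> borel_measurable M" for n
      using measurable_compose[OF f_meas tf(3)] .
    show "AE x in M. (\<lambda>n. f x * (h n (f x) - u n (f x))) \<longlonglongrightarrow> f x * L (f x)" using f_ge_1 lim by auto
    show "AE x in M. norm (f x * (h n (f x) - u n (f x))) \<le> t * (b + b)" for n
      using f_ge_1 tf(2) by auto
  qed auto
  then have "(\<integral>x. f x * L (f x) \<partial>M) \<le> 0" by (rule LIMSEQ_le_const2) (use tf(1) in auto)
  moreover have "b * B r - a * B t \<le> (\<integral>x. f x * L (f x) \<partial>M)"
  proof -
    have "b * B r - a * B t = (\<integral>x. b * (indicator {x. f x \<le> r} x * f x) - a * (indicator {x. f x \<le> t} x * f x) \<partial>M)"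
      unfolding B_def using B_integrable by simp
    also have "\<dots> \<le> (\<integral>x. f x * L (f x) \<partial>M)"
    proof (rule integral_mono_AE)
      have "integrable M (\<lambda>x. (\<lambda>s. s * L s) (f x))"
      proof (rule integrable_cutoff[where C = "t * b"])
        show "\<bar>s * L s\<bar> \<le> t * b" if "1 \<le> s" for s
        proof (cases "t \<le> s")
          case False
          then show ?thesis
            using that ab unfolding abs_mult by (intro mult_mono) (auto simp: L_def)
        qed (use rt' r ab in \<open>auto simp: L_def\<close>)
      qed measurable
      then show "integrable M (\<lambda>x. f x * L (f x))" by simp
      show "AE x in M. b * (indicator {x. f x \<le> r} x * f x) - a * (indicator {x. f x \<le> t} x * f x) \<le> f x * L (f x)"
        using f_ge_1
      proof eventually_elim
        case (elim x)
        then show ?case using ab rt' by (auto simp: L_def indicator_def algebra_simps)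
      qed
    qed (use B_integrable in auto)
    finally show ?thesis .
  qed
  ultimately have "b * B r \<le> a * B t" by linarith
  then show ?thesis by (simp add: a_def b_def Y_eq)
qed simp

definition A :: "real \<Rightarrow> real" where
  "A t = measure M {x \<in> space M. f x \<le> t}"

lemma A_eq_integral:
  assumes a: "1 \<le> a" "AE x in M. a \<le> f x" and t: "a \<le> t"
  shows "(\<lambda>s. B s / s\<^sup>2) integrable_on {a..t}"
    and "A t = B t / t + integral {a..t} (\<lambda>s. B s / s\<^sup>2)"
proof -
  interpret pair_sigma_finite M "lborel :: real measure" ..
  define F where "F x s = indicator {a..t} s * (indicator {x. f x \<le> s} x * f x / s\<^sup>2)" for x and s :: real
  have F_meas: "case_prod F \<in> borel_measurable (M \<Otimes>\<^sub>M lborel)"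
  proof -
    have "case_prod F = (\<lambda>p. if a \<le> snd p \<and> snd p \<le> t \<and> f (fst p) \<le> snd p then f (fst p) / (snd p)\<^sup>2 else 0)"
      by (auto simp: F_def indicator_def fun_eq_iff)
    also have "\<dots> \<in> borel_measurable (M \<Otimes>\<^sub>M lborel)" by measurable
    finally show ?thesis .
  qed
  have F_int: "integrable (M \<Otimes>\<^sub>M lborel) (case_prod F)"
  proof (rule Bochner_Integration.integrable_bound[OF _ F_meas])
    have "emeasure (M \<Otimes>\<^sub>M lborel) (space M \<times> {a..t}) < \<infinity>"
      using emeasure_finite[of "space M", unfolded infinity_ennreal_def top.not_eq_extremum] t
      by (simp add: lborel.emeasure_pair_measure_Times ennreal_mult_less_top)
    then show "integrable (M \<Otimes>\<^sub>M lborel) (\<lambda>p. indicator (space M \<times> {a..t}) p *\<^sub>R t)"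
      by (intro integrable_scaleR_left integrable_real_indicator) auto
    have F_le: "\<bar>F x s\<bar> \<le> indicator {a..t} s * t" if "1 \<le> f x" for x s
    proof (cases "s \<in> {a..t} \<and> f x \<le> s")
      case True
      then have "f x / s\<^sup>2 \<le> t / 1" using that a by (intro frac_le) (auto intro: one_le_power)
      then show ?thesis using True that by (simp add: F_def)
    next
      case False
      then show ?thesis using a t by (auto simp: F_def indicator_def)
    qed
    have "AE x in M. AE s in lborel. \<bar>F x s\<bar> \<le> indicator (space M \<times> {a..t}) (x, s) * t"
      using f_ge_1 AE_space
    proof eventually_elim
      case (elim x)
      then have "\<bar>F x s\<bar> \<le> indicator (space M \<times> {a..t}) (x, s) * t" for s
        using F_le[of x s] by (simp add: indicator_times)
      then show ?case by simp
    qed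
    moreover have "{p \<in> space (M \<Otimes>\<^sub>M lborel). \<bar>F (fst p) (snd p)\<bar> \<le> indicator (space M \<times> {a..t}) (fst p, snd p) * t} \<in> sets (M \<Otimes>\<^sub>M lborel)"
      using F_meas unfolding prod.collapse case_prod_beta by measurable
    ultimately have "AE p in M \<Otimes>\<^sub>M lborel. \<bar>F (fst p) (snd p)\<bar> \<le> indicator (space M \<times> {a..t}) (fst p, snd p) * t"
      by (subst (asm) AE_pair_iff)
    then show "AE p in M \<Otimes>\<^sub>M lborel. norm (case_prod F p) \<le> norm (indicator (space M \<times> {a..t}) p *\<^sub>R t)"
      using a t by (simp add: case_prod_beta abs_mult)
  qed
  have inner_s: "(\<integral>x. F x s \<partial>M) = indicator {a..t} s *\<^sub>R (B s / s\<^sup>2)" for s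
    by (simp add: F_def B_def)
  have inner_x: "(\<integral>s. F x s \<partial>lborel) = indicator {x. f x \<le> t} x * (1 - f x / t)" if x: "a \<le> f x" for x
  proof (cases "f x \<le> t")
    case True
    have pos: "0 < f x" using x a by linarith
    have "(\<integral>s. F x s \<partial>lborel) = (LBINT s:{f x..t}. f x / s\<^sup>2)"
      unfolding set_lebesgue_integral_def
      by (rule Bochner_Integration.integral_cong) (use x in \<open>auto simp: F_def indicator_def\<close>)
    also have "\<dots> = (- f x / t) - (- f x / f x)"
      unfolding set_lebesgue_integral_def
      unfolding real_scaleR_def mult.commute[of "indicator _ _"]
    proof (rule integral_FTC_Icc_nonneg[where F = "\<lambda>s. - f x / s"])
      show "((\<lambda>s. - f x / s) has_real_derivative f x / s\<^sup>2) (at s)" if "s \<in> {f x..t}" for s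
        using that pos by (auto intro!: derivative_eq_intros simp: power2_eq_square)
    qed (use pos True in auto)
    finally show ?thesis using True pos by simp
  next
    case False
    then have "F x s = 0" for s
      by (auto simp: F_def indicator_def)
    then show ?thesis using False by simp
  qed
  have int_B: "set_integrable lborel {a..t} (\<lambda>s. B s / s\<^sup>2)"
    using integrable_snd[OF F_int] unfolding inner_s set_integrable_def .
  then show "(\<lambda>s. B s / s\<^sup>2) integrable_on {a..t}" by (rule set_borel_integral_eq_integral)
  have "integral {a..t} (\<lambda>s. B s / s\<^sup>2) = (\<integral>s. (\<integral>x. F x s \<partial>M) \<partial>lborel)"
    using set_borel_integral_eq_integral(2)[OF int_B] by (simp add: inner_s set_lebesgue_integral_def)
  also have "\<dots> = (\<integral>x. (\<integral>s. F x s \<partial>lborel) \<partial>M)" by (rule Fubini_integral[OF F_int])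
  also have "\<dots> = (\<integral>x. indicator {x. f x \<le> t} x * (1 - f x / t) \<partial>M)"
  proof (rule integral_cong_AE)
    show "(\<lambda>x. \<integral>s. F x s \<partial>lborel) \<in> borel_measurable M" using integrable_fst[OF F_int] by auto
    have "(\<lambda>x. (\<lambda>s. indicator {..t} s * (1 - s / t)) (f x)) \<in> borel_measurable M" by measurable
    then show "(\<lambda>x. indicator {x. f x \<le> t} x * (1 - f x / t)) \<in> borel_measurable M"
      by (simp add: indicator_def)
  qed (use a(2) inner_x in auto)
  also have "\<dots> = (\<integral>x. indicator {x. f x \<le> t} x - (indicator {x. f x \<le> t} x * f x) / t \<partial>M)"
    by (simp add: algebra_simps)
  also have "\<dots> = A t - B t / t"
  proof -
    have *: "indicator {x. f x \<le> t} x = (indicator {x \<in> space M. f x \<le> t} x :: real)" if "x \<in> space M" for x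
      using that by (simp add: indicator_def)
    have "integrable M (indicator {x \<in> space M. f x \<le> t} :: _ \<Rightarrow> real)"
      by (intro integrable_real_indicator) (auto simp: less_top[symmetric])
    then have "integrable M (\<lambda>x. indicator {x. f x \<le> t} x :: real)"
      by (subst Bochner_Integration.integrable_cong[OF refl *])
    moreover have "(\<integral>x. indicator {x. f x \<le> t} x \<partial>M) = A t"
      unfolding A_def by (subst Bochner_Integration.integral_cong[OF refl *]) (auto simp: Int_absorb1)
    ultimately show ?thesis using B_integrable by (simp add: B_def)
  qed
  finally show "A t = B t / t + integral {a..t} (\<lambda>s. B s / s\<^sup>2)" by simp
qed

end

lemma Q_hyp_eq_integral:
  fixes a t :: real
  assumes k: "0 < k" and a: "1 \<le> a" "a \<le> t"
  defines "p \<equiv> \<lambda>s::real. (s\<^sup>2 - 1) powr (real k / 2)"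
  shows "continuous_on {a..t} (\<lambda>s. p s / s\<^sup>2)"
    and "real k * Q_hyp k a t = p t / t + integral {a..t} (\<lambda>s. p s / s\<^sup>2)"
    and "a \<le> r \<Longrightarrow> r \<le> t \<Longrightarrow>
      p r / r + integral {a..r} (\<lambda>s. p s / s\<^sup>2) \<le> p t / t + integral {a..t} (\<lambda>s. p s / s\<^sup>2)"
proof -
  have cont_p: "continuous_on {a..t} p"
    unfolding p_def using a k
    by (intro continuous_on_powr' continuous_intros) (auto simp: one_le_power)
  then show cont: "continuous_on {a..t} (\<lambda>s. p s / s\<^sup>2)" using a by (intro continuous_intros) auto
  define G where "G s = (p s / s + integral {a..s} (\<lambda>u. p u / u\<^sup>2)) / real k" for s
  have cont_G: "continuous_on {a..t} G"
    unfolding G_def[abs_def] using a k cont_p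
    by (intro continuous_intros indefinite_integral_continuous_1 integrable_continuous_real cont) auto
  have der: "(G has_real_derivative (x\<^sup>2 - 1) powr (real k / 2 - 1)) (at x)" if x: "a < x" "x < t" for x
  proof -
    have "1 < x" using x a by simp
    then have "(p has_real_derivative (real k / 2) * (x\<^sup>2 - 1) powr (real k / 2 - 1) * (2 * x)) (at x)"
      unfolding p_def by (rule has_real_derivative_sq_minus_1_powr)
    then have 1: "((\<lambda>s. p s / s) has_real_derivative
        ((real k / 2) * (x\<^sup>2 - 1) powr (real k / 2 - 1) * (2 * x) * x - p x * 1) / (x * x)) (at x)"
      using x a by (intro DERIV_divide DERIV_ident) auto
    have "((\<lambda>s. integral {a..s} (\<lambda>u. p u / u\<^sup>2)) has_real_derivative p x / x\<^sup>2) (at x within {a..t})"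
      using x by (intro integral_has_real_derivative[OF cont]) auto
    then have 2: "((\<lambda>s. integral {a..s} (\<lambda>u. p u / u\<^sup>2)) has_real_derivative p x / x\<^sup>2) (at x)"
      using x by (simp add: at_within_Icc_at)
    have "(G has_real_derivative (((real k / 2) * (x\<^sup>2 - 1) powr (real k / 2 - 1) * (2 * x) * x - p x * 1) / (x * x) + p x / x\<^sup>2) / real k) (at x)"
      unfolding G_def[abs_def] by (intro DERIV_cdivide DERIV_add 1 2)
    moreover have "(((real k / 2) * (x\<^sup>2 - 1) powr (real k / 2 - 1) * (2 * x) * x - p x * 1) / (x * x) + p x / x\<^sup>2) / real k
        = (x\<^sup>2 - 1) powr (real k / 2 - 1)"
      using x a k by (simp add: field_simps power2_eq_square)
    ultimately show ?thesis by metis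
  qed
  show "real k * Q_hyp k a t = p t / t + integral {a..t} (\<lambda>s. p s / s\<^sup>2)"
  proof (cases "a = t")
    case True
    then show ?thesis using k by (simp add: Q_hyp_def interval_integral_endpoints_same p_def)
  next
    case False
    then have at: "a < t" using a by simp
    have "(LBINT s=ereal a..ereal t. (s\<^sup>2 - 1) powr (real k / 2 - 1)) = G t - G a"
    proof (rule interval_integral_FTC_nonneg(2))
      show "isCont (\<lambda>s. (s\<^sup>2 - 1) powr (real k / 2 - 1)) x" if "ereal a < ereal x" "ereal x < ereal t" for x
      proof -
        have "1 < x" using that a by simp
        then have "x\<^sup>2 - 1 \<noteq> 0" using one_less_power[of x 2] by linarith
        then show ?thesis by (intro continuous_intros) auto
      qed
      show "((G \<circ> real_of_ereal) \<longlongrightarrow> G a) (at_right (ereal a))"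
        using continuous_on_Icc_at_rightD[OF cont_G at] by (simp add: ereal_tendsto_simps)
      show "((G \<circ> real_of_ereal) \<longlongrightarrow> G t) (at_left (ereal t))"
        using continuous_on_Icc_at_leftD[OF cont_G at] by (simp add: ereal_tendsto_simps)
    qed (use at der in auto)
    then show ?thesis using k by (simp add: Q_hyp_def G_def p_def field_simps)
  qed
  show "p r / r + integral {a..r} (\<lambda>s. p s / s\<^sup>2) \<le> p t / t + integral {a..t} (\<lambda>s. p s / s\<^sup>2)"
    if r: "a \<le> r" "r \<le> t"
  proof -
    have "G r \<le> G t"
    proof (rule DERIV_nonneg_imp_increasing_open[OF r(2)])
      show "\<exists>y. (G has_real_derivative y) (at x) \<and> 0 \<le> y" if "r < x" "x < t" for x
        using der[of x] that r by fastforce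
      show "continuous_on {r..t} G" by (rule continuous_on_subset[OF cont_G]) (use r in auto)
    qed
    then show ?thesis using k by (simp add: G_def divide_le_cancel)
  qed
qed

context stationary_measure
begin

lemma ratio_mono:
  assumes a: "1 \<le> a" "AE x in M. a \<le> f x" and rt: "a \<le> r" "r \<le> t" "t \<le> T"
    and Q: "Q_hyp k a r \<noteq> 0"
  shows "A r / Q_hyp k a r \<le> A t / Q_hyp k a t"
proof -
  note cont_P = Q_hyp_eq_integral(1)[OF k_pos a(1), folded P_def]
  note Q_eq = Q_hyp_eq_integral(2)[OF k_pos a(1), folded P_def]
  have r1: "1 < r"
  proof (rule ccontr)
    assume "\<not> 1 < r"
    then have "r = 1" "a = 1" using a rt by auto
    then have "Q_hyp k a r = 0" by (simp add: Q_hyp_def interval_integral_endpoints_same)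
    then show False using Q by simp
  qed
  define m where "m = B r / P r"
  have B_le: "B s \<le> m * P s" if "1 < s" "s \<le> r" for s
    using weighted_monotonicity[of s r] that rt P_pos[of s] by (simp add: m_def pos_divide_le_eq)
  have B_ge: "m * P s \<le> B s" if "r \<le> s" "s \<le> t" for s
    using weighted_monotonicity[of r s] r1 that rt P_pos[of s] by (simp add: m_def pos_le_divide_eq)
  have at: "a \<le> t" using rt by simp
  note IB = A_eq_integral[OF a rt(1)]
  note IBt = A_eq_integral[OF a at]
  have IP: "(\<lambda>s. P s / s\<^sup>2) integrable_on {a..r}" "(\<lambda>s. P s / s\<^sup>2) integrable_on {a..t}"
    using cont_P rt by (auto intro!: integrable_continuous_real)
  have "integral {a..r} (\<lambda>s. B s / s\<^sup>2) \<le> integral {a..r} (\<lambda>s. m * (P s / s\<^sup>2))"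
  proof -
    have "integral {a..r} (\<lambda>s. B s / s\<^sup>2) = integral {a<..<r} (\<lambda>s. B s / s\<^sup>2)"
      by (rule integral_open_interval_real)
    also have "\<dots> \<le> integral {a<..<r} (\<lambda>s. m * (P s / s\<^sup>2))"
    proof (rule integral_le)
      show "(\<lambda>s. B s / s\<^sup>2) integrable_on {a<..<r}"
        using IB(1) by (simp add: integrable_on_open_interval_real)
      show "(\<lambda>s. m * (P s / s\<^sup>2)) integrable_on {a<..<r}"
        using integrable_on_mult_right[OF IP(1)] by (simp add: integrable_on_open_interval_real)
      show "B s / s\<^sup>2 \<le> m * (P s / s\<^sup>2)" if "s \<in> {a<..<r}" for s
        using divide_right_mono[OF B_le[of s], of "s\<^sup>2"] that a by simp
    qed
    also have "\<dots> = integral {a..r} (\<lambda>s. m * (P s / s\<^sup>2))"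
      by (rule integral_open_interval_real[symmetric])
    finally show ?thesis .
  qed
  then have "integral {a..r} (\<lambda>s. B s / s\<^sup>2) \<le> m * integral {a..r} (\<lambda>s. P s / s\<^sup>2)"
    unfolding integral_mult_right .
  then have A_le: "A r \<le> m * (k * Q_hyp k a r)"
    unfolding Q_eq[OF rt(1)] IB(2) using divide_right_mono[OF B_le[OF r1], of r] r1
    by (simp add: distrib_left)
  have "integral {r..t} (\<lambda>s. m * (P s / s\<^sup>2)) \<le> integral {r..t} (\<lambda>s. B s / s\<^sup>2)"
  proof (rule integral_le)
    show "(\<lambda>s. m * (P s / s\<^sup>2)) integrable_on {r..t}"
      by (rule integrable_on_subinterval[OF integrable_on_mult_right[OF IP(2)]]) (use rt in auto)
    show "(\<lambda>s. B s / s\<^sup>2) integrable_on {r..t}"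
      by (rule integrable_on_subinterval[OF IBt(1)]) (use rt in auto)
    show "m * (P s / s\<^sup>2) \<le> B s / s\<^sup>2" if "s \<in> {r..t}" for s
      using B_ge[of s] that by (simp add: divide_right_mono)
  qed
  moreover have "integral {a..t} (\<lambda>s. B s / s\<^sup>2) = integral {a..r} (\<lambda>s. B s / s\<^sup>2) + integral {r..t} (\<lambda>s. B s / s\<^sup>2)"
    using rt IBt(1) by (intro Henstock_Kurzweil_Integration.integral_combine[symmetric])
  moreover have "integral {a..t} (\<lambda>s. P s / s\<^sup>2) = integral {a..r} (\<lambda>s. P s / s\<^sup>2) + integral {r..t} (\<lambda>s. P s / s\<^sup>2)"
    using rt IP(2) by (intro Henstock_Kurzweil_Integration.integral_combine[symmetric])
  moreover have "m * (P t / t) \<le> B t / t" "m * (P r / r) = B r / r"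
  proof -
    show "m * (P t / t) \<le> B t / t" using divide_right_mono[OF B_ge[of t], of t] rt r1 by simp
    show "m * (P r / r) = B r / r" using P_pos[OF r1] by (simp add: m_def)
  qed
  moreover have "integral {r..t} (\<lambda>s. m * (P s / s\<^sup>2)) = m * integral {r..t} (\<lambda>s. P s / s\<^sup>2)"
    by (rule integral_mult_right)
  moreover have "m * integral {a..t} (\<lambda>s. P s / s\<^sup>2) = m * integral {a..r} (\<lambda>s. P s / s\<^sup>2) + m * integral {r..t} (\<lambda>s. P s / s\<^sup>2)"
    unfolding calculation(3) by (rule distrib_left)
  moreover have "m * (k * Q_hyp k a t) = m * (P t / t) + m * integral {a..t} (\<lambda>s. P s / s\<^sup>2)"
    "m * (k * Q_hyp k a r) = m * (P r / r) + m * integral {a..r} (\<lambda>s. P s / s\<^sup>2)"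
    unfolding Q_eq[OF rt(1)] Q_eq[OF at] by (simp_all only: distrib_left)
  ultimately have A_diff: "m * (k * Q_hyp k a t) - m * (k * Q_hyp k a r) \<le> A t - A r"
    unfolding IB(2) IBt(2) by linarith
  have nonneg: "0 \<le> integral {a..r} (\<lambda>s. P s / s\<^sup>2)"
    by (rule integral_nonneg[OF IP(1)]) (simp add: P_def)
  have kQ_r: "0 < k * Q_hyp k a r"
    using nonneg P_pos[OF r1] r1 by (simp add: Q_eq[OF rt(1)] add_pos_nonneg)
  have kQ_mono: "k * Q_hyp k a r \<le> k * Q_hyp k a t"
    using Q_hyp_eq_integral(3)[OF k_pos a(1) at rt(1,2), folded P_def]
    unfolding Q_eq[OF rt(1)] Q_eq[OF at] .
  let ?q = "k * Q_hyp k a r" and ?q' = "k * Q_hyp k a t"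
  have "A r * ?q' = A r * ?q + A r * (?q' - ?q)" by (simp add: algebra_simps)
  also have "A r * (?q' - ?q) \<le> m * ?q * (?q' - ?q)"
    using A_le kQ_mono by (intro mult_right_mono) auto
  also have "m * ?q * (?q' - ?q) \<le> (A t - A r) * ?q"
  proof -
    have "m * ?q * (?q' - ?q) = (m * ?q' - m * ?q) * ?q" by (simp add: algebra_simps)
    also have "\<dots> \<le> (A t - A r) * ?q" using A_diff kQ_r by (intro mult_right_mono) auto
    finally show ?thesis .
  qed
  finally have "A r * ?q' \<le> A t * ?q" by (simp add: algebra_simps)
  moreover have "0 < ?q'" using kQ_r kQ_mono by linarith
  ultimately have le: "A r * Q_hyp k a t \<le> A t * Q_hyp k a r" and pos: "0 < Q_hyp k a r" "0 < Q_hyp k a t"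
    using kQ_r k_pos by (auto simp: zero_less_mult_iff)
  have "A r \<le> A t * Q_hyp k a r / Q_hyp k a t"
    using le by (simp only: pos_le_divide_eq[OF pos(2)])
  then show ?thesis by (simp add: pos_divide_le_eq[OF pos(1)])
qed

end

section \<open>The divergence of the tangential gradient\<close>

lemma bounded_bilinear_mink_inner: "bounded_bilinear (mink_inner :: 'n::finite mink \<Rightarrow> _)"
proof -
  have "bounded_linear (\<lambda>w :: 'n mink. (- fst w, snd w))"
    by (intro bounded_linear_Pair bounded_linear_minus bounded_linear_fst bounded_linear_snd)
  from bounded_bilinear.comp[OF bounded_bilinear_inner bounded_linear_ident this]
  show ?thesis by (simp add: mink_inner_def[abs_def] inner_prod_def mult.commute)
qed

interpretation mink: bounded_bilinear "mink_inner :: 'n::finite mink \<Rightarrow> _"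
  by (rule bounded_bilinear_mink_inner)

lemma mink_inner_commute: "mink_inner v w = mink_inner w v"
  by (simp add: mink_inner_def inner_commute mult.commute)

lemma hyp_space_norm:
  assumes "p \<in> hyp_space"
  shows "(fst p)\<^sup>2 = 1 + (norm (snd p))\<^sup>2" "0 < fst p"
  using assms by (simp_all add: hyp_space_def mink_inner_def power2_eq_square flip: power2_norm_eq_inner)

lemma hyp_space_tangent_spacelike:
  assumes p: "p \<in> hyp_space" and v: "mink_inner v p = 0"
  shows "0 \<le> mink_inner v v" and "mink_inner v v = 0 \<Longrightarrow> v = 0"
proof -
  let ?p = "fst p" and ?v = "fst v"
  note p' = hyp_space_norm[OF p]
  have "(?v * ?p)\<^sup>2 = (snd v \<bullet> snd p)\<^sup>2" using v by (simp add: mink_inner_def)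
  also have "\<dots> \<le> (norm (snd v))\<^sup>2 * (norm (snd p))\<^sup>2"
    using Cauchy_Schwarz_ineq[of "snd v" "snd p"] by (simp add: power2_norm_eq_inner)
  also have "\<dots> = (norm (snd v))\<^sup>2 * ?p\<^sup>2 - (norm (snd v))\<^sup>2" by (simp add: p'(1) algebra_simps)
  moreover have "mink_inner v v = (norm (snd v))\<^sup>2 - ?v\<^sup>2"
    by (simp add: mink_inner_def dot_square_norm power2_eq_square)
  ultimately have *: "(norm (snd v))\<^sup>2 \<le> mink_inner v v * ?p\<^sup>2"
    by (simp add: power_mult_distrib left_diff_distrib)
  then have "0 \<le> mink_inner v v * ?p\<^sup>2" using zero_le_power2 order_trans by blast
  then show "0 \<le> mink_inner v v" using p'(2) by (simp add: zero_le_mult_iff)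
  show "v = 0" if "mink_inner v v = 0"
  proof -
    have "snd v = 0" using * that by simp
    moreover from this have "fst v = 0" using that by (simp add: mink_inner_def)
    ultimately show ?thesis by (simp add: prod_eq_iff)
  qed
qed

lemma hyp_space_inner_ge_1:
  assumes "c \<in> hyp_space" "p \<in> hyp_space"
  shows "1 \<le> - mink_inner c p"
proof -
  note c = hyp_space_norm[OF assms(1)] and p = hyp_space_norm[OF assms(2)]
  let ?C = "norm (snd c)" and ?P = "norm (snd p)"
  have "(1 + ?C * ?P)\<^sup>2 \<le> (fst c * fst p)\<^sup>2"
    using sum_squares_bound[of ?C ?P] unfolding power_mult_distrib c p
    by (simp add: power2_eq_square algebra_simps)
  then have "1 + ?C * ?P \<le> fst c * fst p" by (rule power2_le_imp_le) (use c p in simp)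
  moreover have "snd c \<bullet> snd p \<le> ?C * ?P" by (rule norm_cauchy_schwarz)
  ultimately show ?thesis by (simp add: mink_inner_def)
qed

lemma det_pos_if_pos_def:
  fixes A :: "real ^ 'm::finite ^ 'm"
  assumes "\<And>v. v \<noteq> 0 \<Longrightarrow> 0 < v \<bullet> (A *v v)"
  shows "0 < det A"
proof (rule ccontr)
  assume "\<not> 0 < det A"
  define H where "H s = (1 - s) *\<^sub>R mat 1 + s *\<^sub>R A" for s :: real
  have "continuous_on {0..1} (\<lambda>s. det (H s))" unfolding det_def H_def by (intro continuous_intros)
  moreover have "det (H 1) \<le> 0" "0 \<le> det (H 0)" using \<open>\<not> 0 < det A\<close> by (simp_all add: H_def det_I)
  ultimately obtain s where s: "0 \<le> s" "s \<le> 1" "det (H s) = 0"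
    using IVT2'[of "\<lambda>s. det (H s)" 1 0 0] by auto
  then have "\<not> invertible (H s)" by (simp add: invertible_det_nz)
  then obtain v where v: "H s *v v = 0" "v \<noteq> 0"
    using matrix_left_invertible_ker[of "H s"] invertible_left_inverse by blast
  have "0 < (1 - s) * (v \<bullet> v) + s * (v \<bullet> (A *v v))"
  proof (cases "s = 0")
    case False
    then have "0 < s * (v \<bullet> (A *v v))" using s assms[OF v(2)] by simp
    moreover have "0 \<le> (1 - s) * (v \<bullet> v)" using s by simp
    ultimately show ?thesis by linarith
  qed (use v in simp)
  also have "\<dots> = v \<bullet> (H s *v v)"
    by (simp add: H_def matrix_vector_mult_add_rdistrib inner_add_right scaleR_matrix_vector_assoc[symmetric])
  finally show False using v by simp
qed

locale chart =
  fixes S :: "'n::finite mink set" and U :: "(real ^ 'k::finite) set" and \<phi> :: "real ^ 'k \<Rightarrow> 'n mink"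
  assumes param: "local_param S U \<phi>" and S_hyp: "S \<subseteq> hyp_space"
begin

abbreviation g :: "real ^ 'k \<Rightarrow> real ^ 'k ^ 'k" where
  "g \<equiv> first_fund \<phi>"

abbreviation ginv :: "real ^ 'k \<Rightarrow> real ^ 'k ^ 'k" where
  "ginv x \<equiv> matrix_inv (g x)"

abbreviation vd :: "real ^ 'k \<Rightarrow> real" where
  "vd x \<equiv> sqrt (det (g x))"

abbreviation dphi :: "real ^ 'k \<Rightarrow> real ^ 'k \<Rightarrow> 'n mink" where
  "dphi x \<equiv> frechet_derivative \<phi> (at x)"

lemma open_U: "open U"
  using param by (simp add: local_param_def)

lemma smooth: "smooth_on \<phi> U"
  using param by (simp add: local_param_def)

lemma C1: "C1_on \<phi> U" "C1_on (partial i \<phi>) U"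
proof -
  have *: "Ck_on (Suc (Suc 0)) \<phi> U" using smooth by (simp only: smooth_on_def)
  have "\<psi> differentiable at x" if "\<psi> differentiable_on U" "x \<in> U" for \<psi> :: "real ^ 'k \<Rightarrow> 'n mink" and x
    using that open_U by (simp add: differentiable_on_eq_differentiable_at)
  then show "C1_on \<phi> U" "C1_on (partial i \<phi>) U"
    using * unfolding C1_on_def by (simp_all add: differentiable_imp_continuous_on)
qed

lemma image_subset: "\<phi> ` U \<subseteq> S"
  using param openin_imp_subset unfolding local_param_def by blast

lemma in_hyp_space: "x \<in> U \<Longrightarrow> \<phi> x \<in> hyp_space"
  using image_subset S_hyp by blast

lemma has_derivative: "x \<in> U \<Longrightarrow> (\<phi> has_derivative dphi x) (at x)"
  by (rule C1_on_has_derivative[OF C1(1)])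

lemma derivative_eq: "x \<in> U \<Longrightarrow> dphi x v = (\<Sum>i\<in>UNIV. v $ i *\<^sub>R partial i \<phi> x)"
  using C1(1) by (intro frechet_derivative_partial) (simp add: C1_on_def)

lemma linear_derivative: "x \<in> U \<Longrightarrow> linear (dphi x)"
  using C1(1) by (intro linear_frechet_derivative) (simp add: C1_on_def)

lemma inj_derivative: "x \<in> U \<Longrightarrow> inj (dphi x)"
  using param by (simp add: local_param_def)

lemma partial_orthogonal:
  assumes "x \<in> U"
  shows "mink_inner (partial i \<phi> x) (\<phi> x) = 0" "mink_inner (\<phi> x) (partial i \<phi> x) = 0"
proof -
  have "partial i (\<lambda>x. mink_inner (\<phi> x) (\<phi> x)) x = partial i (\<lambda>x. -1) x"
    by (rule partial_cong[OF open_U assms]) (use in_hyp_space in \<open>auto simp: hyp_space_def\<close>)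
  then show "mink_inner (partial i \<phi> x) (\<phi> x) = 0"
    using C1_on_bilinear(2)[OF bounded_bilinear_mink_inner C1(1) C1(1) assms, of i]
    by (simp add: partial_eq[OF has_derivative_const] mink_inner_commute[of "\<phi> x"])
  then show "mink_inner (\<phi> x) (partial i \<phi> x) = 0" by (simp add: mink_inner_commute)
qed

lemma quadratic_form: "v \<bullet> (g x *v w) =
  mink_inner (\<Sum>i\<in>UNIV. v $ i *\<^sub>R partial i \<phi> x) (\<Sum>i\<in>UNIV. w $ i *\<^sub>R partial i \<phi> x)"
  by (simp add: inner_vec_def matrix_vector_mult_def first_fund_def mink.sum_left mink.sum_right
      mink.scaleR_left mink.scaleR_right sum_distrib_left sum_distrib_right mult_ac) (rule sum.swap)

lemma det_pos: 
  assumes "x \<in> U" 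
  shows "0 < det (g x)"
proof (rule det_pos_if_pos_def)
  fix v :: "real ^ 'k" assume "v \<noteq> 0"
  let ?w = "dphi x v"
  have "mink_inner ?w (\<phi> x) = 0"
    using assms by (simp add: derivative_eq mink.sum_left mink.scaleR_left partial_orthogonal)
  moreover have "?w \<noteq> 0"
    using inj_derivative[OF assms] linear_derivative[OF assms] \<open>v \<noteq> 0\<close> by (metis linear_injective_0)
  ultimately have "0 < mink_inner ?w ?w"
    using hyp_space_tangent_spacelike[OF in_hyp_space[OF assms], of ?w] by (simp add: order_less_le) metis
  then show "0 < v \<bullet> (g x *v v)" using assms by (simp add: quadratic_form derivative_eq)
qed

lemma vd_pos: "x \<in> U \<Longrightarrow> 0 < vd x"
  using det_pos by simp

lemma ginv_mult:
  assumes "x \<in> U"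
  shows "(\<Sum>l\<in>UNIV. ginv x $ j $ l * g x $ l $ m) = (if j = m then 1 else 0)"
    and "(\<Sum>l\<in>UNIV. g x $ j $ l * ginv x $ l $ m) = (if j = m then 1 else 0)"
proof -
  have "det (g x) \<noteq> 0" using det_pos[OF assms] by simp
  note * = matrix_inv_mult[OF this]
  show "(\<Sum>l\<in>UNIV. ginv x $ j $ l * g x $ l $ m) = (if j = m then 1 else 0)"
    using arg_cong[OF *(2), of "\<lambda>A. A $ j $ m"] by (simp add: matrix_matrix_mult_def mat_def)
  show "(\<Sum>l\<in>UNIV. g x $ j $ l * ginv x $ l $ m) = (if j = m then 1 else 0)"
    using arg_cong[OF *(1), of "\<lambda>A. A $ j $ m"] by (simp add: matrix_matrix_mult_def mat_def)
qed

lemma g_sym: "g x $ i $ j = g x $ j $ i"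
  by (simp add: first_fund_def mink_inner_commute)

lemma C1_g: "C1_on (\<lambda>x. g x $ i $ j) U"
  and partial_g: "x \<in> U \<Longrightarrow> partial m (\<lambda>x. g x $ i $ j) x =
    mink_inner (partial i \<phi> x) (partial m (partial j \<phi>) x) + mink_inner (partial m (partial i \<phi>) x) (partial j \<phi> x)"
  using C1_on_bilinear[OF bounded_bilinear_mink_inner C1(2)[of i] C1(2)[of j]]
  by (simp_all add: first_fund_def)

lemma C1_ginv: "C1_on (\<lambda>x. ginv x $ i $ j) U"
  by (rule C1_on_matrix_inv[OF C1_g open_U]) (use det_pos in fastforce)

abbreviation dtrace :: "'k \<Rightarrow> real ^ 'k \<Rightarrow> real" where
  "dtrace m x \<equiv> \<Sum>i\<in>UNIV. \<Sum>j\<in>UNIV. ginv x $ j $ i * partial m (\<lambda>x. g x $ i $ j) x"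

lemma C1_vd: "C1_on vd U"
  and partial_vd: "x \<in> U \<Longrightarrow> partial m vd x =
    vd x / 2 * dtrace m x"
proof -
  have C1_det: "C1_on (\<lambda>x. det (g x)) U" by (rule C1_on_det(1)[OF C1_g])
  have der: "(sqrt has_real_derivative inverse (sqrt (det (g x))) / 2) (at (det (g x)))" if "x \<in> U" for x
    by (rule DERIV_real_sqrt[OF det_pos[OF that]])
  have cont: "continuous_on U (\<lambda>x. inverse (sqrt (det (g x))) / 2)"
    using C1_on_continuous[OF C1_det] det_pos by (intro continuous_intros) fastforce+
  show "C1_on vd U" by (rule C1_on_real_compose(1)[OF C1_det der cont])
  assume x: "x \<in> U"
  have "partial m vd x = inverse (sqrt (det (g x))) / 2 * partial m (\<lambda>x. det (g x)) x"
    by (rule C1_on_real_compose(2)[OF C1_det der cont x])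
  also have "partial m (\<lambda>x. det (g x)) x =
      det (g x) * dtrace m x"
    using det_pos[OF x] by (intro partial_det[OF C1_g x] matrix_inv_mult) simp
  also have "inverse (sqrt (det (g x))) / 2 * (det (g x) * dtrace m x)
     = vd x / 2 * dtrace m x"
    using det_pos[OF x] by (simp add: field_simps flip: power2_eq_square real_sqrt_pow2)
  finally show "partial m vd x = vd x / 2 * dtrace m x" .
qed

lemma partial_sym: "x \<in> U \<Longrightarrow> partial i (partial j \<phi>) x = partial j (partial i \<phi>) x"
  by (rule partial_commute[OF open_U C1])

definition flux :: "'k \<Rightarrow> real ^ 'k \<Rightarrow> 'n mink" where
  "flux j x = (\<Sum>l\<in>UNIV. (vd x * ginv x $ j $ l) *\<^sub>R partial l \<phi> x)"

lemma C1_coeff: "C1_on (\<lambda>x. vd x * ginv x $ j $ l) U"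
  by (intro C1_on_mult(1) C1_vd C1_ginv)

lemma C1_flux: "C1_on (flux j) U"
  unfolding flux_def[abs_def] by (intro C1_on_sum(1) C1_on_scaleR(1) C1_coeff C1)

lemma partial_flux:
  assumes "x \<in> U"
  shows "partial j (flux j) x = (\<Sum>l\<in>UNIV. (vd x * ginv x $ j $ l) *\<^sub>R partial j (partial l \<phi>) x
    + partial j (\<lambda>x. vd x * ginv x $ j $ l) x *\<^sub>R partial l \<phi> x)"
  unfolding flux_def[abs_def]
  by (simp add: C1_on_sum(2)[OF C1_on_scaleR(1)[OF C1_coeff C1(2)] assms] C1_on_scaleR(2)[OF C1_coeff C1(2) assms])

lemma flux_inner:
  assumes "x \<in> U"
  shows "mink_inner (flux j x) (partial m \<phi> x) = (if j = m then vd x else 0)"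
proof -
  have "mink_inner (flux j x) (partial m \<phi> x) = vd x * (\<Sum>l\<in>UNIV. ginv x $ j $ l * g x $ l $ m)"
    by (simp add: flux_def mink.sum_left mink.scaleR_left sum_distrib_left first_fund_def mult_ac)
  then show ?thesis using ginv_mult[OF assms] by simp
qed

text \<open>Tangential part of the divergence: Jacobi's formula for \<open>vd\<close> cancels the Christoffel terms.\<close>

lemma div_flux_tangential:
  assumes x: "x \<in> U"
  shows "mink_inner (\<Sum>j\<in>UNIV. partial j (flux j) x) (partial m \<phi> x) = 0"
proof -
  have "mink_inner (partial j (flux j) x) (partial m \<phi> x) =
      (if j = m then partial m vd x else 0) - mink_inner (flux j x) (partial j (partial m \<phi>) x)" for j
  proof -
    have "partial j (\<lambda>x. mink_inner (flux j x) (partial m \<phi> x)) x = partial j (if j = m then vd else (\<lambda>_. 0)) x"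
      by (rule partial_cong[OF open_U x]) (simp add: flux_inner)
    also have "\<dots> = (if j = m then partial m vd x else 0)"
      by (simp add: partial_eq[OF has_derivative_const])
    finally show ?thesis
      using C1_on_bilinear(2)[OF bounded_bilinear_mink_inner C1_flux C1(2) x, of j j m] by simp
  qed
  then have "mink_inner (\<Sum>j\<in>UNIV. partial j (flux j) x) (partial m \<phi> x) =
      partial m vd x - (\<Sum>j\<in>UNIV. mink_inner (flux j x) (partial m (partial j \<phi>) x))"
    by (simp add: mink.sum_left sum_subtractf partial_sym[OF x])
  moreover have "(\<Sum>j\<in>UNIV. mink_inner (flux j x) (partial m (partial j \<phi>) x)) =
      vd x * (\<Sum>j\<in>UNIV. \<Sum>l\<in>UNIV. ginv x $ j $ l * mink_inner (partial l \<phi> x) (partial m (partial j \<phi>) x))"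
    by (simp add: flux_def mink.sum_left mink.scaleR_left sum_distrib_left mult_ac)
  moreover have "partial m vd x =
      vd x * (\<Sum>j\<in>UNIV. \<Sum>l\<in>UNIV. ginv x $ j $ l * mink_inner (partial l \<phi> x) (partial m (partial j \<phi>) x))"
  proof -
    let ?t = "\<lambda>l j. mink_inner (partial l \<phi> x) (partial m (partial j \<phi>) x)"
    have ginv_sym: "ginv x $ i $ j = ginv x $ j $ i" for i j
    proof -
      have tr: "transpose (g x) = g x" by (simp add: vec_eq_iff transpose_def g_sym)
      have d: "det (g x) \<noteq> 0" using det_pos[OF x] by simp
      have "transpose (ginv x) ** g x = mat 1"
        using matrix_inv_mult(1)[OF d] by (metis matrix_transpose_mul tr transpose_mat)
      then have "transpose (ginv x) = ginv x"
        using matrix_inv_mult(1)[OF d] by (metis matrix_mul_assoc matrix_mul_lid matrix_mul_rid)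
      from arg_cong[OF this, of "\<lambda>A. A $ j $ i"] show ?thesis
        by (simp add: transpose_def)
    qed
    have "dtrace m x =
        (\<Sum>i\<in>UNIV. \<Sum>j\<in>UNIV. ginv x $ j $ i * ?t i j) + (\<Sum>i\<in>UNIV. \<Sum>j\<in>UNIV. ginv x $ j $ i * ?t j i)"
      by (simp add: partial_g[OF x] distrib_left sum.distrib mink_inner_commute[of "partial m _ x"])
    also have "(\<Sum>i\<in>UNIV. \<Sum>j\<in>UNIV. ginv x $ j $ i * ?t i j) = (\<Sum>j\<in>UNIV. \<Sum>l\<in>UNIV. ginv x $ j $ l * ?t l j)"
      by (rule sum.swap)
    also have "(\<Sum>i\<in>UNIV. \<Sum>j\<in>UNIV. ginv x $ j $ i * ?t j i) = (\<Sum>j\<in>UNIV. \<Sum>l\<in>UNIV. ginv x $ j $ l * ?t l j)"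
      by (intro sum.cong refl) (simp add: ginv_sym)
    finally show ?thesis unfolding partial_vd[OF x] by simp
  qed
  ultimately show ?thesis by simp
qed

lemma div_flux:
  assumes x: "x \<in> U" and H: "mean_curvature \<phi> x = 0"
  shows "(\<Sum>j\<in>UNIV. partial j (flux j) x) = (real CARD('k) * vd x) *\<^sub>R \<phi> x"
proof -
  let ?D = "dphi x"
  let ?h = "\<lambda>i j. partial i (partial j \<phi>) x"
  define N where "N = (\<Sum>i\<in>UNIV. \<Sum>j\<in>UNIV. ginv x $ i $ j *\<^sub>R ?h i j)"
  have hp: "mink_inner (?h i j) (\<phi> x) = - g x $ i $ j" for i j
  proof -
    have "partial i (\<lambda>x. mink_inner (partial j \<phi> x) (\<phi> x)) x = partial i (\<lambda>_. 0) x"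
      by (rule partial_cong[OF open_U x]) (simp add: partial_orthogonal)
    then show ?thesis
      using C1_on_bilinear(2)[OF bounded_bilinear_mink_inner C1(2) C1(1) x, of i j]
      by (simp add: partial_eq[OF has_derivative_const] first_fund_def mink_inner_commute)
  qed
  have trace: "(\<Sum>i\<in>UNIV. \<Sum>j\<in>UNIV. ginv x $ i $ j * g x $ i $ j) = real CARD('k)"
  proof -
    have "(\<Sum>i\<in>UNIV. \<Sum>j\<in>UNIV. ginv x $ i $ j * g x $ i $ j) = (\<Sum>i\<in>UNIV. \<Sum>j\<in>UNIV. ginv x $ i $ j * g x $ j $ i)"
      by (intro sum.cong refl) (metis g_sym)
    then show ?thesis by (simp add: ginv_mult[OF x])
  qed
  obtain a where a: "N = real CARD('k) *\<^sub>R \<phi> x + ?D a"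
  proof -
    define a where "a = (\<Sum>i\<in>UNIV. \<Sum>j\<in>UNIV. ginv x $ i $ j *\<^sub>R (\<chi> m. \<Sum>b\<in>UNIV. ginv x $ b $ m * mink_inner (?h i j) (partial b \<phi> x)))"
    have "normal_part \<phi> x (?h i j) = ?h i j - g x $ i $ j *\<^sub>R \<phi> x
        - ?D (\<chi> m. \<Sum>b\<in>UNIV. ginv x $ b $ m * mink_inner (?h i j) (partial b \<phi> x))" for i j
      unfolding normal_part_def hp derivative_eq[OF x]
      by (subst sum.swap) (simp add: scaleR_sum_left)
    then have "mean_curvature \<phi> x = N - (\<Sum>i\<in>UNIV. \<Sum>j\<in>UNIV. ginv x $ i $ j * g x $ i $ j) *\<^sub>R \<phi> x - ?D a"
      unfolding mean_curvature_def second_fund_def N_def a_def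
      by (simp add: linear_sum[OF linear_derivative[OF x]] linear_scale[OF linear_derivative[OF x]]
          scaleR_right_diff_distrib sum_subtractf scaleR_sum_left)
    then have "0 = N - real CARD('k) *\<^sub>R \<phi> x - ?D a" unfolding H trace .
    then show thesis using that[of a] by (simp add: algebra_simps)
  qed
  define b where "b = (\<chi> l. \<Sum>j\<in>UNIV. partial j (\<lambda>x. vd x * ginv x $ j $ l) x)"
  have "(\<Sum>j\<in>UNIV. partial j (flux j) x) = vd x *\<^sub>R N + ?D b"
  proof -
    have "(\<Sum>j\<in>UNIV. \<Sum>l\<in>UNIV. partial j (\<lambda>x. vd x * ginv x $ j $ l) x *\<^sub>R partial l \<phi> x) = ?D b"
      unfolding derivative_eq[OF x] b_def by (subst sum.swap) (simp add: scaleR_sum_left)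
    then show ?thesis
      unfolding partial_flux[OF x] N_def by (simp add: sum.distrib scaleR_sum_right)
  qed
  then have eq: "(\<Sum>j\<in>UNIV. partial j (flux j) x) = (real CARD('k) * vd x) *\<^sub>R \<phi> x + ?D (vd x *\<^sub>R a + b)"
    by (simp add: a linear_add[OF linear_derivative[OF x]] linear_scale[OF linear_derivative[OF x]] algebra_simps)
  let ?w = "?D (vd x *\<^sub>R a + b)"
  have tang: "mink_inner ?w (partial m \<phi> x) = 0" for m
    using div_flux_tangential[OF x, of m] unfolding eq by (simp add: mink.add_left mink.scaleR_left partial_orthogonal[OF x])
  have "mink_inner ?w (?D v) = 0" for v
    unfolding derivative_eq[OF x, of v] mink.sum_right mink.scaleR_right tang by simp
  moreover have "mink_inner ?w (\<phi> x) = 0"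
    by (simp add: derivative_eq[OF x] mink.sum_left mink.scaleR_left partial_orthogonal[OF x])
  ultimately have "?w = 0" using hyp_space_tangent_spacelike(2)[OF in_hyp_space[OF x]] by blast
  then show ?thesis using eq by simp
qed

end

section \<open>Independence of the volume from the parametrization\<close>

lemma has_derivative_factor:
  fixes t :: "'a::euclidean_space \<Rightarrow> 'b::euclidean_space" and F :: "'b \<Rightarrow> 'c::euclidean_space"
  assumes F: "(F has_derivative F') (at (t x))" "inj F'"
    and H: "(H has_derivative H') (at x)"
    and t: "isCont t x"
    and V: "open V" "x \<in> V" "\<And>z. z \<in> V \<Longrightarrow> F (t z) = H z"
  obtains T where "(t has_derivative T) (at x)" "\<And>h. F' (T h) = H' h"
proof -
  have linF: "linear F'" using F(1) by (rule has_derivative_linear)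
  obtain L where L: "linear L" "L \<circ> F' = id"
    using linear_injective_left_inverse[OF linF F(2)] by blast
  have LF': "L (F' h) = h" for h
    using L(2) by (metis comp_apply id_apply)
  have bL: "bounded_linear L" using L(1) by (simp add: linear_conv_bounded_linear)
  have L_der: "(L has_derivative L) (at y)" for y
    by (rule bounded_linear_imp_has_derivative[OF bL])
  define f where "f = (\<lambda>y. L (F y))"
  define h where "h = (\<lambda>z. L (H z))"
  define T where "T = (\<lambda>v. L (H' v))"
  have f: "(f has_derivative (\<lambda>v. v)) (at (t x))"
    using diff_chain_at[OF F(1) L_der] by (simp add: o_def LF' f_def)
  have h: "(h has_derivative T) (at x)"
    using diff_chain_at[OF H L_der] by (simp add: o_def h_def T_def)
  have bT: "bounded_linear T" using h by (rule has_derivative_bounded_linear)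
  then obtain K where K: "0 < K" "\<And>v. norm (T v) \<le> norm v * K"
    using bounded_linear.pos_bounded by blast
  have fh: "f (t z) = h z" if "z \<in> V" for z
    using V(3)[OF that] by (simp add: f_def h_def)
  obtain d0 where d0: "d0 > 0" "\<And>z. norm (z - x) < d0 \<Longrightarrow> z \<in> V"
  proof -
    obtain d where "d > 0" "ball x d \<subseteq> V" using V(1,2) open_contains_ball by blast
    then show thesis using that[of d] by (auto simp: subset_iff dist_norm norm_minus_commute)
  qed
  have "(t has_derivative T) (at x)"
    unfolding has_derivative_at_alt
  proof (intro conjI bT allI impI)
    fix e :: real assume "0 < e"
    define e1 where "e1 = min 1 (e / 2)"
    define e2 where "e2 = min (1 / 2) (e / (4 * (K + 1)))"
    have "e2 \<le> 1 / 2" unfolding e2_def by (rule min.cobounded1)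
    then have e12: "0 < e1" "e1 \<le> 1" "e1 \<le> e / 2" "0 < e2" "e2 \<le> 1 / 2" "e2 \<le> e / (4 * (K + 1))"
      using \<open>0 < e\<close> K(1) by (auto simp: e1_def e2_def)
    obtain d1 where d1: "d1 > 0" "\<And>z. norm (z - x) < d1 \<Longrightarrow> norm (h z - h x - T (z - x)) \<le> e1 * norm (z - x)"
      using h e12(1) unfolding has_derivative_at_alt by blast
    obtain d2 where d2: "d2 > 0" "\<And>y. norm (y - t x) < d2 \<Longrightarrow> norm (f y - f (t x) - (y - t x)) \<le> e2 * norm (y - t x)"
      using f e12(4) unfolding has_derivative_at_alt by blast
    obtain d3 where d3: "d3 > 0" "\<And>z. norm (z - x) < d3 \<Longrightarrow> norm (t z - t x) < d2"
      using t d2(1) unfolding continuous_at_eps_delta dist_norm by blast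
    show "\<exists>d>0. \<forall>z. norm (z - x) < d \<longrightarrow> norm (t z - t x - T (z - x)) \<le> e * norm (z - x)"
    proof (intro exI[of _ "min d0 (min d1 d3)"] conjI allI impI)
      fix z assume z: "norm (z - x) < min d0 (min d1 d3)"
      define w where "w = t z - t x"
      define u where "u = h z - h x"
      have eqs: "f (t z) = h z" "f (t x) = h x" using fh d0(2)[of z] V(2) z by auto
      have 1: "norm (u - T (z - x)) \<le> e1 * norm (z - x)" using d1(2)[of z] z by (simp add: u_def)
      have 2: "norm (u - w) \<le> e2 * norm w"
        using d2(2)[of "t z"] d3(2)[of z] z by (simp add: u_def w_def eqs)
      have "norm u \<le> norm (T (z - x)) + norm (u - T (z - x))"
        using norm_triangle_ineq[of "T (z - x)" "u - T (z - x)"] by simp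
      also have "\<dots> \<le> norm (z - x) * K + 1 * norm (z - x)"
        by (rule add_mono[OF K(2) order_trans[OF 1 mult_right_mono[OF e12(2) norm_ge_zero]]])
      finally have u: "norm u \<le> (K + 1) * norm (z - x)" by (simp add: algebra_simps)
      have "norm w \<le> norm u + norm (u - w)"
        using norm_triangle_ineq[of u "w - u"] by (simp add: norm_minus_commute)
      also have "\<dots> \<le> norm u + 1 / 2 * norm w"
        using order_trans[OF 2 mult_right_mono[OF e12(5) norm_ge_zero]] by simp
      finally have w: "norm w \<le> 2 * ((K + 1) * norm (z - x))" using u by simp
      have "norm (u - w) \<le> e / (4 * (K + 1)) * (2 * ((K + 1) * norm (z - x)))"
        using 2 e12(4,6) w K(1) \<open>0 < e\<close> by (intro order_trans[OF 2] mult_mono) auto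
      also have "\<dots> = e / 2 * norm (z - x)" using K(1) by (simp add: field_simps)
      finally have 3: "norm (u - w) \<le> e / 2 * norm (z - x)" .
      have 4: "norm (u - T (z - x)) \<le> e / 2 * norm (z - x)"
        by (rule order_trans[OF 1 mult_right_mono[OF e12(3) norm_ge_zero]])
      have "norm (w - T (z - x)) \<le> norm (u - T (z - x)) + norm (u - w)"
        using norm_triangle_ineq4[of "u - T (z - x)" "u - w"] by simp
      then show "norm (t z - t x - T (z - x)) \<le> e * norm (z - x)" using 3 4 by (simp add: w_def)
    qed (use d0 d1 d3 in auto)
  qed
  moreover have "F' (T v) = H' v" for v
  proof -
    have "((\<lambda>z. F (t z)) has_derivative (\<lambda>v. F' (T v))) (at x)"
      using diff_chain_at[OF \<open>(t has_derivative T) (at x)\<close> F(1)] by (simp add: o_def)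
    moreover have "((\<lambda>z. F (t z)) has_derivative H') (at x)"
      by (rule has_derivative_transform_within_open[OF H V(1,2)]) (simp add: V(3))
    ultimately show ?thesis using has_derivative_unique by metis
  qed
  ultimately show thesis using that by blast
qed

context chart
begin

lemma image_openin: "openin (top_of_set S) (\<phi> ` U)"
  using param by (simp add: local_param_def)

definition \<psi> :: "'n mink \<Rightarrow> real ^ 'k" where
  "\<psi> = (SOME \<psi>. homeomorphism U (\<phi> ` U) \<phi> \<psi>)"

lemma homeo: "homeomorphism U (\<phi> ` U) \<phi> \<psi>"
  unfolding \<psi>_def using param by (intro someI_ex[where P = "homeomorphism U (\<phi> ` U) \<phi>"]) (simp add: local_param_def)

lemma \<psi>_\<phi> [simp]: "x \<in> U \<Longrightarrow> \<psi> (\<phi> x) = x"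
  using homeo by (simp add: homeomorphism_def)

lemma inj_on_\<phi>: "inj_on \<phi> U"
  by (metis \<psi>_\<phi> inj_onI)

lemma continuous_\<phi>: "continuous_on U \<phi>" and continuous_\<psi>: "continuous_on (\<phi> ` U) \<psi>"
  using homeo by (simp_all add: homeomorphism_def)

lemma open_preimage: 
  assumes "openin (top_of_set S) W"
  shows "open {x \<in> U. \<phi> x \<in> W}"
proof -
  obtain T where T: "open T" "W = S \<inter> T" using assms openin_open by metis
  have "{x \<in> U. \<phi> x \<in> W} = U \<inter> \<phi> -` T" using image_subset T(2) by auto
  then show ?thesis using continuous_open_preimage[OF continuous_\<phi> open_U T(1)] by simp
qed

end

locale chart_pair = c1: chart S U \<phi> + c2: chart S U' \<phi>'
  for S :: "'n::finite mink set" and U U' :: "(real ^ 'k::finite) set" and \<phi> \<phi>'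
begin

definition \<tau> :: "real ^ 'k \<Rightarrow> real ^ 'k" where
  "\<tau> x = c2.\<psi> (\<phi> x)"

lemma \<tau>_eq: "y \<in> U' \<Longrightarrow> \<phi> x = \<phi>' y \<Longrightarrow> \<tau> x = y"
  by (simp add: \<tau>_def)

lemma open_overlap: "open {x \<in> U. \<phi> x \<in> \<phi>' ` U'}"
  by (rule c1.open_preimage[OF c2.image_openin])

lemma continuous_\<tau>: "continuous_on {x \<in> U. \<phi> x \<in> \<phi>' ` U'} \<tau>"
  unfolding \<tau>_def
  by (rule continuous_on_compose2[OF c2.continuous_\<psi> continuous_on_subset[OF c1.continuous_\<phi>]]) auto

lemma transition_derivative:
  assumes "x \<in> U" "y \<in> U'" "\<phi> x = \<phi>' y"
  obtains T where "(\<tau> has_derivative T) (at x)"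
    "\<And>h. c2.dphi y (T h) = c1.dphi x h"
proof -
  have x: "x \<in> {x \<in> U. \<phi> x \<in> \<phi>' ` U'}" and y: "\<tau> x = y" using assms \<tau>_eq by auto
  have cont: "isCont \<tau> x"
    using continuous_\<tau> x by (simp only: continuous_on_eq_continuous_at[OF open_overlap])
  have F: "(\<phi>' has_derivative c2.dphi y) (at (\<tau> x))"
    using c2.has_derivative[OF assms(2)] y by simp
  show thesis
  proof (rule has_derivative_factor[OF F c2.inj_derivative[OF assms(2)] c1.has_derivative[OF assms(1)] cont open_overlap x])
    show "\<phi>' (\<tau> z) = \<phi> z" if "z \<in> {x \<in> U. \<phi> x \<in> \<phi>' ` U'}" for z
      using that \<tau>_eq by auto
  qed (rule that)
qed

lemma density_transition:
  assumes "x \<in> U" "y \<in> U'" "linear T"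
    "\<And>h. c2.dphi y (T h) = c1.dphi x h"
  shows "c1.vd x = \<bar>det (matrix T)\<bar> * c2.vd y"
proof -
  have p: "partial i \<phi> x = (\<Sum>a\<in>UNIV. matrix T $ a $ i *\<^sub>R partial a \<phi>' y)" for i
  proof -
    have "partial i \<phi> x = c2.dphi y (T (axis i 1))" by (simp add: partial_def assms(4))
    then show ?thesis by (simp add: c2.derivative_eq[OF assms(2)] matrix_def)
  qed
  have "c1.g x = transpose (matrix T) ** (c2.g y ** matrix T)"
  proof -
    have "c1.g x $ i $ j = (transpose (matrix T) ** (c2.g y ** matrix T)) $ i $ j" for i j
      by (simp add: first_fund_def[of \<phi>] p mink.sum_left mink.sum_right mink.scaleR_left mink.scaleR_right
          matrix_matrix_mult_def transpose_def first_fund_def sum_distrib_left sum_distrib_right mult_ac)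
        (subst sum.swap, intro sum.cong refl, simp add: mult_ac)
    then show ?thesis by (simp add: vec_eq_iff)
  qed
  then have "det (c1.g x) = (det (matrix T))\<^sup>2 * det (c2.g y)"
    by (simp add: det_mul power2_eq_square)
  then show ?thesis by (simp add: real_sqrt_mult)
qed

lemma patch_volume_eq:
  assumes E: "E \<in> sets borel" "E \<subseteq> U" and E': "E' \<in> sets borel" "E' \<subseteq> U'" and eq: "\<phi> ` E = \<phi>' ` E'"
  shows "patch_volume \<phi> E = patch_volume \<phi>' E'"
proof -
  have E_E': "\<exists>y\<in>E'. \<phi> x = \<phi>' y" if "x \<in> E" for x
  proof -
    have "\<phi> x \<in> \<phi>' ` E'" unfolding eq[symmetric] using that by (rule imageI)
    then show ?thesis by auto
  qed
  have E'_E: "\<exists>x\<in>E. \<phi> x = \<phi>' y" if "y \<in> E'" for y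
  proof -
    have "\<phi>' y \<in> \<phi> ` E" unfolding eq using that by (rule imageI)
    then show ?thesis by (elim imageE) (metis)
  qed
  have ex: "\<exists>T :: real ^ 'k \<Rightarrow> real ^ 'k. (\<tau> has_derivative T) (at x) \<and> c1.vd x = \<bar>det (matrix T)\<bar> * c2.vd (\<tau> x)" if "x \<in> E" for x
  proof -
    obtain y where y: "y \<in> E'" "\<phi> x = \<phi>' y" using E_E'[OF \<open>x \<in> E\<close>] by auto
    then have yU: "y \<in> U'" "x \<in> U" using E E' that by auto
    obtain T where T: "(\<tau> has_derivative T) (at x)"
      "\<And>h. c2.dphi y (T h) = c1.dphi x h"
      by (rule transition_derivative[OF yU(2,1) y(2)]) (rule that)
    have "c1.vd x = \<bar>det (matrix T)\<bar> * c2.vd y"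
      by (rule density_transition[OF yU(2,1) has_derivative_linear[OF T(1)] T(2)])
    then show ?thesis using T(1) \<tau>_eq[OF yU(1) y(2)] by auto
  qed
  define T where "T x = (SOME T :: real ^ 'k \<Rightarrow> real ^ 'k. (\<tau> has_derivative T) (at x) \<and>
    c1.vd x = \<bar>det (matrix T)\<bar> * c2.vd (\<tau> x))" for x
  have T: "(\<tau> has_derivative T x) (at x)" "c1.vd x = \<bar>det (matrix (T x))\<bar> * c2.vd (\<tau> x)" if "x \<in> E" for x
    using someI_ex[OF ex[OF that]] unfolding T_def by auto
  have \<tau>_im: "\<tau> ` E = E'"
  proof (intro equalityI subsetI)
    fix y assume "y \<in> \<tau> ` E"
    then obtain x where x: "x \<in> E" "y = \<tau> x" by auto
    then obtain y' where "y' \<in> E'" "\<phi> x = \<phi>' y'" using E_E' by auto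
    then show "y \<in> E'" using x \<tau>_eq E' by auto
  next
    fix y assume y: "y \<in> E'"
    then obtain x where "x \<in> E" "\<phi> x = \<phi>' y" using E'_E by auto
    then show "y \<in> \<tau> ` E" using \<tau>_eq[of y x] E' y by auto
  qed
  have \<tau>_mem: "\<tau> x \<in> U'" "\<phi>' (\<tau> x) = \<phi> x" if "x \<in> E" for x
  proof -
    obtain y where "y \<in> E'" "\<phi> x = \<phi>' y" using E_E'[OF \<open>x \<in> E\<close>] by auto
    then show "\<tau> x \<in> U'" "\<phi>' (\<tau> x) = \<phi> x" using \<tau>_eq[of y x] E' by auto
  qed
  have inj: "inj_on \<tau> E"
  proof (rule inj_onI)
    fix x y assume xy: "x \<in> E" "y \<in> E" "\<tau> x = \<tau> y"
    then have "\<phi> x = \<phi> y" using \<tau>_mem(2)[OF xy(1)] \<tau>_mem(2)[OF xy(2)] by simp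
    then show "x = y" using xy E(2) by (intro inj_onD[OF c1.inj_on_\<phi>]) auto
  qed
  have "(\<integral>\<^sup>+y\<in>\<tau> ` E. ennreal \<bar>c2.vd y\<bar> \<partial>lborel) =
      (\<integral>\<^sup>+x\<in>E. ennreal (\<bar>det (matrix (T x))\<bar> * \<bar>c2.vd (\<tau> x)\<bar>) \<partial>lborel)"
  proof (rule nn_integral_change_of_variables[OF E(1) _ T(1) inj])
    show "\<tau> ` E \<in> sets borel" using \<tau>_im E' by simp
    show "set_borel_measurable borel (\<tau> ` E) (\<lambda>y. \<bar>c2.vd y\<bar>)"
      unfolding set_borel_measurable_def \<tau>_im
      by (intro borel_measurable_continuous_on_indicator continuous_on_rabs E'(1)
          continuous_on_subset[OF C1_on_continuous[OF c2.C1_vd] E'(2)])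
    have abs_vd: "\<bar>c2.vd (\<tau> x)\<bar> = c2.vd (\<tau> x)" if "x \<in> E" for x
      by (rule abs_of_pos[OF c2.vd_pos[OF \<tau>_mem(1)[OF that]]])
    have "indicator E x *\<^sub>R (\<bar>det (matrix (T x))\<bar> * \<bar>c2.vd (\<tau> x)\<bar>) = indicator E x *\<^sub>R c1.vd x" for x
      using abs_vd[of x] T(2)[of x] by (cases "x \<in> E") simp_all
    moreover have "(\<lambda>x. indicator E x *\<^sub>R c1.vd x) \<in> borel_measurable borel"
      by (intro borel_measurable_continuous_on_indicator E(1)
          continuous_on_subset[OF C1_on_continuous[OF c1.C1_vd] E(2)])
    ultimately show "set_borel_measurable borel E (\<lambda>x. \<bar>det (matrix (T x))\<bar> * \<bar>c2.vd (\<tau> x)\<bar>)"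
      unfolding set_borel_measurable_def by presburger
  qed auto
  moreover have "(\<integral>\<^sup>+y\<in>\<tau> ` E. ennreal \<bar>c2.vd y\<bar> \<partial>lborel) = patch_volume \<phi>' E'"
    unfolding patch_volume_def \<tau>_im
    by (rule nn_integral_cong) (use E' c2.vd_pos in \<open>auto simp: indicator_def less_imp_le\<close>)
  moreover have "(\<integral>\<^sup>+x\<in>E. ennreal (\<bar>det (matrix (T x))\<bar> * \<bar>c2.vd (\<tau> x)\<bar>) \<partial>lborel) = patch_volume \<phi> E"
    unfolding patch_volume_def
  proof (rule nn_integral_cong)
    fix x
    show "ennreal (\<bar>det (matrix (T x))\<bar> * \<bar>c2.vd (\<tau> x)\<bar>) * indicator E x = ennreal (c1.vd x) * indicator E x"
      using abs_of_pos[OF c2.vd_pos[OF \<tau>_mem(1)[of x]]] T(2)[of x] by (cases "x \<in> E") simp_all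
  qed
  ultimately show ?thesis by simp
qed

end

context chart
begin

definition density_measure :: "(real ^ 'k) measure" where
  "density_measure = density lborel (\<lambda>x. ennreal (indicator U x * vd x))"

definition chart_measure :: "'n mink measure" where
  "chart_measure = distr density_measure borel (\<lambda>x. indicator U x *\<^sub>R \<phi> x)"

lemma U_borel [measurable]: "U \<in> sets borel"
  using open_U by simp

lemma vd_borel [measurable]: "(\<lambda>x. indicator U x * vd x) \<in> borel_measurable borel"
  using borel_measurable_continuous_on_indicator[OF U_borel C1_on_continuous[OF C1_vd]] by simp

lemma \<phi>_borel [measurable]: "(\<lambda>x. indicator U x *\<^sub>R \<phi> x) \<in> borel_measurable borel"
  by (rule borel_measurable_continuous_on_indicator[OF U_borel continuous_\<phi>])

lemma sets_density_measure [simp]: "sets density_measure = sets borel"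
  and space_density_measure [simp]: "space density_measure = UNIV"
  by (simp_all add: density_measure_def)

lemma sets_chart_measure [simp]: "sets chart_measure = sets borel"
  and space_chart_measure [simp]: "space chart_measure = UNIV"
  by (simp_all add: chart_measure_def)

lemma \<phi>_measurable: "(\<lambda>x. indicator U x *\<^sub>R \<phi> x) \<in> borel_measurable density_measure"
  unfolding measurable_cong_sets[OF sets_density_measure refl] by (rule \<phi>_borel)

lemma emeasure_density_measure:
  assumes "E \<in> sets borel" "E \<subseteq> U"
  shows "emeasure density_measure E = patch_volume \<phi> E"
proof -
  have "emeasure density_measure E = (\<integral>\<^sup>+x. ennreal (indicator U x * vd x) * indicator E x \<partial>lborel)"
    unfolding density_measure_def by (rule emeasure_density) (use assms in auto)
  also have "\<dots> = patch_volume \<phi> E"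
    unfolding patch_volume_def
  proof (rule nn_integral_cong)
    fix x
    show "ennreal (indicator U x * vd x) * indicator E x = ennreal (vd x) * indicator E x"
      using assms by (cases "x \<in> E") auto
  qed
  finally show ?thesis .
qed

lemma preimage_borel:
  assumes "A \<in> sets borel"
  shows "{x \<in> U. \<phi> x \<in> A} \<in> sets borel"
proof -
  have "{x \<in> U. \<phi> x \<in> A} = U \<inter> (\<lambda>x. indicator U x *\<^sub>R \<phi> x) -` A" by auto
  then show ?thesis using measurable_sets[OF \<phi>_borel assms] by simp
qed

lemma emeasure_chart_measure:
  assumes "A \<in> sets borel"
  shows "emeasure chart_measure A = patch_volume \<phi> {x \<in> U. \<phi> x \<in> A}"
proof -
  let ?E = "{x \<in> U. \<phi> x \<in> A}"
  have "emeasure chart_measure A = emeasure density_measure ((\<lambda>x. indicator U x *\<^sub>R \<phi> x) -` A)"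
    unfolding chart_measure_def using assms by (subst emeasure_distr) (simp_all add: \<phi>_measurable)
  also have "\<dots> = (\<integral>\<^sup>+x. ennreal (indicator U x * vd x) * indicator ((\<lambda>x. indicator U x *\<^sub>R \<phi> x) -` A) x \<partial>lborel)"
    unfolding density_measure_def
    by (rule emeasure_density) (use measurable_sets[OF \<phi>_borel assms] in simp_all)
  also have "\<dots> = patch_volume \<phi> ?E"
    unfolding patch_volume_def
  proof (rule nn_integral_cong)
    fix x
    show "ennreal (indicator U x * vd x) * indicator ((\<lambda>x. indicator U x *\<^sub>R \<phi> x) -` A) x = ennreal (vd x) * indicator ?E x"
      by (cases "x \<in> U"; cases "\<phi> x \<in> A") simp_all
  qed
  finally show ?thesis .
qed

lemma integral_chart_measure:
  fixes v :: "'n mink \<Rightarrow> real"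
  assumes [measurable]: "v \<in> borel_measurable borel"
  shows "integral\<^sup>L chart_measure v = (\<integral>x. indicator U x * (vd x * v (\<phi> x)) \<partial>lborel)"
proof -
  have m: "(\<lambda>x. v (indicator U x *\<^sub>R \<phi> x)) \<in> borel_measurable borel" by measurable
  have "integral\<^sup>L chart_measure v = (\<integral>x. v (indicator U x *\<^sub>R \<phi> x) \<partial>density_measure)"
    unfolding chart_measure_def by (rule integral_distr) (simp_all add: \<phi>_measurable)
  also have "\<dots> = (\<integral>x. (indicator U x * vd x) *\<^sub>R v (indicator U x *\<^sub>R \<phi> x) \<partial>lborel)"
    unfolding density_measure_def
  proof (rule integral_density)
    show "AE x in lborel. 0 \<le> indicator U x * vd x"
      using vd_pos by (intro AE_I2) (simp add: indicator_def less_imp_le)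
  qed (use m in simp_all)
  also have "\<dots> = (\<integral>x. indicator U x * (vd x * v (\<phi> x)) \<partial>lborel)"
    by (rule Bochner_Integration.integral_cong) (simp_all add: indicator_def)
  finally show ?thesis .
qed

lemma image_borel:
  assumes "closed S" "E \<in> sets borel" "E \<subseteq> U"
  shows "\<phi> ` E \<in> sets borel"
proof -
  obtain T where T: "open T" "\<phi> ` U = S \<inter> T" using image_openin openin_open by metis
  have W: "\<phi> ` U \<in> sets borel" unfolding T(2) using T(1) assms(1) by auto
  have m: "(\<lambda>p. indicator (\<phi> ` U) p *\<^sub>R \<psi> p) \<in> borel_measurable borel"
    by (rule borel_measurable_continuous_on_indicator[OF W continuous_\<psi>])
  have "\<phi> ` E = \<phi> ` U \<inter> (\<lambda>p. indicator (\<phi> ` U) p *\<^sub>R \<psi> p) -` E"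
  proof (intro equalityI subsetI)
    fix p assume "p \<in> \<phi> ` E"
    then obtain x where "x \<in> E" "p = \<phi> x" by auto
    then show "p \<in> \<phi> ` U \<inter> (\<lambda>p. indicator (\<phi> ` U) p *\<^sub>R \<psi> p) -` E" using assms(3) by auto
  next
    fix p assume p: "p \<in> \<phi> ` U \<inter> (\<lambda>p. indicator (\<phi> ` U) p *\<^sub>R \<psi> p) -` E"
    then obtain x where x: "x \<in> U" "p = \<phi> x" by auto
    then have "x \<in> E" using p by simp
    then show "p \<in> \<phi> ` E" using x by auto
  qed
  then show ?thesis using W measurable_sets[OF m assms(2)] by simp
qed

end

locale chart_cover =
  fixes S :: "'n::finite mink set" and n :: nat
    and U :: "nat \<Rightarrow> (real ^ 'k::finite) set" and \<phi> :: "nat \<Rightarrow> real ^ 'k \<Rightarrow> 'n mink"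
  assumes closed_S: "closed S" and S_hyp: "S \<subseteq> hyp_space"
    and params: "\<And>i. i < n \<Longrightarrow> local_param S (U i) (\<phi> i)"
    and finite_patches: "\<And>i. i < n \<Longrightarrow> patch_volume (\<phi> i) (U i) < \<infinity>"
begin

lemma chart: "i < n \<Longrightarrow> chart S (U i) (\<phi> i)"
  using params S_hyp by (simp add: chart_def)

definition W :: "nat \<Rightarrow> 'n mink set" where
  "W i = \<phi> i ` U i"

definition D :: "nat \<Rightarrow> 'n mink set" where
  "D i = W i - (\<Union>j<i. W j)"

abbreviation \<mu> :: "nat \<Rightarrow> 'n mink measure" where
  "\<mu> i \<equiv> chart.chart_measure (U i) (\<phi> i)"

text \<open>Cutting the patches down to the disjoint sets \<open>D i\<close> counts their overlaps only once.\<close>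

definition M :: "'n mink measure" where
  "M = measure_of UNIV (sets borel) (\<lambda>A. \<Sum>i<n. emeasure (\<mu> i) (A \<inter> D i))"

lemma W_borel: "i < n \<Longrightarrow> W i \<in> sets borel"
  unfolding W_def using chart.image_borel[OF chart closed_S chart.U_borel[OF chart]] by simp

lemma D_borel: "i < n \<Longrightarrow> D i \<in> sets borel"
  unfolding D_def using W_borel by (intro sets.Diff sets.finite_UN) auto

lemma D_subset: "D i \<subseteq> W i"
  by (auto simp: D_def)

lemma D_disjoint: "i \<noteq> j \<Longrightarrow> D i \<inter> D j = {}"
  by (cases i j rule: linorder_cases) (auto simp: D_def)

lemma UN_D: "(\<Union>i<n. D i) = (\<Union>i<n. W i)"
proof (intro equalityI subsetI)
  fix p assume "p \<in> (\<Union>i<n. W i)"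
  then obtain i where i: "i < n" "p \<in> W i" by auto
  define j where "j = (LEAST j. p \<in> W j)"
  have "p \<in> W j" "j \<le> i" "\<And>l. l < j \<Longrightarrow> p \<notin> W l"
    unfolding j_def using i by (auto intro: LeastI Least_le dest: not_less_Least)
  then show "p \<in> (\<Union>i<n. D i)" using i by (intro UN_I[of j]) (auto simp: D_def)
qed (use D_subset in auto)

lemma sets_M [simp]: "sets M = sets borel"
  unfolding M_def using sets.sigma_sets_eq[of borel] by (simp add: space_borel)

lemma space_M [simp]: "space M = UNIV"
  by (simp add: M_def)

lemma emeasure_M:
  assumes "A \<in> sets borel"
  shows "emeasure M A = (\<Sum>i<n. emeasure (\<mu> i) (A \<inter> D i))"
proof (rule emeasure_measure_of[OF M_def])
  let ?m = "\<lambda>A. \<Sum>i<n. emeasure (\<mu> i) (A \<inter> D i)"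
  show "positive (sets M) ?m" by (simp add: positive_def)
  show "countably_additive (sets M) ?m"
  proof (rule countably_additiveI)
    fix A :: "nat \<Rightarrow> 'n mink set"
    assume A: "range A \<subseteq> sets M" "disjoint_family A"
    have "(\<Sum>j. ?m (A j)) = (\<Sum>i<n. \<Sum>j. emeasure (\<mu> i) (A j \<inter> D i))" by (rule suminf_sum) simp
    also have "\<dots> = ?m (\<Union>j. A j)"
    proof (rule sum.cong[OF refl])
      fix i assume "i \<in> {..<n}"
      then have i: "i < n" by simp
      have "(\<Sum>j. emeasure (\<mu> i) (A j \<inter> D i)) =
          emeasure (\<mu> i) (\<Union>j. A j \<inter> D i)"
      proof (rule suminf_emeasure)
        show "range (\<lambda>j. A j \<inter> D i) \<subseteq> sets (\<mu> i)"
          using A(1) D_borel[OF i] by (auto simp: chart.sets_chart_measure[OF chart[OF i]])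
        show "disjoint_family (\<lambda>j. A j \<inter> D i)" using A(2) by (auto simp: disjoint_family_on_def)
      qed
      then show "(\<Sum>j. emeasure (\<mu> i) (A j \<inter> D i)) =
          emeasure (\<mu> i) ((\<Union>j. A j) \<inter> D i)"
        by simp
    qed
    finally show "(\<Sum>j. ?m (A j)) = ?m (\<Union>j. A j)" .
  qed
qed (use assms in auto)

lemma emeasure_M_chart:
  fixes U' :: "(real ^ 'k) set" and \<phi>' :: "real ^ 'k \<Rightarrow> 'n mink"
  assumes "local_param S U' \<phi>'" and A: "A \<in> sets borel" "A \<subseteq> \<phi>' ` U'" "A \<subseteq> (\<Union>i<n. W i)"
  shows "emeasure M A = patch_volume \<phi>' {x \<in> U'. \<phi>' x \<in> A}"
proof -
  interpret c': chart S U' \<phi>' by unfold_locales (fact assms(1) S_hyp)+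
  have "emeasure (\<mu> i) (A \<inter> D i) = emeasure c'.density_measure {x \<in> U'. \<phi>' x \<in> A \<inter> D i}" if i: "i < n" for i
  proof -
    interpret c: chart S "U i" "\<phi> i" by (rule chart[OF i])
    interpret chart_pair S "U i" U' "\<phi> i" \<phi>' ..
    have AD: "A \<inter> D i \<in> sets borel" using A(1) D_borel[OF i] by simp
    have "emeasure c.chart_measure (A \<inter> D i) = patch_volume (\<phi> i) {x \<in> U i. \<phi> i x \<in> A \<inter> D i}"
      by (rule c.emeasure_chart_measure[OF AD])
    also have "\<dots> = patch_volume \<phi>' {x \<in> U'. \<phi>' x \<in> A \<inter> D i}"
    proof (rule patch_volume_eq)
      have "\<phi> i ` {x \<in> U i. \<phi> i x \<in> A \<inter> D i} = A \<inter> D i" using D_subset[of i] by (auto simp: W_def)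
      moreover have "\<phi>' ` {x \<in> U'. \<phi>' x \<in> A \<inter> D i} = A \<inter> D i" using A(2) by auto
      ultimately show "\<phi> i ` {x \<in> U i. \<phi> i x \<in> A \<inter> D i} = \<phi>' ` {x \<in> U'. \<phi>' x \<in> A \<inter> D i}" by simp
    qed (use c.preimage_borel[OF AD] c'.preimage_borel[OF AD] in auto)
    also have "\<dots> = emeasure c'.density_measure {x \<in> U'. \<phi>' x \<in> A \<inter> D i}"
      by (rule c'.emeasure_density_measure[symmetric]) (use c'.preimage_borel[OF AD] in auto)
    finally show ?thesis .
  qed
  then have "emeasure M A = (\<Sum>i<n. emeasure c'.density_measure {x \<in> U'. \<phi>' x \<in> A \<inter> D i})"
    by (simp add: emeasure_M[OF A(1)])
  also have "\<dots> = emeasure c'.density_measure (\<Union>i<n. {x \<in> U'. \<phi>' x \<in> A \<inter> D i})"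
  proof (rule sum_emeasure)
    have "{x \<in> U'. \<phi>' x \<in> A \<inter> D i} \<in> sets borel" if "i < n" for i
      using A(1) D_borel[OF that] by (intro c'.preimage_borel) auto
    then show "(\<lambda>i. {x \<in> U'. \<phi>' x \<in> A \<inter> D i}) ` {..<n} \<subseteq> sets c'.density_measure" by auto
    show "disjoint_family_on (\<lambda>i. {x \<in> U'. \<phi>' x \<in> A \<inter> D i}) {..<n}"
      using D_disjoint by (auto simp: disjoint_family_on_def)
  qed simp
  also have "(\<Union>i<n. {x \<in> U'. \<phi>' x \<in> A \<inter> D i}) = {x \<in> U'. \<phi>' x \<in> A}"
    using A(3) unfolding UN_D[symmetric] by auto
  also have "emeasure c'.density_measure \<dots> = patch_volume \<phi>' {x \<in> U'. \<phi>' x \<in> A}"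
    by (rule c'.emeasure_density_measure) (use c'.preimage_borel[OF A(1)] in auto)
  finally show ?thesis .
qed

lemma volume_eq_M:
  assumes T: "T \<in> sets borel" "T \<subseteq> (\<Union>i<n. W i)"
  shows "volume TYPE('k) S T = emeasure M T"
proof (rule antisym)
  show "volume TYPE('k) S T \<le> emeasure M T"
    unfolding volume_def
  proof (rule SUP_least)
    fix F :: "((real ^ 'k \<Rightarrow> 'n mink) \<times> (real ^ 'k) set) set"
    assume F: "F \<in> patch_families S T"
    note F' = F[unfolded patch_families_def mem_Collect_eq]
    note fin = conjunct1[OF F'] and disj = conjunct2[OF conjunct2[OF F']]
    have FE: "E \<in> sets borel \<and> \<phi> ` E \<subseteq> T \<and> (\<exists>U. local_param S U \<phi> \<and> E \<subseteq> U)" if "(\<phi>, E) \<in> F" for \<phi> E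
      using bspec[OF conjunct1[OF conjunct2[OF F']] that] by simp
    have pv: "patch_volume \<phi>' E = emeasure M (\<phi>' ` E) \<and> \<phi>' ` E \<in> sets borel" if pE: "(\<phi>', E) \<in> F" for \<phi>' E
    proof -
      obtain U' where U': "local_param S U' \<phi>'" "E \<subseteq> U'" and E: "E \<in> sets borel" "\<phi>' ` E \<subseteq> T"
        using FE[OF pE] by auto
      interpret c': chart S U' \<phi>' by unfold_locales (fact U'(1) S_hyp)+
      have bor: "\<phi>' ` E \<in> sets borel" by (rule c'.image_borel[OF closed_S E(1) U'(2)])
      have "{x \<in> U'. \<phi>' x \<in> \<phi>' ` E} = E" using U'(2) c'.inj_on_\<phi> by (auto simp: inj_on_def)
      then show ?thesis
        using emeasure_M_chart[OF U'(1) bor] U'(2) E(2) T(2) bor by (simp add: image_mono)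
    qed
    have "(\<Sum>(\<phi>', E)\<in>F. patch_volume \<phi>' E) = (\<Sum>p\<in>F. emeasure M ((\<lambda>(\<phi>, E). \<phi> ` E) p))"
      by (rule sum.cong[OF refl]) (use pv in auto)
    also have "\<dots> = emeasure M (\<Union>p\<in>F. (\<lambda>(\<phi>, E). \<phi> ` E) p)"
      by (rule sum_emeasure[OF _ disj fin]) (use pv in auto)
    also have "\<dots> \<le> emeasure M T"
    proof (rule emeasure_mono)
      show "(\<Union>p\<in>F. (\<lambda>(\<phi>, E). \<phi> ` E) p) \<subseteq> T"
      proof (rule UN_least)
        fix p assume "p \<in> F"
        then show "(\<lambda>(\<phi>, E). \<phi> ` E) p \<subseteq> T" using FE by (cases p) simp
      qed
    qed (use T(1) in simp)
    finally show "(\<Sum>(\<phi>', E)\<in>F. patch_volume \<phi>' E) \<le> emeasure M T" .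
  qed
next
  define p where "p i = (\<phi> i, {x \<in> U i. \<phi> i x \<in> T \<inter> D i})" for i
  have img: "\<phi> i ` {x \<in> U i. \<phi> i x \<in> T \<inter> D i} = T \<inter> D i" for i
    using D_subset[of i] by (auto simp: W_def)
  have TD: "T \<inter> D i \<in> sets borel" if "i < n" for i
    using T(1) D_borel[OF that] by simp
  have "p ` {..<n} \<in> patch_families S T"
    unfolding patch_families_def
  proof (intro CollectI conjI ballI)
    fix q assume "q \<in> p ` {..<n}"
    then obtain i where i: "i < n" "q = p i" by auto
    have "{x \<in> U i. \<phi> i x \<in> T \<inter> D i} \<in> sets borel"
      by (rule chart.preimage_borel[OF chart[OF i(1)] TD[OF i(1)]])
    then show "case q of (\<phi>, E) \<Rightarrow> E \<in> sets borel \<and> \<phi> ` E \<subseteq> T \<and> (\<exists>U. local_param S U \<phi> \<and> E \<subseteq> U)"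
      unfolding i(2) p_def prod.case img using params[OF i(1)] by auto
  next
    show "disjoint_family_on (\<lambda>(\<phi>, E). \<phi> ` E) (p ` {..<n})"
      unfolding disjoint_family_on_def
    proof (intro ballI impI)
      fix q q' assume q: "q \<in> p ` {..<n}" "q' \<in> p ` {..<n}" "q \<noteq> q'"
      then obtain i j where "q = p i" "q' = p j" "i \<noteq> j" by auto
      then show "(case q of (\<phi>, E) \<Rightarrow> \<phi> ` E) \<inter> (case q' of (\<phi>, E) \<Rightarrow> \<phi> ` E) = {}"
        using D_disjoint[of i j] by (simp only: p_def prod.case img) auto
    qed
  qed simp
  then have "(\<Sum>(\<phi>', E)\<in>p ` {..<n}. patch_volume \<phi>' E) \<le> volume TYPE('k) S T"
    unfolding volume_def by (rule SUP_upper)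
  moreover have "(\<Sum>(\<phi>', E)\<in>p ` {..<n}. patch_volume \<phi>' E) = (\<Sum>i<n. (\<lambda>(\<phi>', E). patch_volume \<phi>' E) (p i))"
  proof (subst sum.reindex_nontrivial)
    fix i j assume ij: "i \<noteq> j" "p i = p j"
    have "fst (p i) ` snd (p i) = fst (p j) ` snd (p j)" by (simp only: ij(2))
    then have "T \<inter> D i = T \<inter> D j" unfolding p_def fst_conv snd_conv img .
    then have "T \<inter> D i = {}" using D_disjoint[OF ij(1)] by auto
    then show "(case p i of (\<phi>', E) \<Rightarrow> patch_volume \<phi>' E) = 0"
      by (simp add: p_def patch_volume_def)
  qed (simp_all add: o_def)
  moreover have "(\<Sum>i<n. (\<lambda>(\<phi>', E). patch_volume \<phi>' E) (p i)) = emeasure M T"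
    unfolding emeasure_M[OF T(1)]
    by (rule sum.cong[OF refl]) (simp add: p_def chart.emeasure_chart_measure[OF chart TD])
  ultimately show "emeasure M T \<le> volume TYPE('k) S T" by simp
qed

lemma finite_measure_M: "finite_measure M"
proof (rule finite_measureI)
  have "emeasure (\<mu> i) (UNIV \<inter> D i) < \<infinity>" if i: "i < n" for i
  proof -
    interpret c: chart S "U i" "\<phi> i" by (rule chart[OF i])
    have "emeasure c.chart_measure (UNIV \<inter> D i) \<le> emeasure c.chart_measure UNIV"
      by (rule emeasure_mono) auto
    also have "\<dots> = patch_volume (\<phi> i) (U i)" by (subst c.emeasure_chart_measure) auto
    finally show ?thesis using finite_patches[OF i] by (rule le_less_trans)
  qed
  then have "emeasure M UNIV < \<infinity>" by (subst emeasure_M) (auto simp: ennreal_sum_less_top)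
  then show "emeasure M (space M) \<noteq> \<infinity>" by simp
qed

lemma AE_M: "AE p in M. p \<in> (\<Union>i<n. W i)"
proof (rule AE_I')
  have bor: "(\<Union>i<n. W i) \<in> sets borel" using W_borel by (intro sets.finite_UN) auto
  have "emeasure M (- (\<Union>i<n. W i)) = (\<Sum>i<n. emeasure (\<mu> i) (- (\<Union>i<n. W i) \<inter> D i))"
    by (rule emeasure_M[OF borel_comp[OF bor]])
  also have "\<dots> = 0"
  proof (rule sum.neutral, intro ballI)
    fix i assume "i \<in> {..<n}"
    then have "- (\<Union>i<n. W i) \<inter> D i = {}" using D_subset by auto
    then show "emeasure (\<mu> i) (- (\<Union>i<n. W i) \<inter> D i) = 0" by simp
  qed
  finally show "- (\<Union>i<n. W i) \<in> null_sets M"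
    using borel_comp[OF bor] by (intro null_setsI) (simp_all only: sets_M)
qed auto

lemma integral_M_chart:
  fixes v :: "'n mink \<Rightarrow> real"
  assumes i: "i < n" and v: "v \<in> borel_measurable borel" "\<And>p. p \<notin> W i \<Longrightarrow> v p = 0"
  shows "integral\<^sup>L M v = (\<integral>x. indicator (U i) x * (chart.vd (\<phi> i) x * v (\<phi> i x)) \<partial>lborel)"
proof -
  interpret c: chart S "U i" "\<phi> i" by (rule chart[OF i])
  have [measurable]: "W i \<in> sets M" using W_borel[OF i] by simp
  have "c.chart_measure = density M (\<lambda>p. ennreal (indicator (W i) p))"
  proof (rule measure_eqI)
    fix A assume "A \<in> sets c.chart_measure"
    then have A: "A \<in> sets borel" by simp
    have "emeasure (density M (\<lambda>p. ennreal (indicator (W i) p))) A = emeasure M (A \<inter> W i)"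
      using A W_borel[OF i] by (simp add: ennreal_indicator emeasure_restricted Int_commute)
    also have "\<dots> = patch_volume (\<phi> i) {x \<in> U i. \<phi> i x \<in> A \<inter> W i}"
      using A W_borel[OF i] i by (intro emeasure_M_chart[OF params[OF i]]) (auto simp: W_def)
    also have "{x \<in> U i. \<phi> i x \<in> A \<inter> W i} = {x \<in> U i. \<phi> i x \<in> A}" by (auto simp: W_def)
    also have "patch_volume (\<phi> i) \<dots> = emeasure c.chart_measure A"
      by (rule c.emeasure_chart_measure[OF A, symmetric])
    finally show "emeasure c.chart_measure A = emeasure (density M (\<lambda>p. ennreal (indicator (W i) p))) A"
      by simp
  qed simp
  then have "integral\<^sup>L c.chart_measure v = integral\<^sup>L (density M (\<lambda>p. ennreal (indicator (W i) p))) v"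
    by simp
  also have "\<dots> = (\<integral>p. indicator (W i) p *\<^sub>R v p \<partial>M)"
  proof (rule integral_density)
    show "v \<in> borel_measurable M" unfolding measurable_cong_sets[OF sets_M refl] by (rule v(1))
  qed simp_all
  also have "\<dots> = integral\<^sup>L M v"
    by (rule Bochner_Integration.integral_cong) (use v(2) in \<open>auto simp: indicator_def\<close>)
  finally show ?thesis using c.integral_chart_measure[OF v(1)] by simp
qed

end

section \<open>The weak form of the equation for the height function\<close>

lemma C1_on_Un:
  assumes "C1_on f A" "C1_on f B" "open A" "open B"
  shows "C1_on f (A \<union> B)"
  using assms(1,2) unfolding C1_on_def by (auto intro!: continuous_on_open_Un[OF assms(3,4)])

lemma C1_on_ambient:
  fixes \<phi> :: "real ^ 'k::finite \<Rightarrow> 'n::finite mink" and \<eta> :: "'n mink \<Rightarrow> real"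
  assumes \<phi>: "C1_on \<phi> U"
    and \<eta>: "\<And>x. x \<in> U \<Longrightarrow> (\<eta> has_derivative (\<lambda>v. G (\<phi> x) \<bullet> v)) (at (\<phi> x))"
    and G: "continuous_on (\<phi> ` U) G"
  shows "C1_on (\<lambda>x. \<eta> (\<phi> x)) U"
    and "x \<in> U \<Longrightarrow> partial i (\<lambda>x. \<eta> (\<phi> x)) x = G (\<phi> x) \<bullet> partial i \<phi> x"
proof -
  have der: "((\<lambda>x. \<eta> (\<phi> x)) has_derivative (\<lambda>h. G (\<phi> x) \<bullet> frechet_derivative \<phi> (at x) h)) (at x)" if "x \<in> U" for x
    using diff_chain_at[OF C1_on_has_derivative[OF \<phi> that] \<eta>[OF that]] by (simp add: o_def)
  have "continuous_on U (\<lambda>x. G (\<phi> x) \<bullet> partial i \<phi> x)" for i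
    using \<phi> by (intro continuous_on_inner continuous_on_compose2[OF G C1_on_continuous[OF \<phi>]])
      (auto simp: C1_on_def)
  then show "C1_on (\<lambda>x. \<eta> (\<phi> x)) U"
    by (intro C1_onI[OF der]) (simp_all add: partial_def[symmetric])
  show "x \<in> U \<Longrightarrow> partial i (\<lambda>x. \<eta> (\<phi> x)) x = G (\<phi> x) \<bullet> partial i \<phi> x"
    using partial_eq[OF der] by (simp add: partial_def)
qed

context chart
begin

definition tproj :: "'n mink \<Rightarrow> real ^ 'k \<Rightarrow> 'n mink" where
  "tproj c x = (\<Sum>j\<in>UNIV. \<Sum>l\<in>UNIV. (ginv x $ j $ l * mink_inner c (partial l \<phi> x)) *\<^sub>R partial j \<phi> x)"

lemma continuous_tproj: "continuous_on U (tproj c)"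
  unfolding tproj_def[abs_def]
proof (intro continuous_on_sum continuous_on_scaleR continuous_on_mult)
  show "continuous_on U (\<lambda>x. ginv x $ j $ l)" for j l
    by (rule C1_on_continuous[OF C1_ginv])
  show "continuous_on U (\<lambda>x. mink_inner c (partial l \<phi> x))" for l
    by (intro mink.continuous_on continuous_on_const C1_on_continuous[OF C1(2)])
  show "continuous_on U (partial j \<phi>)" for j
    by (rule C1_on_continuous[OF C1(2)])
qed

lemma tproj_in_range: "x \<in> U \<Longrightarrow> tproj c x = dphi x
    (\<chi> j. \<Sum>l\<in>UNIV. ginv x $ j $ l * mink_inner c (partial l \<phi> x))"
  by (simp add: derivative_eq tproj_def scaleR_sum_left)

lemma tproj_inner:
  assumes x: "x \<in> U"
  shows "mink_inner (tproj c x) (dphi x v) = mink_inner c (dphi x v)"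
proof -
  have "mink_inner (tproj c x) (partial m \<phi> x) = mink_inner c (partial m \<phi> x)" for m
  proof -
    have "mink_inner (tproj c x) (partial m \<phi> x) =
        (\<Sum>j\<in>UNIV. \<Sum>l\<in>UNIV. ginv x $ j $ l * mink_inner c (partial l \<phi> x) * g x $ j $ m)"
      by (simp add: tproj_def mink.sum_left mink.scaleR_left first_fund_def)
    also have "\<dots> = (\<Sum>l\<in>UNIV. mink_inner c (partial l \<phi> x) * (\<Sum>j\<in>UNIV. g x $ m $ j * ginv x $ j $ l))"
      by (subst sum.swap) (simp add: sum_distrib_left g_sym[of x _ m] mult_ac)
    also have "\<dots> = mink_inner c (partial m \<phi> x)" by (simp add: ginv_mult[OF x] mult_delta_right)
    finally show ?thesis .
  qed
  then show ?thesis by (simp add: derivative_eq[OF x] mink.sum_right mink.scaleR_right)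
qed

lemma derivative_tangent: "x \<in> U \<Longrightarrow> mink_inner (dphi x v) (\<phi> x) = 0"
  by (simp add: derivative_eq mink.sum_left mink.scaleR_left partial_orthogonal)

lemma tproj_bounds:
  assumes x: "x \<in> U" and c: "c \<in> hyp_space"
  shows "0 \<le> mink_inner c (tproj c x)" "mink_inner c (tproj c x) \<le> (- mink_inner c (\<phi> x))\<^sup>2 - 1"
proof -
  let ?X = "tproj c x" and ?p = "\<phi> x"
  obtain u where u: "?X = dphi x u" by (rule that[OF tproj_in_range[OF x]])
  have XX: "mink_inner ?X ?X = mink_inner c ?X"
    using tproj_inner[OF x, of c u] unfolding u[symmetric] .
  have Xp: "mink_inner ?X ?p = 0" unfolding u by (rule derivative_tangent[OF x])
  show "0 \<le> mink_inner c ?X"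
    using hyp_space_tangent_spacelike(1)[OF in_hyp_space[OF x] Xp] XX by simp
  define s where "s = mink_inner c ?p"
  define N where "N = c - ?X + s *\<^sub>R ?p"
  have pp: "mink_inner ?p ?p = -1" and cc: "mink_inner c c = -1"
    using in_hyp_space[OF x] c by (simp_all add: hyp_space_def)
  have "mink_inner N ?p = 0"
    by (simp add: N_def mink.add_left mink.diff_left mink.scaleR_left Xp pp s_def)
  then have "0 \<le> mink_inner N N" by (rule hyp_space_tangent_spacelike(1)[OF in_hyp_space[OF x]])
  also have "mink_inner N N = s\<^sup>2 - 1 - mink_inner c ?X"
  proof -
    have comm: "mink_inner ?p ?X = 0" "mink_inner ?p c = s" "mink_inner ?X c = mink_inner c ?X" "mink_inner c ?p = s"
      using Xp by (simp_all add: mink_inner_commute s_def)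
    show ?thesis
      unfolding N_def mink.add_left mink.diff_left mink.scaleR_left mink.add_right mink.diff_right mink.scaleR_right
        comm Xp pp cc XX
      by (simp add: power2_eq_square)
  qed
  finally show "mink_inner c ?X \<le> (- mink_inner c ?p)\<^sup>2 - 1" by (simp add: s_def)
qed

lemma weak_identity:
  fixes \<eta> :: "'n mink \<Rightarrow> real"
  assumes H: "\<And>x. x \<in> U \<Longrightarrow> mean_curvature \<phi> x = 0"
    and \<eta>: "\<And>p. p \<in> \<phi> ` U \<Longrightarrow> (\<eta> has_derivative (\<lambda>v. G p \<bullet> v)) (at p)"
    and G: "continuous_on (\<phi> ` U) G"
    and C: "compact C" "C \<subseteq> \<phi> ` U" "\<And>p. p \<in> \<phi> ` U \<Longrightarrow> p \<notin> C \<Longrightarrow> \<eta> p = 0"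
  shows "(\<integral>x. indicator U x * (vd x *
    (real CARD('k) * (- mink_inner c (\<phi> x)) * \<eta> (\<phi> x) - G (\<phi> x) \<bullet> tproj c x)) \<partial>lborel) = 0"
proof -
  let ?I = "\<lambda>x. vd x * (real CARD('k) * (- mink_inner c (\<phi> x)) * \<eta> (\<phi> x) - G (\<phi> x) \<bullet> tproj c x)"
  have \<eta>\<phi>: "C1_on (\<lambda>x. \<eta> (\<phi> x)) U" "\<And>x i. x \<in> U \<Longrightarrow> partial i (\<lambda>x. \<eta> (\<phi> x)) x = G (\<phi> x) \<bullet> partial i \<phi> x"
    using C1_on_ambient[OF C1(1) \<eta> G] by auto
  define K where "K = \<psi> ` C"
  have K: "compact K"
    unfolding K_def by (rule compact_continuous_image[OF continuous_on_subset[OF continuous_\<psi> C(2)] C(1)])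
  have K_sub: "K \<subseteq> U"
  proof
    fix y assume "y \<in> K"
    then obtain p where "p \<in> C" "y = \<psi> p" by (auto simp: K_def)
    then obtain x where "x \<in> U" "p = \<phi> x" using C(2) by auto
    then show "y \<in> U" using \<open>y = \<psi> p\<close> by simp
  qed
  have zero: "\<eta> (\<phi> x) = 0" if "x \<in> U" "x \<notin> K" for x
  proof (rule C(3))
    show "\<phi> x \<notin> C"
    proof
      assume "\<phi> x \<in> C"
      then have "\<psi> (\<phi> x) \<in> K" by (auto simp: K_def)
      then show False using that by simp
    qed
  qed (use that in auto)
  define w where "w j x = (if x \<in> U then - mink_inner c (flux j x) * \<eta> (\<phi> x) else 0)" for j x
  have w_zero: "w j x = 0" if "x \<notin> K" for j x
    using zero[of x] that by (simp add: w_def)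
  have open_K: "open (- K)" using K by (simp add: compact_imp_closed open_Compl)
  have C1_f: "C1_on (\<lambda>x. - mink_inner c (flux j x)) U"
    "x \<in> U \<Longrightarrow> partial i (\<lambda>x. - mink_inner c (flux j x)) x = - mink_inner c (partial i (flux j) x)" for i j x
  proof -
    have "C1_on (\<lambda>x. mink_inner (- c) (flux j x)) U"
      by (rule C1_on_bilinear(1)[OF bounded_bilinear_mink_inner C1_on_const C1_flux])
    then show "C1_on (\<lambda>x. - mink_inner c (flux j x)) U" by (simp add: mink.minus_left)
    show "x \<in> U \<Longrightarrow> partial i (\<lambda>x. - mink_inner c (flux j x)) x = - mink_inner c (partial i (flux j) x)"
      using C1_on_bilinear(2)[OF bounded_bilinear_mink_inner C1_on_const[of "- c"] C1_flux[of j]]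
      by (simp add: mink.minus_left partial_eq[OF has_derivative_const] mink.zero_left)
  qed
  have C1_w: "C1_on (w j) UNIV" for j
  proof -
    have "C1_on (\<lambda>x. - mink_inner c (flux j x) * \<eta> (\<phi> x)) U"
      by (rule C1_on_mult(1)[OF C1_f(1) \<eta>\<phi>(1)])
    then have "C1_on (w j) U" by (rule C1_on_cong[OF _ open_U]) (simp add: w_def)
    moreover have "C1_on (w j) (- K)"
      by (rule C1_on_cong[OF C1_on_const[of 0] open_K]) (simp add: w_zero)
    ultimately have "C1_on (w j) (U \<union> - K)" by (rule C1_on_Un[OF _ _ open_U open_K])
    moreover have "U \<union> - K = UNIV" using K_sub by auto
    ultimately show ?thesis by simp
  qed
  obtain R where R: "\<And>x. x \<in> K \<Longrightarrow> norm x \<le> R"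
    using compact_imp_bounded[OF K] by (auto simp: bounded_iff)
  have w_R: "norm x \<le> R" if "w j x \<noteq> 0" for j x
    using that R w_zero by blast
  have "(\<Sum>j\<in>UNIV. partial j (w j) x) = indicator U x * ?I x" for x
  proof (cases "x \<in> U")
    case True
    have "partial j (w j) x = - mink_inner c (partial j (flux j) x) * \<eta> (\<phi> x)
        - mink_inner c (flux j x) * (G (\<phi> x) \<bullet> partial j \<phi> x)" for j
    proof -
      have "partial j (w j) x = partial j (\<lambda>x. - mink_inner c (flux j x) * \<eta> (\<phi> x)) x"
        by (rule partial_cong[OF open_U True]) (simp add: w_def)
      also have "\<dots> = - mink_inner c (flux j x) * (G (\<phi> x) \<bullet> partial j \<phi> x) + - mink_inner c (partial j (flux j) x) * \<eta> (\<phi> x)"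
        using C1_on_mult(2)[OF C1_f(1) \<eta>\<phi>(1) True] C1_f(2)[OF True] \<eta>\<phi>(2)[OF True] by simp
      finally show ?thesis by simp
    qed
    then have "(\<Sum>j\<in>UNIV. partial j (w j) x) = - mink_inner c (\<Sum>j\<in>UNIV. partial j (flux j) x) * \<eta> (\<phi> x)
        - (\<Sum>j\<in>UNIV. mink_inner c (flux j x) * (G (\<phi> x) \<bullet> partial j \<phi> x))"
      by (simp add: sum_subtractf sum_negf mink.sum_right sum_distrib_right)
    also have "(\<Sum>j\<in>UNIV. partial j (flux j) x) = (real CARD('k) * vd x) *\<^sub>R \<phi> x"
      by (rule div_flux[OF True H[OF True]])
    also have "(\<Sum>j\<in>UNIV. mink_inner c (flux j x) * (G (\<phi> x) \<bullet> partial j \<phi> x)) = vd x * (G (\<phi> x) \<bullet> tproj c x)"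
      by (simp add: flux_def tproj_def mink.sum_right mink.scaleR_right inner_sum_right sum_distrib_left sum_distrib_right mult_ac)
    finally show ?thesis using True by (simp add: mink.scaleR_right algebra_simps)
  next
    case False
    then have "x \<in> - K" using K_sub by auto
    then have "partial j (w j) x = partial j (\<lambda>_. 0) x" for j
      by (rule partial_cong[OF open_K]) (simp add: w_zero)
    then show ?thesis using False by (simp add: partial_eq[OF has_derivative_const])
  qed
  then have "(\<integral>x. indicator U x * ?I x \<partial>lborel) = (\<integral>x. (\<Sum>j\<in>UNIV. partial j (w j) x) \<partial>lborel)"
    by simp
  also have "\<dots> = (\<Sum>j\<in>UNIV. integral\<^sup>L lborel (partial j (w j)))"
    by (rule Bochner_Integration.integral_sum) (rule integral_partial_eq_0(1)[OF C1_w w_R])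
  also have "\<dots> = 0" by (rule sum.neutral) (simp add: integral_partial_eq_0(2)[OF C1_w w_R])
  finally show ?thesis .
qed

end

context chart_pair
begin

lemma tproj_eq:
  assumes x: "x \<in> U" and y: "y \<in> U'" and eq: "\<phi> x = \<phi>' y"
  shows "c1.tproj c x = c2.tproj c y"
proof -
  interpret sw: chart_pair S U' U \<phi>' \<phi> ..
  let ?D = "c1.dphi x" and ?D' = "c2.dphi y"
  obtain T where T: "\<And>h. ?D' (T h) = ?D h" by (rule transition_derivative[OF x y eq]) (rule that)
  obtain T' where T': "\<And>h. ?D (T' h) = ?D' h"
    by (rule sw.transition_derivative[OF y x eq[symmetric]]) (rule that)
  let ?a = "c1.tproj c x" and ?b = "c2.tproj c y"
  obtain u where u: "?a = ?D u" by (rule that[OF c1.tproj_in_range[OF x]])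
  obtain u' where u': "?b = ?D' u'" by (rule that[OF c2.tproj_in_range[OF y]])
  have ab: "?a - ?b = ?D (u - T' u')"
    unfolding u u' by (simp add: linear_diff[OF c1.linear_derivative[OF x]] T')
  have orth: "mink_inner (?a - ?b) (?D v) = 0" for v
    using c1.tproj_inner[OF x, of c v] c2.tproj_inner[OF y, of c "T v"] by (simp add: T mink.diff_left)
  have "mink_inner (?a - ?b) (?a - ?b) = 0" using orth[of "u - T' u'"] unfolding ab[symmetric] .
  moreover have "mink_inner (?a - ?b) (\<phi> x) = 0"
    unfolding ab by (rule c1.derivative_tangent[OF x])
  ultimately have "?a - ?b = 0"
    by (intro hyp_space_tangent_spacelike(2)[OF c1.in_hyp_space[OF x]])
  then show ?thesis by simp
qed

end

context chart_cover
begin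

definition X :: "'n mink \<Rightarrow> 'n mink \<Rightarrow> 'n mink" where
  "X c p = (let i = (SOME i. i < n \<and> p \<in> W i) in
    chart.tproj (\<phi> i) c (chart.\<psi> (U i) (\<phi> i) p))"

lemma X_eq:
  assumes i: "i < n" and x: "x \<in> U i"
  shows "X c (\<phi> i x) = chart.tproj (\<phi> i) c x"
proof -
  define j where "j = (SOME j. j < n \<and> \<phi> i x \<in> W j)"
  have "i < n \<and> \<phi> i x \<in> W i" using i x by (simp add: W_def)
  then have j: "j < n" "\<phi> i x \<in> W j"
    using someI[of "\<lambda>j. j < n \<and> \<phi> i x \<in> W j" i] unfolding j_def by auto
  interpret ci: chart S "U i" "\<phi> i" by (rule chart[OF i])
  interpret cj: chart S "U j" "\<phi> j" by (rule chart[OF j(1)])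
  interpret chart_pair S "U i" "U j" "\<phi> i" "\<phi> j" ..
  obtain y where y: "y \<in> U j" "\<phi> i x = \<phi> j y" using j(2) by (auto simp: W_def)
  have "X c (\<phi> i x) = cj.tproj c (cj.\<psi> (\<phi> i x))"
    unfolding X_def Let_def j_def ..
  also have "\<dots> = cj.tproj c y" by (simp add: y)
  also have "\<dots> = ci.tproj c x" by (rule tproj_eq[OF x y, symmetric])
  finally show ?thesis .
qed

lemma continuous_X:
  assumes i: "i < n"
  shows "continuous_on (W i) (X c)"
proof -
  interpret ci: chart S "U i" "\<phi> i" by (rule chart[OF i])
  have "continuous_on (W i) (\<lambda>p. ci.tproj c (ci.\<psi> p))"
    unfolding W_def by (rule continuous_on_compose2[OF ci.continuous_tproj ci.continuous_\<psi>]) auto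
  then show ?thesis by (rule continuous_on_eq) (auto simp: W_def X_eq[OF i])
qed

end

section \<open>Covers by finitely many charts\<close>

lemma Ck_on_subset: "Ck_on m f U \<Longrightarrow> V \<subseteq> U \<Longrightarrow> Ck_on m f V"
proof (induction m arbitrary: f)
  case 0
  then show ?case by (simp add: continuous_on_subset[of U f V])
next
  case (Suc m)
  then show ?case by (simp add: differentiable_on_subset[of f U V])
qed

lemma local_param_subset:
  assumes "local_param S U \<phi>" "open V" "V \<subseteq> U"
  shows "local_param S V \<phi>"
proof -
  obtain \<psi> where h: "homeomorphism U (\<phi> ` U) \<phi> \<psi>" and o: "openin (top_of_set S) (\<phi> ` U)"
    using assms(1) unfolding local_param_def by auto
  have "openin (top_of_set U) V" using assms(2,3) by (simp add: open_subset)
  then have "openin (top_of_set S) (\<phi> ` V)"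
    using openin_trans[OF homeomorphism_imp_open_map[OF h] o] by simp
  moreover have "homeomorphism V (\<phi> ` V) \<phi> \<psi>"
    by (rule homeomorphism_of_subsets[OF h assms(3) image_mono[OF assms(3)] refl])
  moreover have "smooth_on \<phi> V"
  proof -
    have "Ck_on m \<phi> U" for m
      using assms(1) by (simp add: local_param_def smooth_on_def)
    then show ?thesis unfolding smooth_on_def using Ck_on_subset[OF _ assms(3)] by blast
  qed
  moreover have "\<forall>x\<in>V. inj (frechet_derivative \<phi> (at x))"
    using assms(1,3) by (auto simp: local_param_def)
  ultimately show ?thesis using assms(2) unfolding local_param_def by auto
qed

lemma small_chart:
  fixes S :: "'n::finite mink set"
  assumes "hyp_submanifold TYPE('k::finite) S" "p \<in> S"
  shows "\<exists>U (\<phi> :: real ^ 'k \<Rightarrow> 'n mink) e. local_param S U \<phi> \<and> patch_volume \<phi> U < \<infinity> \<and>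
    0 < e \<and> S \<inter> cball p e \<subseteq> \<phi> ` U"
proof -
  obtain U0 and \<phi> :: "real ^ 'k \<Rightarrow> 'n mink" where p0: "local_param S U0 \<phi>" "p \<in> \<phi> ` U0" and S: "S \<subseteq> hyp_space"
    using assms unfolding hyp_submanifold_def by auto
  interpret c: chart S U0 \<phi> by unfold_locales (fact p0 S)+
  obtain x where x: "x \<in> U0" "p = \<phi> x" using p0(2) by auto
  obtain r where r: "r > 0" "cball x r \<subseteq> U0" using c.open_U x(1) open_contains_cball by metis
  let ?U = "ball x r"
  have U: "local_param S ?U \<phi>"
    by (rule local_param_subset[OF p0(1) open_ball]) (use r ball_subset_cball in auto)
  have "bounded (c.vd ` cball x r)"
    by (intro compact_imp_bounded compact_continuous_image compact_cball
        continuous_on_subset[OF C1_on_continuous[OF c.C1_vd] r(2)])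
  then obtain C where C: "\<forall>y\<in>cball x r. \<bar>c.vd y\<bar> \<le> C" unfolding bounded_iff by auto
  have "patch_volume \<phi> ?U \<le> (\<integral>\<^sup>+y. ennreal C * indicator ?U y \<partial>lborel)"
    unfolding patch_volume_def
  proof (rule nn_integral_mono)
    fix y
    show "ennreal (c.vd y) * indicator ?U y \<le> ennreal C * indicator ?U y"
      using bspec[OF C, of y] by (cases "y \<in> ?U") (auto intro!: ennreal_leI)
  qed
  also have "\<dots> = ennreal C * emeasure lborel ?U" by (rule nn_integral_cmult_indicator) simp
  also have "\<dots> < \<infinity>"
    using emeasure_bounded_finite[OF bounded_ball, of x r] by (simp add: ennreal_mult_less_top less_top)
  finally have fin: "patch_volume \<phi> ?U < \<infinity>" .
  have "openin (top_of_set S) (\<phi> ` ?U)" "p \<in> \<phi> ` ?U"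
    using U x r(1) by (auto simp: local_param_def)
  then obtain e where "e > 0" "cball p e \<inter> S \<subseteq> \<phi> ` ?U" unfolding openin_contains_cball by auto
  then show ?thesis using U fin by (intro exI[of _ ?U] exI[of _ \<phi>] exI[of _ e]) auto
qed

lemma continuous_on_mink_inner: "continuous_on A (mink_inner c)"
  by (intro mink.continuous_on continuous_on_const continuous_on_id)

lemma compact_sublevel:
  assumes "closed S" "S \<subseteq> hyp_space" "c \<in> hyp_space"
  shows "compact {p \<in> S. - mink_inner c p \<le> t}"
proof -
  note c = hyp_space_norm[OF assms(3)]
  have gap: "norm (snd c) < fst c" by (rule power2_less_imp_less) (use c in auto)
  define R where "R = t / (fst c - norm (snd c))"
  have "norm p \<le> R + R" if "p \<in> S" "- mink_inner c p \<le> t" for p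
  proof -
    have "p \<in> hyp_space" using that assms by auto
    note p = hyp_space_norm[OF this]
    have p': "norm (snd p) \<le> fst p" by (rule power2_le_imp_le) (use p in auto)
    have "snd c \<bullet> snd p \<le> norm (snd c) * norm (snd p)" by (rule norm_cauchy_schwarz)
    also have "\<dots> \<le> norm (snd c) * fst p" using p' by (simp add: mult_left_mono)
    finally have "fst p * (fst c - norm (snd c)) \<le> t"
      using that(2) by (simp add: mink_inner_def algebra_simps)
    then have "fst p \<le> R" unfolding R_def using gap by (simp add: pos_le_divide_eq)
    moreover have "norm p \<le> norm (fst p) + norm (snd p)"
      using norm_Pair_le[of "fst p" "snd p"] by simp
    ultimately show ?thesis using p p' by simp
  qed
  then have "bounded {p \<in> S. - mink_inner c p \<le> t}" by (auto simp: bounded_iff)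
  moreover have "closed {p \<in> S. - mink_inner c p \<le> t}"
  proof -
    have "closed {p. - mink_inner c p \<le> t}"
      by (intro closed_Collect_le continuous_on_minus continuous_on_mink_inner continuous_on_const)
    then have "closed (S \<inter> {p. - mink_inner c p \<le> t})"
      using assms(1) by (rule closed_Int[rotated])
    then show ?thesis by (simp add: Collect_conj_eq)
  qed
  ultimately show ?thesis by (simp add: compact_eq_bounded_closed)
qed

definition bump :: "'a::euclidean_space \<Rightarrow> real \<Rightarrow> 'a \<Rightarrow> real" where
  "bump p e x = (max 0 (e\<^sup>2 - (x - p) \<bullet> (x - p)))\<^sup>2"

definition bump_grad :: "'a::euclidean_space \<Rightarrow> real \<Rightarrow> 'a \<Rightarrow> 'a" where
  "bump_grad p e x = (2 * max 0 (e\<^sup>2 - (x - p) \<bullet> (x - p)) * (- 2)) *\<^sub>R (x - p)"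

lemma bump_has_derivative: "(bump p e has_derivative (\<lambda>v. bump_grad p e x \<bullet> v)) (at x)"
proof -
  have "((\<lambda>x. e\<^sup>2 - (x - p) \<bullet> (x - p)) has_derivative (\<lambda>v. - 2 * ((x - p) \<bullet> v))) (at x)"
    by (auto intro!: derivative_eq_intros simp: inner_commute)
  from diff_chain_at[OF this has_real_derivative_square_pos_part[unfolded has_field_derivative_def]]
  have "(bump p e has_derivative (\<lambda>v. 2 * max 0 (e\<^sup>2 - (x - p) \<bullet> (x - p)) * (- 2 * ((x - p) \<bullet> v)))) (at x)"
    by (simp add: o_def bump_def[abs_def])
  then show ?thesis by (simp add: bump_grad_def mult.assoc)
qed

lemma continuous_bump: "continuous_on A (bump p e)" "continuous_on A (bump_grad p e)"
  unfolding bump_def[abs_def] bump_grad_def[abs_def] by (intro continuous_intros)+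

lemma bump_nonneg: "0 \<le> bump p e x"
  by (simp add: bump_def)

lemma bump_pos: "dist p x < e \<Longrightarrow> 0 < bump p e x"
proof -
  assume "dist p x < e"
  then have "(dist p x)\<^sup>2 < e\<^sup>2" by (intro power_strict_mono) auto
  then show ?thesis
    by (simp add: bump_def dist_norm norm_minus_commute[of p] power2_norm_eq_inner)
qed

lemma bump_zero: "0 < e \<Longrightarrow> x \<notin> cball p e \<Longrightarrow> bump p e x = 0" "0 < e \<Longrightarrow> x \<notin> cball p e \<Longrightarrow> bump_grad p e x = 0"
proof -
  assume "0 < e" "x \<notin> cball p e"
  then have "e\<^sup>2 \<le> (dist p x)\<^sup>2" by (intro power_mono) auto
  then have "e\<^sup>2 - (x - p) \<bullet> (x - p) \<le> 0"
    by (simp add: dist_norm norm_minus_commute[of p] power2_norm_eq_inner)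
  then show "bump p e x = 0" "bump_grad p e x = 0"
    by (simp_all add: bump_def bump_grad_def max_def)
qed

lemma continuous_on_mult_compose:
  "continuous_on UNIV (h :: real \<Rightarrow> real) \<Longrightarrow> continuous_on A F \<Longrightarrow> continuous_on A (\<lambda>x. h (F x))"
  by (rule continuous_on_compose2[of UNIV h A F]) auto

context chart_cover
begin

lemma W_subset: "i < n \<Longrightarrow> W i \<subseteq> S"
  unfolding W_def by (rule chart.image_subset[OF chart])

definition q :: "'n mink \<Rightarrow> 'n mink \<Rightarrow> real" where
  "q c p = (\<Sum>i<n. indicator (D i) p * mink_inner c (indicator (W i) p *\<^sub>R X c p))"

lemma q_eq:
  assumes "p \<in> (\<Union>i<n. W i)"
  shows "q c p = mink_inner c (X c p)"
proof -
  obtain i where i: "i < n" "p \<in> D i" using assms unfolding UN_D[symmetric] by auto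
  have "indicator (D j) p * mink_inner c (indicator (W j) p *\<^sub>R X c p) =
      (if j = i then mink_inner c (X c p) else 0)" for j
    using i D_disjoint[of i j] D_subset[of i] by (auto simp: indicator_def)
  then show ?thesis using i by (simp add: q_def)
qed

lemma X_borel: "i < n \<Longrightarrow> (\<lambda>p. indicator (W i) p *\<^sub>R X c p) \<in> borel_measurable borel"
  by (rule borel_measurable_continuous_on_indicator[OF W_borel continuous_X])

lemma q_borel: "q c \<in> borel_measurable borel"
  unfolding q_def[abs_def]
proof (intro borel_measurable_sum borel_measurable_times)
  fix i assume "i \<in> {..<n}"
  then have i: "i < n" by simp
  show "indicator (D i) \<in> borel_measurable borel" using D_borel[OF i] by simp
  have "mink_inner c \<in> borel_measurable borel"
    by (intro borel_measurable_continuous_onI continuous_on_mink_inner)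
  then show "(\<lambda>p. mink_inner c (indicator (W i) p *\<^sub>R X c p)) \<in> borel_measurable borel"
    using measurable_compose[OF X_borel[OF i]] by blast
qed

lemma q_bounds:
  assumes c: "c \<in> hyp_space" and p: "p \<in> (\<Union>i<n. W i)"
  shows "0 \<le> q c p \<and> q c p \<le> (- mink_inner c p)\<^sup>2 - 1"
proof -
  obtain i x where i: "i < n" "x \<in> U i" "p = \<phi> i x" using p by (auto simp: W_def)
  show ?thesis
    using chart.tproj_bounds[OF chart[OF i(1)] i(2) c] unfolding q_eq[OF p] unfolding i(3) X_eq[OF i(1,2)] by simp
qed

end

locale minimal_chart_cover = chart_cover S n U \<phi>
  for S :: "'n::finite mink set" and n and U :: "nat \<Rightarrow> (real ^ 'k::finite) set" and \<phi> +
  fixes c :: "'n mink" and pc :: "nat \<Rightarrow> 'n mink" and e :: "nat \<Rightarrow> real" and T :: real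
  assumes c: "c \<in> hyp_space"
    and minimal: "\<And>i x. i < n \<Longrightarrow> x \<in> U i \<Longrightarrow> mean_curvature (\<phi> i) x = 0"
    and e: "\<And>i. i < n \<Longrightarrow> 0 < e i" "\<And>i. i < n \<Longrightarrow> S \<inter> cball (pc i) (e i) \<subseteq> W i"
    and cover: "\<And>p. p \<in> S \<Longrightarrow> - mink_inner c p \<le> T \<Longrightarrow> \<exists>i<n. dist (pc i) p < e i"
begin

lemma stationary_identity:
  assumes h: "\<And>s. (h has_real_derivative h' s) (at s)" "continuous_on UNIV h'" "\<And>s. T \<le> s \<Longrightarrow> h s = 0"
  shows "(\<integral>p. h' (- mink_inner c p) * q c p + real CARD('k) * (- mink_inner c p) * h (- mink_inner c p) \<partial>M) = 0"
proof -
  define F where "F p = - mink_inner c p" for p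
  define gF where "gF = (fst c, - snd c)"
  have F_eq: "F p = gF \<bullet> p" for p
    by (simp add: F_def gF_def mink_inner_def inner_prod_def)
  define b where "b i = bump (pc i) (e i)" for i
  define gb where "gb i = bump_grad (pc i) (e i)" for i
  define \<beta> where "\<beta> p = (\<Sum>i<n. b i p)" for p
  define g\<beta> where "g\<beta> p = (\<Sum>i<n. gb i p)" for p
  \<comment> \<open>\<open>b i / \<beta>\<close> is a partition of unity. Where \<open>\<beta> = 0\<close> on \<open>S\<close>, \<open>F > T\<close> and both numerators vanish.\<close>
  define \<zeta> where "\<zeta> p = h (F p) / \<beta> p" for p
  define g\<zeta> where "g\<zeta> p = (h' (F p) / \<beta> p) *\<^sub>R gF - (h (F p) / (\<beta> p * \<beta> p)) *\<^sub>R g\<beta> p" for p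
  define \<eta> where "\<eta> i p = b i p * \<zeta> p" for i p
  define G where "G i p = b i p *\<^sub>R g\<zeta> p + \<zeta> p *\<^sub>R gb i p" for i p
  define O1 where "O1 = {p. 0 < \<beta> p}"
  define O2 where "O2 = {p. T < F p}"
  have cont_F: "continuous_on A F" for A
    unfolding F_eq by (intro continuous_intros)
  have cont_b: "continuous_on A (b i)" "continuous_on A (gb i)" for A i
    unfolding b_def gb_def by (rule continuous_bump)+
  have cont_\<beta>: "continuous_on A \<beta>" "continuous_on A g\<beta>" for A
    unfolding \<beta>_def[abs_def] g\<beta>_def[abs_def] by (intro continuous_on_sum cont_b)+
  have cont_h: "continuous_on UNIV h"
    using h(1) by (intro continuous_at_imp_continuous_on ballI DERIV_isCont)
  have opens: "open O1" "open O2"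
    unfolding O1_def O2_def by (intro open_Collect_less continuous_on_const cont_F cont_\<beta>)+
  have S_cover: "S \<subseteq> O1 \<union> O2"
  proof
    fix p assume p: "p \<in> S"
    show "p \<in> O1 \<union> O2"
    proof (cases "F p \<le> T")
      case True
      then obtain i where i: "i < n" "dist (pc i) p < e i" using cover[OF p] by (auto simp: F_def)
      have "0 < b i p" unfolding b_def by (rule bump_pos[OF i(2)])
      also have "b i p \<le> \<beta> p"
        unfolding \<beta>_def using i(1) by (intro member_le_sum) (auto simp: b_def bump_nonneg)
      finally show ?thesis by (simp add: O1_def)
    qed (simp add: O2_def)
  qed
  have h'_zero: "h' s = 0" if "T < s" for s
  proof -
    have "((\<lambda>_. 0) has_real_derivative h' s) (at s)"
      by (rule has_field_derivative_transform_within_open[OF h(1), where S = "{T<..}"]) (use that h(3) in auto)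
    then show ?thesis using DERIV_const DERIV_unique by blast
  qed
  have zero2: "\<zeta> p = 0" "g\<zeta> p = 0" if "p \<in> O2" for p
    using that h(3)[of "F p"] h'_zero[of "F p"] by (simp_all add: O2_def \<zeta>_def g\<zeta>_def)
  have der_b: "(b i has_derivative (\<lambda>v. gb i p \<bullet> v)) (at p)" for i p
    unfolding b_def gb_def by (rule bump_has_derivative)
  have der_\<zeta>: "(\<zeta> has_derivative (\<lambda>v. g\<zeta> p \<bullet> v)) (at p)" if "p \<in> O1 \<union> O2" for p
  proof (cases "p \<in> O2")
    case True
    have "((\<lambda>_. 0) has_derivative (\<lambda>v. g\<zeta> p \<bullet> v)) (at p)" using zero2[OF True] by simp
    then show ?thesis
      by (rule has_derivative_transform_within_open[OF _ opens(2) True]) (simp add: zero2)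
  next
    case False
    then have \<beta>p: "\<beta> p \<noteq> 0" using that by (auto simp: O1_def)
    have "(\<beta> has_derivative (\<lambda>v. \<Sum>i<n. gb i p \<bullet> v)) (at p)"
      unfolding \<beta>_def[abs_def] by (intro has_derivative_sum der_b)
    moreover have "((\<lambda>p. h (F p)) has_derivative (\<lambda>v. h' (F p) * (gF \<bullet> v))) (at p)"
    proof -
      have "(F has_derivative (\<lambda>v. gF \<bullet> v)) (at p)"
        unfolding F_eq[abs_def] by (auto intro!: derivative_eq_intros)
      from diff_chain_at[OF this h(1)[unfolded has_field_derivative_def]]
      show ?thesis by (simp add: o_def)
    qed
    ultimately have "(\<zeta> has_derivative
        (\<lambda>v. (h' (F p) * (gF \<bullet> v) * \<beta> p - h (F p) * (\<Sum>i<n. gb i p \<bullet> v)) / (\<beta> p * \<beta> p))) (at p)"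
      unfolding \<zeta>_def[abs_def] by (intro has_derivative_divide' \<beta>p)
    moreover have "(h' (F p) * (gF \<bullet> v) * \<beta> p - h (F p) * (\<Sum>i<n. gb i p \<bullet> v)) / (\<beta> p * \<beta> p) = g\<zeta> p \<bullet> v" for v
      using \<beta>p by (simp add: g\<zeta>_def g\<beta>_def inner_diff_left inner_sum_left diff_divide_distrib)
    ultimately show ?thesis by simp
  qed
  have der_\<eta>: "(\<eta> i has_derivative (\<lambda>v. G i p \<bullet> v)) (at p)" if "p \<in> O1 \<union> O2" for i p
  proof -
    have "((\<lambda>p. b i p * \<zeta> p) has_derivative (\<lambda>v. b i p * (g\<zeta> p \<bullet> v) + (gb i p \<bullet> v) * \<zeta> p)) (at p)"
      by (rule has_derivative_mult[OF der_b der_\<zeta>[OF that]])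
    then show ?thesis by (simp add: \<eta>_def[abs_def] G_def inner_add_left mult.commute)
  qed
  have cont_\<zeta>: "continuous_on (O1 \<union> O2) \<zeta>" "continuous_on (O1 \<union> O2) g\<zeta>"
  proof -
    have "continuous_on O1 \<zeta>" "continuous_on O1 g\<zeta>"
      unfolding \<zeta>_def[abs_def] g\<zeta>_def[abs_def]
      by (intro continuous_on_divide continuous_on_diff continuous_on_scaleR continuous_on_mult continuous_on_const
          continuous_on_mult_compose[OF cont_h] continuous_on_mult_compose[OF h(2)] cont_F cont_\<beta>; simp add: O1_def)+
    moreover have "continuous_on O2 \<zeta>" "continuous_on O2 g\<zeta>"
      by (rule continuous_on_eq[OF continuous_on_const[of _ 0]], simp add: zero2)+
    ultimately show "continuous_on (O1 \<union> O2) \<zeta>" "continuous_on (O1 \<union> O2) g\<zeta>"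
      by (auto intro!: continuous_on_open_Un opens)
  qed
  have cont_\<eta>: "continuous_on (O1 \<union> O2) (\<eta> i)" "continuous_on (O1 \<union> O2) (G i)" for i
    unfolding \<eta>_def[abs_def] G_def[abs_def]
    by (intro continuous_on_add continuous_on_mult continuous_on_scaleR cont_\<zeta> cont_b)+
  let ?v = "\<lambda>i p. real CARD('k) * F p * \<eta> i p - G i p \<bullet> X c p"
  define v where "v i p = indicator (W i) p *\<^sub>R ?v i p" for i p
  have WO: "W i \<subseteq> O1 \<union> O2" if "i < n" for i
    using W_subset[OF that] S_cover by (rule subset_trans)
  have cont_v: "continuous_on (W i) (?v i)" if i: "i < n" for i
    by (intro continuous_on_diff continuous_on_mult continuous_on_const cont_F continuous_on_inner
        continuous_X[OF i] continuous_on_subset[OF cont_\<eta>(1) WO[OF i]] continuous_on_subset[OF cont_\<eta>(2) WO[OF i]])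
  have v_borel: "v i \<in> borel_measurable borel" if i: "i < n" for i
    unfolding v_def[abs_def] by (rule borel_measurable_continuous_on_indicator[OF W_borel[OF i] cont_v[OF i]])
  have b_zero: "b i p = 0" "gb i p = 0" if "i < n" "p \<notin> cball (pc i) (e i)" for i p
    unfolding b_def gb_def using bump_zero[OF e(1)[OF that(1)] that(2)] by auto
  have \<eta>_zero: "\<eta> i p = 0" "G i p = 0" if "i < n" "p \<notin> cball (pc i) (e i)" for i p
    using b_zero[OF that] by (simp_all add: \<eta>_def G_def)
  have compact_C: "compact (S \<inter> cball (pc i) (e i))" for i
    using closed_Int_compact[OF closed_S compact_cball] .
  have v_int: "integrable M (v i)" if i: "i < n" for i
  proof -
    have "bounded ((?v i) ` (S \<inter> cball (pc i) (e i)))"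
      by (intro compact_imp_bounded compact_continuous_image compact_C continuous_on_subset[OF cont_v[OF i] e(2)[OF i]])
    then obtain B where B: "\<forall>p\<in>S \<inter> cball (pc i) (e i). \<bar>?v i p\<bar> \<le> B" "0 < B"
      unfolding bounded_pos by auto
    have "norm (v i p) \<le> B" for p
    proof (cases "p \<in> W i \<and> p \<in> cball (pc i) (e i)")
      case True
      then show ?thesis using bspec[OF B(1), of p] W_subset[OF i] by (auto simp: v_def)
    next
      case False
      then show ?thesis using \<eta>_zero[OF i, of p] B(2) by (cases "p \<in> W i") (simp_all add: v_def)
    qed
    then show ?thesis
      using v_borel[OF i]
      by (intro finite_measure.integrable_const_bound[OF finite_measure_M, of _ B] AE_I2)
        (simp_all add: measurable_cong_sets[OF sets_M refl])
  qed
  have v_0: "integral\<^sup>L M (v i) = 0" if i: "i < n" for i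
  proof -
    interpret ci: chart S "U i" "\<phi> i" by (rule chart[OF i])
    have "integral\<^sup>L M (v i) = (\<integral>x. indicator (U i) x * (ci.vd x * v i (\<phi> i x)) \<partial>lborel)"
      by (rule integral_M_chart[OF i v_borel[OF i]]) (simp add: v_def)
    also have "\<dots> = (\<integral>x. indicator (U i) x * (ci.vd x *
      (real CARD('k) * (- mink_inner c (\<phi> i x)) * \<eta> i (\<phi> i x) - G i (\<phi> i x) \<bullet> ci.tproj c x)) \<partial>lborel)"
    proof (rule Bochner_Integration.integral_cong[OF refl])
      fix x
      show "indicator (U i) x * (ci.vd x * v i (\<phi> i x)) = indicator (U i) x * (ci.vd x *
        (real CARD('k) * (- mink_inner c (\<phi> i x)) * \<eta> i (\<phi> i x) - G i (\<phi> i x) \<bullet> ci.tproj c x))"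
        by (cases "x \<in> U i") (simp_all add: v_def W_def X_eq[OF i] F_def)
    qed
    also have "\<dots> = 0"
    proof (rule ci.weak_identity[OF minimal[OF i]])
      show "(\<eta> i has_derivative (\<lambda>v. G i p \<bullet> v)) (at p)" if "p \<in> \<phi> i ` U i" for p
        by (rule der_\<eta>) (use subsetD[OF WO[OF i], of p] that in \<open>simp add: W_def\<close>)
      show "continuous_on (\<phi> i ` U i) (G i)"
        using continuous_on_subset[OF cont_\<eta>(2) WO[OF i]] by (simp add: W_def)
      show "compact (S \<inter> cball (pc i) (e i))" by (rule compact_C)
      show "S \<inter> cball (pc i) (e i) \<subseteq> \<phi> i ` U i" using e(2)[OF i] by (simp add: W_def)
      show "\<eta> i p = 0" if "p \<in> \<phi> i ` U i" "p \<notin> S \<inter> cball (pc i) (e i)" for p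
        using \<eta>_zero(1)[OF i, of p] that ci.image_subset by auto
    qed
    finally show ?thesis .
  qed
  have sum_v: "(\<Sum>i<n. v i p) = h' (F p) * q c p + real CARD('k) * F p * h (F p)" if p: "p \<in> (\<Union>i<n. W i)" for p
  proof -
    have pS: "p \<in> S" using p W_subset by auto
    have "v i p = ?v i p" if i: "i < n" for i
    proof (cases "p \<in> W i")
      case False
      then have "p \<notin> cball (pc i) (e i)" using e(2)[OF i] pS by auto
      then show ?thesis using False \<eta>_zero[OF i] by (simp add: v_def)
    qed (simp add: v_def)
    then have "(\<Sum>i<n. v i p) = real CARD('k) * F p * (\<Sum>i<n. \<eta> i p) - (\<Sum>i<n. G i p) \<bullet> X c p"
      by (simp add: sum_subtractf sum_distrib_left inner_sum_left)
    also have "(\<Sum>i<n. \<eta> i p) = \<beta> p * \<zeta> p" by (simp add: \<eta>_def \<beta>_def sum_distrib_right)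
    also have "(\<Sum>i<n. G i p) = \<beta> p *\<^sub>R g\<zeta> p + \<zeta> p *\<^sub>R g\<beta> p"
      by (simp add: G_def \<beta>_def g\<beta>_def sum.distrib scaleR_sum_left scaleR_sum_right)
    finally have "(\<Sum>i<n. v i p) = real CARD('k) * F p * (\<beta> p * \<zeta> p) - (\<beta> p *\<^sub>R g\<zeta> p + \<zeta> p *\<^sub>R g\<beta> p) \<bullet> X c p" .
    moreover have "\<beta> p * \<zeta> p = h (F p) \<and> \<beta> p *\<^sub>R g\<zeta> p + \<zeta> p *\<^sub>R g\<beta> p = h' (F p) *\<^sub>R gF"
    proof (cases "p \<in> O2")
      case True
      then show ?thesis
        using zero2[OF True] h(3)[of "F p"] h'_zero[of "F p"] by (simp add: O2_def)
    next
      case False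
      then have "\<beta> p \<noteq> 0" using pS S_cover by (auto simp: O1_def)
      then show ?thesis by (simp add: \<zeta>_def g\<zeta>_def scaleR_right_diff_distrib)
    qed
    moreover have "gF \<bullet> X c p = - q c p"
      unfolding q_eq[OF p] using F_eq[of "X c p"] by (simp add: F_def)
    ultimately show ?thesis by simp
  qed
  have "(\<integral>p. h' (F p) * q c p + real CARD('k) * F p * h (F p) \<partial>M) = (\<integral>p. (\<Sum>i<n. v i p) \<partial>M)"
  proof (rule integral_cong_AE)
    show "AE p in M. h' (F p) * q c p + real CARD('k) * F p * h (F p) = (\<Sum>i<n. v i p)"
      using AE_M by (rule AE_mp) (intro AE_I2 impI, simp add: sum_v)
    have [measurable]: "F \<in> borel_measurable borel" "h \<in> borel_measurable borel" "h' \<in> borel_measurable borel" "q c \<in> borel_measurable borel"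
      using cont_F cont_h h(2) q_borel by (auto intro: borel_measurable_continuous_onI)
    have "(\<lambda>p. h' (F p) * q c p + real CARD('k) * F p * h (F p)) \<in> borel_measurable borel"
      by measurable
    then show "(\<lambda>p. h' (F p) * q c p + real CARD('k) * F p * h (F p)) \<in> borel_measurable M"
      by (simp add: measurable_cong_sets[OF sets_M refl])
    have "(\<lambda>p. \<Sum>i<n. v i p) \<in> borel_measurable borel"
      by (rule borel_measurable_sum) (simp add: v_borel)
    then show "(\<lambda>p. \<Sum>i<n. v i p) \<in> borel_measurable M"
      by (simp add: measurable_cong_sets[OF sets_M refl])
  qed
  also have "\<dots> = (\<Sum>i<n. integral\<^sup>L M (v i))"
    by (rule Bochner_Integration.integral_sum) (simp add: v_int)
  also have "\<dots> = 0" by (simp add: v_0)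
  finally show ?thesis unfolding F_def .
qed

end

lemma cosh_hyp_dist:
  assumes "c \<in> hyp_space" "p \<in> hyp_space"
  shows "cosh (hyp_dist c p) = - mink_inner c p" "0 \<le> hyp_dist c p"
  using hyp_space_inner_ge_1[OF assms] by (simp_all add: hyp_dist_def cosh_arcosh_real arcosh_nonneg_real)

lemma hyp_dist_set_le:
  assumes "c \<in> hyp_space" "S \<subseteq> hyp_space" "p \<in> S"
  shows "cosh (hyp_dist_set c S) \<le> - mink_inner c p"
proof -
  have nonneg: "0 \<le> hyp_dist c x" if "x \<in> S" for x
    using cosh_hyp_dist(2)[OF assms(1)] assms(2) that by blast
  have "hyp_dist_set c S \<le> hyp_dist c p"
    unfolding hyp_dist_set_def by (rule cINF_lower[OF bdd_belowI2 assms(3)]) (rule nonneg)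
  moreover have "0 \<le> hyp_dist_set c S"
    unfolding hyp_dist_set_def by (rule cINF_greatest) (use nonneg assms(3) in auto)
  ultimately have "cosh (hyp_dist_set c S) \<le> cosh (hyp_dist c p)"
    by (simp add: cosh_real_nonneg_le_iff)
  then show ?thesis using cosh_hyp_dist(1)[OF assms(1) subsetD[OF assms(2,3)]] by simp
qed

lemma finite_chart_cover:
  fixes S :: "'n::finite mink set"
  assumes sub: "hyp_submanifold TYPE('k::finite) S" and S: "closed S" and c: "c \<in> hyp_space"
  obtains n and U :: "nat \<Rightarrow> (real ^ 'k) set" and \<phi> :: "nat \<Rightarrow> real ^ 'k \<Rightarrow> 'n mink" and pc e
  where "chart_cover S n U \<phi>" "\<And>i. i < n \<Longrightarrow> 0 < e i" "\<And>i. i < n \<Longrightarrow> S \<inter> cball (pc i) (e i) \<subseteq> \<phi> i ` U i"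
    "\<And>p. p \<in> S \<Longrightarrow> - mink_inner c p \<le> T \<Longrightarrow> \<exists>i<n. dist (pc i) p < e i"
proof -
  have S_hyp: "S \<subseteq> hyp_space" using sub by (simp add: hyp_submanifold_def)
  let ?P = "\<lambda>p (U :: (real ^ 'k) set, \<phi> :: real ^ 'k \<Rightarrow> 'n mink, e). local_param S U \<phi> \<and> patch_volume \<phi> U < \<infinity> \<and>
    0 < e \<and> S \<inter> cball p e \<subseteq> \<phi> ` U"
  have "\<forall>p\<in>S. \<exists>t. ?P p t" using small_chart[OF sub] by simp
  from bchoice[OF this] obtain t where t: "\<forall>p\<in>S. ?P p (t p)" by (elim exE)
  define Uc where "Uc p = fst (t p)" for p
  define \<phi>c where "\<phi>c p = fst (snd (t p))" for p
  define ec where "ec p = snd (snd (t p))" for p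
  have tp: "local_param S (Uc p) (\<phi>c p)" "patch_volume (\<phi>c p) (Uc p) < \<infinity>" "0 < ec p" "S \<inter> cball p (ec p) \<subseteq> \<phi>c p ` Uc p"
    if "p \<in> S" for p
    using bspec[OF t that] by (simp_all add: Uc_def \<phi>c_def ec_def case_prod_beta)
  let ?K = "{p \<in> S. - mink_inner c p \<le> T}"
  have "?K \<subseteq> (\<Union>p\<in>?K. ball p (ec p))"
  proof
    fix p assume "p \<in> ?K"
    then show "p \<in> (\<Union>p\<in>?K. ball p (ec p))" using tp(3)[of p] by (intro UN_I[of p]) auto
  qed
  then obtain P where P: "P \<subseteq> ?K" "finite P" "?K \<subseteq> (\<Union>p\<in>P. ball p (ec p))"
    by (rule compactE_image[OF compact_sublevel[OF S S_hyp c], rotated]) auto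
  obtain pc where pc: "bij_betw pc {0..<card P} P" using ex_bij_betw_nat_finite[OF P(2)] by blast
  have pcS: "pc i \<in> S" if "i < card P" for i
  proof -
    have "pc i \<in> P" using pc that by (auto simp: bij_betw_def)
    then show ?thesis using P(1) by auto
  qed
  show thesis
  proof (rule that)
    show "chart_cover S (card P) (\<lambda>i. Uc (pc i)) (\<lambda>i. \<phi>c (pc i))"
      by unfold_locales (use S S_hyp tp pcS in auto)
    show "0 < ec (pc i)" "S \<inter> cball (pc i) (ec (pc i)) \<subseteq> \<phi>c (pc i) ` Uc (pc i)" if "i < card P" for i
      using tp[OF pcS[OF that]] by auto
    show "\<exists>i<card P. dist (pc i) p < ec (pc i)" if "p \<in> S" "- mink_inner c p \<le> T" for p
    proof -
      have "p \<in> (\<Union>p\<in>P. ball p (ec p))" using subsetD[OF P(3), of p] that by simp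
      then obtain p' where p': "p' \<in> P" "dist p' p < ec p'" by auto
      then have "p' \<in> pc ` {0..<card P}" using pc by (simp add: bij_betw_def)
      then show ?thesis using p'(2) by auto
    qed
  qed
qed

context minimal_chart_cover
begin

lemma stationary_measure_M:
  shows "stationary_measure M (\<lambda>p. - mink_inner c p) (q c) CARD('k) T"
proof (rule stationary_measure.intro[OF finite_measure_M stationary_measure_axioms.intro])
  show "(\<lambda>p. - mink_inner c p) \<in> borel_measurable M"
    unfolding measurable_cong_sets[OF sets_M refl]
    by (intro borel_measurable_continuous_onI continuous_on_minus continuous_on_mink_inner)
  show "q c \<in> borel_measurable M" unfolding measurable_cong_sets[OF sets_M refl] by (rule q_borel)
  show "0 < CARD('k)" by simp
  show "AE p in M. 1 \<le> - mink_inner c p"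
    using AE_M
  proof (rule AE_mp, intro AE_I2 impI)
    fix p assume "p \<in> (\<Union>i<n. W i)"
    then have "p \<in> hyp_space" using W_subset S_hyp by auto
    then show "1 \<le> - mink_inner c p" by (rule hyp_space_inner_ge_1[OF c])
  qed
  show "AE p in M. 0 \<le> q c p \<and> q c p \<le> (- mink_inner c p)\<^sup>2 - 1"
    using AE_M by (rule AE_mp) (intro AE_I2 impI q_bounds[OF c])
  show "(\<integral>p. h' (- mink_inner c p) * q c p + real CARD('k) * (- mink_inner c p) * h (- mink_inner c p) \<partial>M) = 0"
    if "\<And>s. (h has_real_derivative h' s) (at s)" "continuous_on UNIV h'" "\<And>s. T \<le> s \<Longrightarrow> h s = 0" for h h'
    by (rule stationary_identity[OF that])
qed

lemma A_vol_eq: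
  assumes s: "s \<le> T"
  shows "A_vol TYPE('k) S c s = measure M {p \<in> space M. - mink_inner c p \<le> s}"
proof -
  have eq: "sublevel S c s = {p \<in> S. - mink_inner c p \<le> s}"
    unfolding sublevel_def using cosh_hyp_dist(1)[OF c] S_hyp by auto
  have closed: "closed (sublevel S c s)"
    unfolding eq using compact_sublevel[OF closed_S S_hyp c] by (rule compact_imp_closed)
  have sub: "sublevel S c s \<subseteq> (\<Union>i<n. W i)"
  proof
    fix p assume "p \<in> sublevel S c s"
    then have p: "p \<in> S" "- mink_inner c p \<le> T" using s by (auto simp: eq)
    then obtain i where "i < n" "dist (pc i) p < e i" using cover[OF p] by auto
    then show "p \<in> (\<Union>i<n. W i)" using e(2)[of i] p(1) by auto
  qed
  have "A_vol TYPE('k) S c s = measure M (sublevel S c s)"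
    unfolding A_vol_def measure_def using volume_eq_M[OF _ sub] closed by simp
  also have "\<dots> = measure M {p \<in> space M. - mink_inner c p \<le> s}"
  proof (rule measure_eq_AE)
    show "AE p in M. p \<in> sublevel S c s \<longleftrightarrow> p \<in> {p \<in> space M. - mink_inner c p \<le> s}"
      using AE_M
    proof (rule AE_mp, intro AE_I2 impI)
      fix p assume "p \<in> (\<Union>i<n. W i)"
      then have "p \<in> S" using W_subset by auto
      then show "p \<in> sublevel S c s \<longleftrightarrow> p \<in> {p \<in> space M. - mink_inner c p \<le> s}" by (simp add: eq)
    qed
    show "sublevel S c s \<in> sets M" using closed by simp
    have "closed {p. - mink_inner c p \<le> s}"
      by (intro closed_Collect_le continuous_on_minus continuous_on_mink_inner continuous_on_const)
    then show "{p \<in> space M. - mink_inner c p \<le> s} \<in> sets M" by simp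
  qed
  finally show ?thesis .
qed

end

theorem theorem1p1:
  fixes S :: "'n::finite mink set" and c :: "'n mink" and a d :: real
  assumes "minimal_submanifold TYPE('k::finite) S"
    and "closed S"
    and "S \<noteq> {}"
    and "c \<in> hyp_space"
    and "d = hyp_dist_set c S"
    and "a \<in> {1..cosh d}"
  shows "mono_on {t. 1 \<le> t \<and> Q_hyp CARD('k) a t \<noteq> 0} (\<lambda>t. \<Phi>_hyp TYPE('k) S c a t)"
proof (rule mono_onI)
  fix r t assume r: "r \<in> {t. 1 \<le> t \<and> Q_hyp CARD('k) a t \<noteq> 0}" and t: "t \<in> {t. 1 \<le> t \<and> Q_hyp CARD('k) a t \<noteq> 0}"
    and rt: "r \<le> t"
  have sub: "hyp_submanifold TYPE('k) S" using assms(1) by (simp add: minimal_submanifold_def)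
  have mean: "mean_curvature \<phi> x = 0" if "local_param S U \<phi>" "x \<in> U" for U and \<phi> :: "real ^ 'k \<Rightarrow> 'n mink" and x
    using assms(1) that by (auto simp: minimal_submanifold_def)
  have S_hyp: "S \<subseteq> hyp_space" using sub by (simp add: hyp_submanifold_def)
  have a: "1 \<le> a" "\<And>p. p \<in> S \<Longrightarrow> a \<le> - mink_inner c p"
    using assms(6) hyp_dist_set_le[OF assms(4) S_hyp] unfolding assms(5) by force+
  obtain n and U :: "nat \<Rightarrow> (real ^ 'k) set" and \<phi> :: "nat \<Rightarrow> real ^ 'k \<Rightarrow> 'n mink" and pc e
    where cov: "chart_cover S n U \<phi>" and e: "\<And>i. i < n \<Longrightarrow> 0 < e i" "\<And>i. i < n \<Longrightarrow> S \<inter> cball (pc i) (e i) \<subseteq> \<phi> i ` U i"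
      and cover: "\<And>p. p \<in> S \<Longrightarrow> - mink_inner c p \<le> t \<Longrightarrow> \<exists>i<n. dist (pc i) p < e i"
    by (rule finite_chart_cover[OF sub assms(2,4), of t]) (rule that)
  interpret chart_cover S n U \<phi> by (rule cov)
  interpret minimal_chart_cover S n U \<phi> c pc e t
    by unfold_locales (use assms(4) mean[OF params] e cover in \<open>simp_all add: W_def\<close>)
  interpret sm: stationary_measure M "\<lambda>p. - mink_inner c p" "q c" "CARD('k)" t
    by (rule stationary_measure_M)
  have AE_a: "AE p in M. a \<le> - mink_inner c p"
    using AE_M
  proof (rule AE_mp, intro AE_I2 impI)
    fix p assume "p \<in> (\<Union>i<n. W i)"
    then have "p \<in> S" using W_subset by auto
    then show "a \<le> - mink_inner c p" by (rule a(2))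
  qed
  have A_zero: "A_vol TYPE('k) S c s = 0" if "s \<le> t" "s < a" for s
  proof -
    have "measure M {p \<in> space M. - mink_inner c p \<le> s} = measure M {}"
    proof (rule measure_eq_AE)
      show "AE p in M. p \<in> {p \<in> space M. - mink_inner c p \<le> s} \<longleftrightarrow> p \<in> {}"
        using AE_a by (rule AE_mp) (use that(2) in auto)
      show "{p \<in> space M. - mink_inner c p \<le> s} \<in> sets M"
        by (intro borel_measurable_le sm.f_meas borel_measurable_const)
    qed simp
    then show ?thesis using A_vol_eq[OF that(1)] by simp
  qed
  show "\<Phi>_hyp TYPE('k) S c a r \<le> \<Phi>_hyp TYPE('k) S c a t"
  proof (cases "a \<le> r")
    case True
    then show ?thesis
      using sm.ratio_mono[OF a(1) AE_a True rt order_refl] r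
      unfolding \<Phi>_hyp_def A_vol_eq[OF rt] A_vol_eq[OF order_refl] sm.A_def by simp
  next
    case False
    then have "\<Phi>_hyp TYPE('k) S c a r = 0" using A_zero[OF rt] by (simp add: \<Phi>_hyp_def)
    also have "0 \<le> \<Phi>_hyp TYPE('k) S c a t"
    proof (cases "a \<le> t")
      case True
      have "0 \<le> integral {a..t} (\<lambda>s. (s\<^sup>2 - 1) powr (real CARD('k) / 2) / s\<^sup>2)"
        using Q_hyp_eq_integral(1)[OF sm.k_pos a(1) True]
        by (intro integral_nonneg integrable_continuous_real) auto
      then have "0 \<le> real CARD('k) * Q_hyp CARD('k) a t"
        unfolding Q_hyp_eq_integral(2)[OF sm.k_pos a(1) True] using True a(1) by simp
      then have "0 \<le> Q_hyp CARD('k) a t" by (simp add: zero_le_mult_iff)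
      then show ?thesis by (simp add: \<Phi>_hyp_def A_vol_def)
    next
      case False
      then show ?thesis using A_zero[of t] by (simp add: \<Phi>_hyp_def)
    qed
    finally show ?thesis .
  qed
qed

end
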